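(* Let $d\ge1$ and let $\Gamma$ be a finite graph. If $\Gamma$ is not generically globally rigid in $\mathbb{E}^d$, then any generic framework $\rho$ in $C^d(\Gamma)$ can be connected to some framework $\sigma$ in $C^d(\Gamma)$ incongruent to $\rho$ by a path of frameworks of $\Gamma$ in $\mathbb{E}^{d+1}$ with constant edge lengths.
   Context: A graph $\Gamma$ has a finite vertex set $\mathcal V$ of size $v$ and an edge set $\mathcal E$ of two-element subsets of $\mathcal V$. A framework of $\Gamma$ in $\mathbb{E}^d$ is a map $\mathcal V\to\mathbb{E}^d$; $C^d(\Gamma)\cong\mathbb{R}^{vd}$ is the space of all of them. Frameworks in $\mathbb{E}^d$ are regarded as frameworks in $\mathbb{E}^{d+1}$ by embedding $\mathbb{E}^d$ as the first $d$ coordinates of $\mathbb{E}^{d+1}$. Frameworks in $C^d(\Gamma)$ are congruent if they differ by a rigid motion (possibly with reflection) of $\mathbb{E}^d$. $\rho$ is globally rigid if every framework $\sigma\in C^d(\Gamma)$ with the same edge lengths as $\rho$ is congruent to $\rho$. $\rho$ is generic if its $vd$ coordinates satisfy no non-trivial polynomial equation with rational coefficients. It is known that either all generic frameworks in $C^d(\Gamma)$ are globally rigid or none are; $\Gamma$ is called generically globally rigid in $\mathbb{E}^d$ in the former case. *)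

theory Defs
  imports "HOL-Analysis.Analysis" "HOL-Library.Poly_Mapping"
begin

text \<open>
  The vertex set is a finite type \<open>'v\<close>, and a graph is given by its edge set.  The dimension is
  \<open>d = CARD('n)\<close> for a finite type \<open>'n\<close> of coordinate indices.
\<close>

definition graph :: "'v::finite set set \<Rightarrow> bool" where
  "graph E \<longleftrightarrow> (\<forall>e\<in>E. card e = 2)"

text \<open>The space of all frameworks; it carries the Euclidean topology of dimension \<open>d * CARD('v)\<close>.\<close>

type_synonym ('n, 'v) framework = "(real, 'n) vec ^ 'v"

definition same_edge_lengths ::
  "'v::finite set set \<Rightarrow> ('n::finite, 'v) framework \<Rightarrow> ('n, 'v) framework \<Rightarrow> bool" where
  "same_edge_lengths E \<rho> \<sigma> \<longleftrightarrow>
     (\<forall>u w. {u, w} \<in> E \<longrightarrow> dist (\<rho> $ u) (\<rho> $ w) = dist (\<sigma> $ u) (\<sigma> $ w))"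

text \<open>Orthogonal transformations may have determinant \<open>-1\<close>, so reflections are included.\<close>

definition congruent_frameworks ::
  "('n::finite, 'v::finite) framework \<Rightarrow> ('n, 'v) framework \<Rightarrow> bool" where
  "congruent_frameworks \<rho> \<sigma> \<longleftrightarrow>
     (\<exists>T a. orthogonal_transformation T \<and> (\<forall>v. \<sigma> $ v = a + T (\<rho> $ v)))"

definition globally_rigid :: "'v::finite set set \<Rightarrow> ('n::finite, 'v) framework \<Rightarrow> bool" where
  "globally_rigid E \<rho> \<longleftrightarrow> (\<forall>\<sigma>. same_edge_lengths E \<sigma> \<rho> \<longrightarrow> congruent_frameworks \<rho> \<sigma>)"

text \<open>
  Polynomials with rational coefficients in a finite set of variables \<open>'x\<close>: finitely supported
  maps from monomials (that is, exponent vectors) to coefficients.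
\<close>

type_synonym 'x rat_mpoly = "('x \<Rightarrow>\<^sub>0 nat) \<Rightarrow>\<^sub>0 rat"

definition eval_mpoly :: "'x::finite rat_mpoly \<Rightarrow> ('x \<Rightarrow> real) \<Rightarrow> real" where
  "eval_mpoly p x =
     (\<Sum>m\<in>Poly_Mapping.keys p.
        of_rat (Poly_Mapping.lookup p m) * (\<Prod>i\<in>UNIV. x i ^ Poly_Mapping.lookup m i))"

definition generic_framework :: "('n::finite, 'v::finite) framework \<Rightarrow> bool" where
  "generic_framework \<rho> \<longleftrightarrow>
     (\<forall>p :: ('v \<times> 'n) rat_mpoly. p \<noteq> 0 \<longrightarrow> eval_mpoly p (\<lambda>(v, i). \<rho> $ v $ i) \<noteq> 0)"

definition generically_globally_rigid ::
  "'n::finite itself \<Rightarrow> 'v::finite set set \<Rightarrow> bool" where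
  "generically_globally_rigid (_ :: 'n itself) E \<longleftrightarrow>
     (\<forall>\<rho> :: ('n, 'v) framework. generic_framework \<rho> \<longrightarrow> globally_rigid E \<rho>)"

text \<open>
  Euclidean \<open>(d+1)\<close>-space has coordinate indices \<open>'n option\<close>: the indices \<open>Some i\<close> are the first
  \<open>d\<close> coordinates and \<open>None\<close> is the last one.
\<close>

definition embed_framework ::
  "('n::finite, 'v::finite) framework \<Rightarrow> ('n option, 'v) framework" where
  "embed_framework \<rho> = (\<chi> v i. case i of None \<Rightarrow> 0 | Some j \<Rightarrow> \<rho> $ v $ j)"

definition connected_with_constant_lengths ::
  "'v::finite set set \<Rightarrow> ('n::finite, 'v) framework \<Rightarrow> ('n, 'v) framework \<Rightarrow> bool" where
  "connected_with_constant_lengths E \<rho> \<sigma> \<longleftrightarrow>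
     (\<exists>\<gamma>. path \<gamma> \<and> pathstart \<gamma> = \<rho> \<and> pathfinish \<gamma> = \<sigma> \<and>
          (\<forall>t\<in>{0..1}. same_edge_lengths E (\<gamma> t) \<rho>))"

end

theory Submission
  imports Defs "HOL-Computational_Algebra.Polynomial"
begin

text \<open>
  Let \<open>K\<close> be the space of functions on the vertices that are annihilated by all equilibrium stresses
  of \<open>\<rho>\<close>.  It contains the restrictions of the affine functions.

  If \<open>K\<close> contains nothing else, then \<open>\<rho>\<close> cannot be infinitesimally rigid: otherwise, as ranks agree at
  all generic frameworks, Connelly's theorem would make every generic framework globally rigid.  An
  infinitesimal flex has its coordinates in \<open>K\<close>, so it is an affine image of \<open>\<rho>\<close>, the edge directions
  lie on a conic, and \<open>\<rho>\<close> has an affine flex even in dimension \<open>d\<close>.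

  If \<open>K\<close> is larger, one may add edges without changing \<open>K\<close> until \<open>\<rho>\<close> is infinitesimally rigid.  For a
  suitable \<open>w \<in> K\<close>, the frameworks in dimension \<open>d + 1\<close> with the edge lengths of \<open>\<rho>\<close> whose first \<open>d\<close>
  coordinates lie in \<open>K\<close>, in triangular position, and whose last coordinate is \<open>t w\<close> with \<open>t \<ge> 0\<close> form
  a compact curve with boundary \<open>t = 0\<close>.  The component of \<open>\<rho>\<close> is an arc, which ends at another
  framework \<open>\<sigma>\<close> of dimension \<open>d\<close>.  If \<open>\<sigma>\<close> were congruent to \<open>\<rho>\<close>, then a coordinate reflection would map
  the arc to itself exchanging its ends, and a fixed point would be a singular point of the curve.

  Genericity enters through derivations of the field of real numbers: as the coordinates of \<open>\<rho>\<close> are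
  algebraically independent, some derivation takes any prescribed values on them, and applying it
  to polynomial relations that hold at \<open>\<rho>\<close> replaces the use of Sard's theorem and of elimination.
\<close>


section \<open>Algebraically independent points\<close>

text \<open>Why a curve: with isometries factored out, the differential of the squared edge lengths
  at the rotated framework \<open>\<tau>\<close> is injective on the slice \<open>G\<close>, and all
  products of two functions in \<open>K\<close> lie in its image \<open>W\<close>. So the length
  equations take values in a space of dimension \<open>dim G\<close>, and the height parameter
  \<open>t\<close> is exactly one extra unknown. Regularity is needed at every solution, not only
  near \<open>\<rho>\<close>. Derivations give this because they act on all reals, so they can be
  applied to any solution. For this \<open>w\<close> must be a constant of the derivations used,
  which is why it is taken from a basis normalised by entries 0 and 1. Triangular position leaves
  only coordinate sign changes as symmetries, so a congruent end of the arc comes from one of them.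
  A solution with a vanishing coordinate would be singular because that coordinate can be moved
  along every function in \<open>K\<close> that respects the triangular shape; two independent such
  functions exist as \<open>K\<close> is larger than the affine functions.\<close>

definition rat_poly_fun :: "(('x::finite \<Rightarrow> real) \<Rightarrow> real) \<Rightarrow> bool" where
  "rat_poly_fun f \<longleftrightarrow> (\<exists>p. f = eval_mpoly p)"

lemma eval_mpoly_superset:
  fixes p :: "'x::finite rat_mpoly"
  assumes "finite S" "Poly_Mapping.keys p \<subseteq> S"
  shows "eval_mpoly p x =
    (\<Sum>m\<in>S. of_rat (Poly_Mapping.lookup p m) * (\<Prod>i\<in>UNIV. x i ^ Poly_Mapping.lookup m i))"
  unfolding eval_mpoly_def
  by (rule sum.mono_neutral_left) (use assms in \<open>auto simp: in_keys_iff\<close>)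

lemma eval_mpoly_add: "eval_mpoly (p + q) x = eval_mpoly p x + eval_mpoly q x"
proof -
  let ?S = "Poly_Mapping.keys p \<union> Poly_Mapping.keys q"
  have "finite ?S" by simp
  moreover have "Poly_Mapping.keys (p + q) \<subseteq> ?S" by (rule Poly_Mapping.keys_add)
  ultimately show ?thesis
    by (simp add: eval_mpoly_superset[of ?S] lookup_add of_rat_add distrib_right sum.distrib)
qed

lemma eval_mpoly_single:
  "eval_mpoly (Poly_Mapping.single m c) x = of_rat c * (\<Prod>i\<in>UNIV. x i ^ Poly_Mapping.lookup m i)"
  by (subst eval_mpoly_superset[of "{m}"]) auto

lemma rat_poly_fun_monomial:
  "rat_poly_fun (\<lambda>x. of_rat c * (\<Prod>i\<in>UNIV. x i ^ Poly_Mapping.lookup m i))"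
  unfolding rat_poly_fun_def by (rule exI[of _ "Poly_Mapping.single m c"]) (auto simp: eval_mpoly_single)

lemma rat_poly_fun_const: "rat_poly_fun (\<lambda>x. of_rat c)"
  using rat_poly_fun_monomial[of c 0] by simp

lemma rat_poly_fun_0: "rat_poly_fun (\<lambda>x. 0)"
  using rat_poly_fun_const[of 0] by simp

lemma rat_poly_fun_1: "rat_poly_fun (\<lambda>x. 1)"
  using rat_poly_fun_const[of 1] by simp

lemma rat_poly_fun_var: "rat_poly_fun (\<lambda>x. x i)"
proof -
  have "x j ^ Poly_Mapping.lookup (Poly_Mapping.single i 1) j = (if j = i then x j else 1)"
    for x :: "'a \<Rightarrow> real" and j
    by (simp add: lookup_single)
  then have "(\<Prod>j\<in>UNIV. x j ^ Poly_Mapping.lookup (Poly_Mapping.single i 1) j) = x i"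
    for x :: "'a \<Rightarrow> real"
    by simp
  then show ?thesis
    using rat_poly_fun_monomial[of 1 "Poly_Mapping.single i 1"] by simp
qed

lemma rat_poly_fun_add:
  "rat_poly_fun f \<Longrightarrow> rat_poly_fun g \<Longrightarrow> rat_poly_fun (\<lambda>x. f x + g x)"
  unfolding rat_poly_fun_def fun_eq_iff by (elim exE, rule exI, simp add: eval_mpoly_add[symmetric], rule allI, rule refl)

lemma rat_poly_fun_sum:
  assumes "\<And>j. j \<in> J \<Longrightarrow> rat_poly_fun (f j)"
  shows "rat_poly_fun (\<lambda>x. \<Sum>j\<in>J. f j x)"
  using assms
  by (induction J rule: infinite_finite_induct) (auto simp: rat_poly_fun_0 intro: rat_poly_fun_add)

lemma rat_poly_fun_mult:
  fixes f g :: "('x::finite \<Rightarrow> real) \<Rightarrow> real"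
  assumes "rat_poly_fun f" "rat_poly_fun g"
  shows "rat_poly_fun (\<lambda>x. f x * g x)"
proof -
  obtain p q where f: "f = eval_mpoly p" and g: "g = eval_mpoly q"
    using assms unfolding rat_poly_fun_def by auto
  have "f x * g x = (\<Sum>m\<in>Poly_Mapping.keys p. \<Sum>n\<in>Poly_Mapping.keys q.
      of_rat (Poly_Mapping.lookup p m * Poly_Mapping.lookup q n) *
      (\<Prod>i\<in>UNIV. x i ^ Poly_Mapping.lookup (m + n) i))" for x
    unfolding f g eval_mpoly_def sum_product
    by (intro sum.cong refl) (simp add: of_rat_mult lookup_add power_add prod.distrib)
  then show ?thesis
    by (simp add: rat_poly_fun_sum rat_poly_fun_monomial)
qed

lemma rat_poly_fun_uminus: "rat_poly_fun f \<Longrightarrow> rat_poly_fun (\<lambda>x. - f x)"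
  using rat_poly_fun_mult[OF rat_poly_fun_const[of "-1"], of f] by simp

lemma rat_poly_fun_diff:
  "rat_poly_fun f \<Longrightarrow> rat_poly_fun g \<Longrightarrow> rat_poly_fun (\<lambda>x. f x - g x)"
  using rat_poly_fun_add[OF _ rat_poly_fun_uminus, of f g] by simp

lemmas rat_poly_fun_intros =
  rat_poly_fun_0 rat_poly_fun_1 rat_poly_fun_var rat_poly_fun_add rat_poly_fun_sum rat_poly_fun_mult
  rat_poly_fun_uminus rat_poly_fun_diff

definition alg_indep :: "('x::finite \<Rightarrow> real) \<Rightarrow> bool" where
  "alg_indep x \<longleftrightarrow> (\<forall>p. p \<noteq> 0 \<longrightarrow> eval_mpoly p x \<noteq> 0)"

lemma alg_indep_zero:
  assumes "alg_indep x" "rat_poly_fun f" "f x = 0"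
  shows "f y = 0"
proof -
  obtain p where f: "f = eval_mpoly p" using assms(2) unfolding rat_poly_fun_def by auto
  then have "p = 0" using assms unfolding alg_indep_def by auto
  then show ?thesis by (simp add: f eval_mpoly_def)
qed

text \<open>
  Gaussian elimination without division: the eliminated family is again polynomial, so a linear
  relation at an algebraically independent point forces one at every point.
\<close>

lemma alg_indep_linear_indep:
  fixes v :: "'j \<Rightarrow> ('x::finite \<Rightarrow> real) \<Rightarrow> 'b::euclidean_space"
  assumes "alg_indep x" "finite J"
    and "\<And>j b. j \<in> J \<Longrightarrow> b \<in> Basis \<Longrightarrow> rat_poly_fun (\<lambda>z. v j z \<bullet> b)"
    and "\<And>a. (\<Sum>j\<in>J. a j *\<^sub>R v j y) = 0 \<Longrightarrow> \<forall>j\<in>J. a j = 0"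
    and "(\<Sum>j\<in>J. a j *\<^sub>R v j x) = 0"
  shows "\<forall>j\<in>J. a j = 0"
  using assms(2-)
proof (induction J arbitrary: v a rule: finite_induct)
  case empty
  then show ?case by simp
next
  case (insert k J)
  have "v k y \<noteq> 0"
  proof
    assume "v k y = 0"
    then have "(\<Sum>j\<in>insert k J. (if j = k then 1 else 0) *\<^sub>R v j y) = 0"
      using insert by (auto intro!: sum.neutral)
    from insert.prems(2)[OF this] show False by auto
  qed
  then obtain c where c: "c \<in> Basis" "v k y \<bullet> c \<noteq> 0"
    using euclidean_all_zero_iff by blast
  have kx: "v k x \<bullet> c \<noteq> 0"
    using alg_indep_zero[OF assms(1) insert.prems(1)[of k c]] c by auto
  define w where "w j z = (v k z \<bullet> c) *\<^sub>R v j z - (v j z \<bullet> c) *\<^sub>R v k z" for j z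
  have comb: "(\<Sum>j\<in>J. b j *\<^sub>R w j z) =
      (v k z \<bullet> c) *\<^sub>R (\<Sum>j\<in>J. b j *\<^sub>R v j z) - ((\<Sum>j\<in>J. b j *\<^sub>R v j z) \<bullet> c) *\<^sub>R v k z" for b z
    unfolding w_def scaleR_diff_right sum_subtractf scaleR_sum_right inner_sum_left scaleR_sum_left
    by (simp add: mult.commute)
  have "\<forall>j\<in>J. b j = 0" if "(\<Sum>j\<in>J. b j *\<^sub>R w j y) = 0" for b
  proof -
    let ?b = "\<lambda>j. if j = k then - ((\<Sum>j\<in>J. b j *\<^sub>R v j y) \<bullet> c) else (v k y \<bullet> c) * b j"
    have "(\<Sum>j\<in>J. ?b j *\<^sub>R v j y) = (v k y \<bullet> c) *\<^sub>R (\<Sum>j\<in>J. b j *\<^sub>R v j y)"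
      using insert.hyps by (auto simp: scaleR_sum_right intro!: sum.cong)
    then have "(\<Sum>j\<in>insert k J. ?b j *\<^sub>R v j y) = 0"
      using that insert.hyps unfolding comb by simp
    from insert.prems(2)[OF this] have "\<forall>j\<in>J. (v k y \<bullet> c) * b j = 0"
      using insert.hyps by (metis insertCI)
    then show ?thesis using c by simp
  qed
  moreover have "rat_poly_fun (\<lambda>z. w j z \<bullet> b)" if "j \<in> J" "b \<in> Basis" for j b
    unfolding w_def inner_diff_left inner_scaleR_left
    by (intro rat_poly_fun_intros insert.prems(1)) (use that c in auto)
  moreover have "(\<Sum>j\<in>J. a j *\<^sub>R w j x) = 0"
  proof -
    have "(\<Sum>j\<in>J. a j *\<^sub>R v j x) = - a k *\<^sub>R v k x"
      using insert.prems(3) insert.hyps by (simp add: eq_neg_iff_add_eq_0 add.commute)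
    then show ?thesis unfolding comb by simp
  qed
  ultimately have J0: "\<forall>j\<in>J. a j = 0"
    using insert.IH[of w a] by blast
  then have "a k *\<^sub>R v k x = 0"
    using insert.prems(3) insert.hyps by simp
  then have "a k = 0" using kx by auto
  with J0 show ?case by simp
qed

lemma family_independent:
  fixes f :: "'j \<Rightarrow> 'a::euclidean_space"
  assumes "finite J" "\<And>a. (\<Sum>j\<in>J. a j *\<^sub>R f j) = 0 \<Longrightarrow> \<forall>j\<in>J. a j = 0"
  shows "inj_on f J" "independent (f ` J)"
proof -
  show inj: "inj_on f J"
  proof (rule inj_onI)
    fix i j assume ij: "i \<in> J" "j \<in> J" "f i = f j"
    show "i = j"
    proof (rule ccontr)
      assume "i \<noteq> j"
      let ?a = "\<lambda>k. if k = i then 1 else if k = j then -1 else (0::real)"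
      have "(\<Sum>k\<in>J. ?a k *\<^sub>R f k) = (\<Sum>k\<in>{i,j}. ?a k *\<^sub>R f k)"
        by (rule sum.mono_neutral_right) (use ij assms(1) in auto)
      also have "\<dots> = 0" using ij \<open>i \<noteq> j\<close> by simp
      finally show False using assms(2)[of ?a] ij by force
    qed
  qed
  show "independent (f ` J)"
    unfolding dependent_finite[OF finite_imageI[OF assms(1)]]
  proof clarify
    fix u j
    assume "(\<Sum>v\<in>f ` J. u v *\<^sub>R v) = 0" "j \<in> J" "u (f j) \<noteq> 0"
    then show False
      using assms(2)[of "\<lambda>j. u (f j)"] inj by (auto simp: sum.reindex)
  qed
qed

text \<open>Basis vectors whose images under \<open>L y\<close> are independent keep independent
  images under \<open>L x\<close>, by the elimination lemma. So linear systems with polynomial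
  coefficients have maximal rank at a generic point, and generic ranks agree.\<close>

lemma alg_indep_rank:
  fixes L :: "('x::finite \<Rightarrow> real) \<Rightarrow> 'a::euclidean_space \<Rightarrow> 'b::euclidean_space"
  assumes x: "alg_indep x"
    and lin: "\<And>z. linear (L z)"
    and pol: "\<And>a b. a \<in> Basis \<Longrightarrow> b \<in> Basis \<Longrightarrow> rat_poly_fun (\<lambda>z. L z a \<bullet> b)"
  shows "dim (range (L y)) \<le> dim (range (L x))"
proof -
  have rng: "range (L z) = span (L z ` Basis)" for z
    by (metis lin linear_span_image span_Basis)
  obtain C where C: "C \<subseteq> L y ` Basis" "independent C" "span C = span (L y ` Basis)"
    using maximal_independent_subset[of "L y ` Basis"] by (metis span_eq span_superset subset_trans)
  then obtain J where J: "J \<subseteq> Basis" "inj_on (L y) J" "C = L y ` J"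
    by (meson subset_image_inj)
  have finJ: "finite J" using finite_subset[OF J(1) finite_Basis] .
  have "\<forall>j\<in>J. a j = 0" if "(\<Sum>j\<in>J. a j *\<^sub>R L y j) = 0" for a
  proof -
    have "(\<Sum>c\<in>C. a (the_inv_into J (L y) c) *\<^sub>R c) = 0"
      using that J by (simp add: sum.reindex the_inv_into_f_f)
    moreover have "finite C" using finJ J by simp
    ultimately have "\<forall>c\<in>C. a (the_inv_into J (L y) c) = 0"
      using C(2) independent_explicit by (auto simp: dependent_finite)
    then show ?thesis using J by (simp add: the_inv_into_f_f)
  qed
  then have ind: "\<forall>j\<in>J. a j = 0" if "(\<Sum>j\<in>J. a j *\<^sub>R L x j) = 0" for a
    using alg_indep_linear_indep[OF x finJ, of "\<lambda>j z. L z j" y a] pol J that by blast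
  have inj: "inj_on (L x) J" and "independent (L x ` J)"
    using family_independent[OF finJ, of "L x"] ind by blast+
  then have "card J \<le> dim (range (L x))"
    using inj by (metis card_image independent_card_le_dim image_mono subset_UNIV)
  moreover have "dim (range (L y)) = card J"
    using C J by (metis card_image dim_eq_card_independent dim_span rng)
  ultimately show ?thesis by simp
qed


section \<open>Derivations of the reals\<close>

definition derivation :: "(real \<Rightarrow> real) \<Rightarrow> bool" where
  "derivation D \<longleftrightarrow> (\<forall>x y. D (x + y) = D x + D y) \<and> (\<forall>x y. D (x * y) = x * D y + D x * y)"

text \<open>
  The graph of a derivation on a subring of the reals, seen as a subring of the dual numbers
  that meets the ideal of infinitesimals only in 0.
\<close>

definition dual_subring :: "(real \<times> real) set \<Rightarrow> bool" where
  "dual_subring G \<longleftrightarrow> (1, 0) \<in> G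
     \<and> (\<forall>a a' b b'. (a, a') \<in> G \<longrightarrow> (b, b') \<in> G \<longrightarrow> (a + b, a' + b') \<in> G \<and> (a * b, a * b' + a' * b) \<in> G)
     \<and> (\<forall>a a'. (a, a') \<in> G \<longrightarrow> (- a, - a') \<in> G)
     \<and> (\<forall>a'. (0, a') \<in> G \<longrightarrow> a' = 0)"

context
  fixes G assumes G: "dual_subring G"
begin

lemma ds_add: "(a, a') \<in> G \<Longrightarrow> (b, b') \<in> G \<Longrightarrow> (a + b, a' + b') \<in> G"
  and ds_mult: "(a, a') \<in> G \<Longrightarrow> (b, b') \<in> G \<Longrightarrow> (a * b, a * b' + a' * b) \<in> G"
  and ds_minus: "(a, a') \<in> G \<Longrightarrow> (- a, - a') \<in> G"
  and ds_zeroD: "(0, a') \<in> G \<Longrightarrow> a' = 0"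
  and ds_1: "(1, 0) \<in> G"
  using G unfolding dual_subring_def by blast+

lemma ds_0: "(0, 0) \<in> G"
  using ds_add[OF ds_1 ds_minus[OF ds_1]] by simp

lemma ds_of_nat: "(of_nat n, 0) \<in> G"
  by (induction n) (use ds_0 ds_add ds_1 in force)+

lemma ds_sum: "(\<And>i. i \<in> I \<Longrightarrow> (f i, f' i) \<in> G) \<Longrightarrow> (sum f I, sum f' I) \<in> G"
  by (induction I rule: infinite_finite_induct) (auto intro: ds_0 ds_add)

lemma ds_unique: "(a, b) \<in> G \<Longrightarrow> (a, c) \<in> G \<Longrightarrow> b = c"
  using ds_add[of a b "- a" "- c"] ds_minus[of a c] ds_zeroD[of "b - c"] by simp

text \<open>The pair stands for the polynomial \<open>p + e p'\<close>, \<open>e\<close>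
  infinitesimal, with coefficients in the dual subring; \<open>dual_eval\<close> is the
  infinitesimal part of its value at \<open>x + e y\<close>.\<close>

definition dual_poly :: "real poly \<Rightarrow> real poly \<Rightarrow> bool" where
  "dual_poly p p' \<longleftrightarrow> (\<forall>i. (coeff p i, coeff p' i) \<in> G)"

lemma dual_poly_add: "dual_poly p p' \<Longrightarrow> dual_poly q q' \<Longrightarrow> dual_poly (p + q) (p' + q')"
  unfolding dual_poly_def by (simp add: ds_add)

lemma dual_poly_minus: "dual_poly p p' \<Longrightarrow> dual_poly (- p) (- p')"
  unfolding dual_poly_def by (simp add: ds_minus)

lemma dual_poly_mult:
  assumes "dual_poly p p'" "dual_poly q q'"
  shows "dual_poly (p * q) (p * q' + p' * q)"
proof -
  have "(\<Sum>i\<le>n. coeff p i * coeff q (n - i),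
         \<Sum>i\<le>n. coeff p i * coeff q' (n - i) + coeff p' i * coeff q (n - i)) \<in> G" for n
    by (rule ds_sum) (use assms in \<open>auto simp: dual_poly_def intro: ds_mult\<close>)
  then show ?thesis
    by (simp add: dual_poly_def coeff_mult sum.distrib)
qed

lemma dual_poly_const: "(a, a') \<in> G \<Longrightarrow> dual_poly [:a:] [:a':]"
  by (auto simp: dual_poly_def coeff_pCons ds_0 split: nat.split)

lemma dual_poly_monom: "dual_poly (monom 1 k) 0"
  by (auto simp: dual_poly_def coeff_monom ds_0 ds_1)

lemma dual_poly_pderiv: "dual_poly p p' \<Longrightarrow> dual_poly (pderiv p) (pderiv p')"
proof -
  assume "dual_poly p p'"
  then have "(of_nat (Suc i) * coeff p (Suc i), of_nat (Suc i) * coeff p' (Suc i)) \<in> G" for i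
    using ds_mult[OF ds_of_nat[of "Suc i"], of "coeff p (Suc i)" "coeff p' (Suc i)"]
    by (simp add: dual_poly_def)
  then show ?thesis by (simp add: dual_poly_def coeff_pderiv)
qed

definition dual_eval :: "real \<Rightarrow> real \<Rightarrow> real poly \<Rightarrow> real poly \<Rightarrow> real" where
  "dual_eval x y p p' = poly p' x + poly (pderiv p) x * y"

lemma dual_eval_mult:
  "dual_eval x y (p * q) (p * q' + p' * q) = poly p x * dual_eval x y q q' + dual_eval x y p p' * poly q x"
  by (simp add: dual_eval_def pderiv_mult algebra_simps)

text \<open>Pseudo-division by \<open>f\<close>, an annihilator of \<open>x\<close> of least degree:
  the coefficients lie only in a ring, so the leading term of \<open>p\<close> is cancelled after
  multiplying by the nonzero leading coefficient of \<open>f\<close>.\<close>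

lemma dual_eval_vanishes:
  assumes f: "dual_poly f f'" "poly f x = 0" "f \<noteq> 0" "dual_eval x y f f' = 0"
    and min: "\<And>p p'. dual_poly p p' \<Longrightarrow> poly p x = 0 \<Longrightarrow> p \<noteq> 0 \<Longrightarrow> degree f \<le> degree p"
    and p: "dual_poly p p'" "poly p x = 0"
  shows "dual_eval x y p p' = 0"
  using p
proof (induction "degree p" arbitrary: p p' rule: less_induct)
  case less
  show ?case
  proof (cases "p = 0")
    case True
    then have "coeff p' i = 0" for i
      using less.prems ds_zeroD by (auto simp: dual_poly_def)
    then have "p' = 0" by (simp add: poly_eq_iff)
    with True show ?thesis by (simp add: dual_eval_def)
  next
    case False
    define k where "k = degree p - degree f"
    define a where "a = lead_coeff f"
    define a' where "a' = coeff f' (degree f)"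
    define b where "b = lead_coeff p"
    define b' where "b' = coeff p' (degree p)"
    have deg: "degree f \<le> degree p" using min less.prems False by blast
    have "degree f \<noteq> 0"
    proof
      assume "degree f = 0"
      then obtain c where "f = [:c:]" by (metis degree_eq_zeroE)
      with f show False by simp
    qed
    have ab: "(a, a') \<in> G" "(b, b') \<in> G"
      using f(1) less.prems(1) unfolding dual_poly_def a_def a'_def b_def b'_def by auto
    define m where "m = [:b:] * monom 1 k"
    define m' where "m' = [:b:] * 0 + [:b':] * monom 1 k"
    have m: "dual_poly m m'"
      unfolding m_def m'_def by (rule dual_poly_mult[OF dual_poly_const[OF ab(2)] dual_poly_monom])
    \<comment> \<open>The same step is carried out in the dual numbers, whence the product-rule
      terms of \<open>r'\<close>.\<close>
    define r where "r = [:a:] * p + - (m * f)"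
    define r' where "r' = ([:a:] * p' + [:a':] * p) + - (m * f' + m' * f)"
    have r: "dual_poly r r'"
      unfolding r_def r'_def
      by (intro dual_poly_add dual_poly_minus dual_poly_mult dual_poly_const ab less.prems f m)
    have rx: "poly r x = 0" using less.prems f by (simp add: r_def)
    have "degree r \<le> degree p"
      unfolding r_def m_def using deg
      by (intro degree_add_le) (auto simp: k_def mult.assoc degree_monom_eq
          intro!: degree_smult_le order.trans[OF degree_mult_le] order.trans[OF degree_smult_le] degree_monom_le)
    moreover have "coeff r (degree p) = 0"
      using deg by (simp add: r_def m_def k_def a_def b_def mult.assoc coeff_monom_mult)
    ultimately have "degree r < degree p"
      using \<open>degree f \<noteq> 0\<close> deg by (metis degree_0 leading_coeff_0_iff le_neq_implies_less not_gr0 le_zero_eq)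
    then have "dual_eval x y r r' = 0" using less.hyps r rx by blast
    moreover have "dual_eval x y r r' = a * dual_eval x y p p'"
    proof -
      have "dual_eval x y r r' = dual_eval x y ([:a:] * p) ([:a:] * p' + [:a':] * p)
          - dual_eval x y (m * f) (m * f' + m' * f)"
        unfolding r_def r'_def dual_eval_def pderiv_add pderiv_minus poly_add poly_minus
        by (simp add: algebra_simps)
      then show ?thesis
        unfolding dual_eval_mult using f less.prems by simp
    qed
    ultimately show ?thesis using f(3) by (simp add: a_def)
  qed
qed

text \<open>A transcendental \<open>x\<close> can be given the value 0. For an algebraic
  \<open>x\<close> the annihilator \<open>f\<close> of least degree dictates \<open>y\<close>; the
  equation is solvable since \<open>pderiv f\<close> is nonzero of smaller degree and hence does not
  vanish at \<open>x\<close>.\<close>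

lemma dual_subring_adjoin:
  obtains H y where "dual_subring H" "G \<subseteq> H" "(x, y) \<in> H"
proof -
  have "\<exists>y. \<forall>p p'. dual_poly p p' \<longrightarrow> poly p x = 0 \<longrightarrow> dual_eval x y p p' = 0"
  proof (cases "\<exists>f f'. dual_poly f f' \<and> poly f x = 0 \<and> f \<noteq> 0")
    case True
    define P where "P n \<longleftrightarrow> (\<exists>f f'. dual_poly f f' \<and> poly f x = 0 \<and> f \<noteq> 0 \<and> degree f = n)" for n
    have "\<exists>n. P n" using True unfolding P_def by blast
    then have "P (LEAST n. P n)" by (rule LeastI_ex)
    then obtain f f' where f: "dual_poly f f'" "poly f x = 0" "f \<noteq> 0" "degree f = (LEAST n. P n)"
      unfolding P_def by blast
    have min: "degree f \<le> degree p" if "dual_poly p p'" "poly p x = 0" "p \<noteq> 0" for p p'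
      using that Least_le[of P "degree p"] unfolding f(4) P_def by blast
    have "degree f \<noteq> 0"
    proof
      assume "degree f = 0"
      then obtain c where "f = [:c:]" by (metis degree_eq_zeroE)
      with f show False by simp
    qed
    then have "poly (pderiv f) x \<noteq> 0"
      using min[OF dual_poly_pderiv[OF f(1)]] by (auto simp: degree_pderiv pderiv_eq_0_iff)
    then have "dual_eval x (- poly f' x / poly (pderiv f) x) f f' = 0"
      by (simp add: dual_eval_def)
    then show ?thesis using dual_eval_vanishes[OF f(1-3)] min by blast
  next
    case False
    have "dual_eval x 0 p p' = 0" if "dual_poly p p'" "poly p x = 0" for p p'
    proof -
      have "p = 0" using False that by blast
      then have "coeff p' i = 0" for i
        using that ds_zeroD by (auto simp: dual_poly_def)
      then have "p' = 0" by (simp add: poly_eq_iff)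
      with \<open>p = 0\<close> show ?thesis by (simp add: dual_eval_def)
    qed
    then show ?thesis by blast
  qed
  then obtain y where y: "\<And>p p'. dual_poly p p' \<Longrightarrow> poly p x = 0 \<Longrightarrow> dual_eval x y p p' = 0"
    by blast
  \<comment> \<open>The subring generated over \<open>G\<close> by the dual number
    \<open>(x, y)\<close>.\<close>
  define H where "H = {(poly p x, dual_eval x y p p') |p p'. dual_poly p p'}"
  have inH: "(poly p x, dual_eval x y p p') \<in> H" if "dual_poly p p'" for p p'
    using that unfolding H_def by blast
  have HE: "\<exists>p p'. dual_poly p p' \<and> a = poly p x \<and> a' = dual_eval x y p p'" if "(a, a') \<in> H" for a a'
    using that unfolding H_def by blast
  have sub: "G \<subseteq> H"
  proof clarify
    fix a a' assume "(a, a') \<in> G"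
    from inH[OF dual_poly_const[OF this]] show "(a, a') \<in> H" by (simp add: dual_eval_def)
  qed
  moreover have "(x, y) \<in> H"
    using inH[OF dual_poly_monom[of 1]] by (simp add: dual_eval_def poly_monom pderiv_monom)
  moreover have "dual_subring H"
    unfolding dual_subring_def
  proof (intro conjI allI impI)
    show "(1, 0) \<in> H" using sub ds_1 by blast
    show "a' = 0" if "(0, a') \<in> H" for a' using HE[OF that] y by metis
    show "(- a, - a') \<in> H" if aH: "(a, a') \<in> H" for a a'
    proof -
      obtain p p' where p: "dual_poly p p'" "a = poly p x" "a' = dual_eval x y p p'"
        using HE[OF aH] by blast
      from inH[OF dual_poly_minus[OF p(1)]] show ?thesis
        by (simp add: p dual_eval_def pderiv_minus algebra_simps)
    qed
    fix a a' b b' assume ab: "(a, a') \<in> H" "(b, b') \<in> H"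
    obtain p p' where p: "dual_poly p p'" "a = poly p x" "a' = dual_eval x y p p'"
      using HE ab by blast
    obtain q q' where q: "dual_poly q q'" "b = poly q x" "b' = dual_eval x y q q'"
      using HE ab by blast
    show "(a + b, a' + b') \<in> H"
      using inH[OF dual_poly_add[OF p(1) q(1)]]
      by (simp add: p q dual_eval_def pderiv_add algebra_simps)
    show "(a * b, a * b' + a' * b) \<in> H"
      using inH[OF dual_poly_mult[OF p(1) q(1)]] unfolding dual_eval_mult by (simp add: p q)
  qed
  ultimately show ?thesis using that by blast
qed

end

lemma dual_subring_Union:
  assumes chain: "subset.chain {G. dual_subring G} C" and "C \<noteq> {}"
  shows "dual_subring (\<Union>C)"
proof -
  have C: "dual_subring G" if "G \<in> C" for G
    using chain that by (auto simp: subset.chain_def)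
  have two: "\<exists>G\<in>C. u \<in> G \<and> v \<in> G" if "u \<in> \<Union>C" "v \<in> \<Union>C" for u v
    using that chain unfolding subset_chain_def by blast
  show ?thesis
    unfolding dual_subring_def
  proof (intro conjI allI impI)
    show "(1, 0) \<in> \<Union>C" using C ds_1 \<open>C \<noteq> {}\<close> by blast
    show "a' = 0" if "(0, a') \<in> \<Union>C" for a' using C ds_zeroD that by blast
    show "(- a, - a') \<in> \<Union>C" if "(a, a') \<in> \<Union>C" for a a' using C ds_minus that by blast
    show "(a + b, a' + b') \<in> \<Union>C" if "(a, a') \<in> \<Union>C" "(b, b') \<in> \<Union>C" for a a' b b'
      using two[OF that] C ds_add by blast
    show "(a * b, a * b' + a' * b) \<in> \<Union>C" if "(a, a') \<in> \<Union>C" "(b, b') \<in> \<Union>C" for a a' b b'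
      using two[OF that] C ds_mult by blast
  qed
qed

text \<open>Zorn's lemma: by adjunction a maximal dual subring has an entry above every real, and
  the absence of nonzero infinitesimals makes it the graph of a function.\<close>

lemma dual_subring_extend_derivation:
  assumes G0: "dual_subring G\<^sub>0"
  shows "\<exists>D. derivation D \<and> (\<forall>a a'. (a, a') \<in> G\<^sub>0 \<longrightarrow> D a = a')"
proof -
  define \<A> where "\<A> = {G. dual_subring G \<and> G\<^sub>0 \<subseteq> G}"
  have "\<exists>M\<in>\<A>. \<forall>X\<in>\<A>. M \<subseteq> X \<longrightarrow> X = M"
  proof (rule subset_Zorn_nonempty)
    show "\<A> \<noteq> {}" using G0 by (auto simp: \<A>_def)
    fix C assume C: "C \<noteq> {}" "subset.chain \<A> C"
    then have "subset.chain {G. dual_subring G} C"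
      by (auto simp: subset.chain_def \<A>_def)
    from dual_subring_Union[OF this C(1)] have "dual_subring (\<Union>C)" .
    moreover obtain X where "X \<in> C" using C(1) by blast
    then have "G\<^sub>0 \<subseteq> X" using C(2) by (auto simp: subset.chain_def \<A>_def)
    then have "G\<^sub>0 \<subseteq> \<Union>C" using \<open>X \<in> C\<close> by blast
    ultimately show "\<Union>C \<in> \<A>" unfolding \<A>_def by blast
  qed
  then obtain M where M: "dual_subring M" "G\<^sub>0 \<subseteq> M"
    and max: "\<And>X. dual_subring X \<Longrightarrow> M \<subseteq> X \<Longrightarrow> X = M"
    unfolding \<A>_def by (auto dest: order_trans)
  have "\<exists>y. (x, y) \<in> M" for x
  proof -
    obtain H y where H: "dual_subring H" "M \<subseteq> H" "(x, y) \<in> H"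
      using dual_subring_adjoin[OF M(1)] .
    from max[OF H(1,2)] H(3) show ?thesis by blast
  qed
  then have "\<forall>x. \<exists>y. (x, y) \<in> M" by blast
  from choice[OF this] obtain D where D: "\<And>x. (x, D x) \<in> M" by blast
  then have eq: "D x = y" if "(x, y) \<in> M" for x y
    using ds_unique[OF M(1)] that by blast
  have "derivation D"
    unfolding derivation_def
    by (intro conjI allI; rule eq) (auto intro: ds_add[OF M(1)] ds_mult[OF M(1)] D)
  moreover have "\<forall>a a'. (a, a') \<in> G\<^sub>0 \<longrightarrow> D a = a'"
    using eq M(2) by blast
  ultimately show ?thesis by blast
qed

text \<open>Start from the directional derivative along \<open>c\<close> on polynomials in the
  coordinates of \<open>x\<close>. It depends only on the value at \<open>x\<close>, because a
  polynomial is determined by its value at an algebraically independent point.\<close>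

lemma alg_indep_derivation:
  fixes x c :: "'x::finite \<Rightarrow> real"
  assumes x: "alg_indep x"
  obtains D where "derivation D" "\<And>i. D (x i) = c i"
proof -
  let ?l = "\<lambda>f t. f (\<lambda>i. x i + t * c i)"
  define G where "G = {(f x, d) |f d. rat_poly_fun f \<and> (?l f has_real_derivative d) (at 0)}"
  have inG: "(f x, d) \<in> G" if "rat_poly_fun f" "(?l f has_real_derivative d) (at 0)" for f d
    using that unfolding G_def by blast
  have GE: "\<exists>f. rat_poly_fun f \<and> (?l f has_real_derivative d) (at 0) \<and> a = f x" if "(a, d) \<in> G" for a d
    using that unfolding G_def by blast
  have "dual_subring G"
    unfolding dual_subring_def
  proof (intro conjI allI impI)
    show "(1, 0) \<in> G" using inG[of "\<lambda>_. 1" 0] by (simp add: rat_poly_fun_1)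
    show "d = 0" if d: "(0, d) \<in> G" for d
    proof -
      obtain f where f: "rat_poly_fun f" "(?l f has_real_derivative d) (at 0)" "0 = f x"
        using GE[OF d] by blast
      then have "f y = 0" for y using alg_indep_zero[OF x, of f] by simp
      with f(2) show ?thesis using DERIV_unique[OF _ DERIV_const, of 0 d 0] by simp
    qed
    show "(- a, - d) \<in> G" if ad: "(a, d) \<in> G" for a d
    proof -
      obtain f where f: "rat_poly_fun f" "(?l f has_real_derivative d) (at 0)" "a = f x"
        using GE[OF ad] by blast
      show ?thesis
        unfolding f(3) by (rule inG[of "\<lambda>x. - f x"]) (intro rat_poly_fun_uminus DERIV_minus f)+
    qed
    fix a d b e assume ab: "(a, d) \<in> G" "(b, e) \<in> G"
    obtain f where f: "rat_poly_fun f" "(?l f has_real_derivative d) (at 0)" "a = f x"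
      using GE ab by blast
    obtain g where g: "rat_poly_fun g" "(?l g has_real_derivative e) (at 0)" "b = g x"
      using GE ab by blast
    show "(a + b, d + e) \<in> G"
      unfolding f(3) g(3)
      by (rule inG[of "\<lambda>x. f x + g x"]) (intro rat_poly_fun_add DERIV_add f g)+
    show "(a * b, a * e + d * b) \<in> G"
      unfolding f(3) g(3)
      by (rule inG[of "\<lambda>x. f x * g x"])
        (use DERIV_mult[OF f(2) g(2)] in \<open>auto intro!: rat_poly_fun_mult f g simp: algebra_simps\<close>)
  qed
  from dual_subring_extend_derivation[OF this] obtain D
    where D: "derivation D" "\<And>a a'. (a, a') \<in> G \<Longrightarrow> D a = a'" by blast
  have "(x i, c i) \<in> G" for i
    by (rule inG[of "\<lambda>x. x i", OF rat_poly_fun_var]) (auto intro!: derivative_eq_intros)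
  with D that show ?thesis by blast
qed

context
  fixes D assumes D: "derivation D"
begin

lemma derivation_add: "D (x + y) = D x + D y"
  and derivation_mult: "D (x * y) = x * D y + D x * y"
  using D by (auto simp: derivation_def)

lemma derivation_0: "D 0 = 0"
  using derivation_add[of 0 0] by simp

lemma derivation_1: "D 1 = 0"
  using derivation_mult[of 1 1] by simp

lemma derivation_uminus: "D (- x) = - D x"
  using derivation_add[of x "- x"] derivation_0 by simp

lemma derivation_diff: "D (x - y) = D x - D y"
  using derivation_add[of x "- y"] derivation_uminus by simp

lemma derivation_sum: "D (\<Sum>i\<in>I. f i) = (\<Sum>i\<in>I. D (f i))"
  by (induction I rule: infinite_finite_induct) (auto simp: derivation_0 derivation_add)

end


section \<open>Compact curves with boundary\<close>

text \<open>A compact 1-manifold with prescribed boundary \<open>B\<close>, possibly with several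
  components. The normalisation \<open>f x = 0\<close> places a boundary point at the closed end of
  its half-open interval.\<close>

definition bordered_curve :: "'a::euclidean_space set \<Rightarrow> 'a set \<Rightarrow> bool" where
  "bordered_curve C B \<longleftrightarrow> compact C \<and> B \<subseteq> C \<and>
     (\<forall>x\<in>C. \<exists>N f g (e::real). openin (top_of_set C) N \<and> x \<in> N \<and> e > 0 \<and> f x = 0 \<and>
        homeomorphism N (if x \<in> B then {0..<e} else {-e<..<e}) f g)"

context
  fixes C B :: "'a::euclidean_space set"
  assumes curve: "bordered_curve C B"
begin

lemma bc_compact: "compact C" and bc_sub: "B \<subseteq> C"
  using curve by (auto simp: bordered_curve_def)

lemma bc_chart:
  assumes "x \<in> C"
  obtains N e f g where "openin (top_of_set C) N" "x \<in> N" "(e::real) > 0" "f x = 0"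
    "homeomorphism N (if x \<in> B then {0..<e} else {-e<..<e}) f g"
  using curve assms unfolding bordered_curve_def by meson

lemma arc_stays_near:
  assumes \<gamma>: "arc \<gamma>" "path_image \<gamma> \<subseteq> C" and N: "openin (top_of_set C) N" and t: "t \<in> {0..1}" "\<gamma> t \<in> N"
  obtains d where "d > 0" "\<And>s. s \<in> {0..1} \<Longrightarrow> \<bar>s - t\<bar> < d \<Longrightarrow> \<gamma> s \<in> N"
proof -
  obtain W where W: "open W" "N = C \<inter> W" using N by (auto simp: openin_open)
  have "openin (top_of_set {0..1}) ({0..1} \<inter> \<gamma> -` W)"
    using \<gamma> W(1) by (intro continuous_openin_preimage_gen) (auto simp: arc_def path_def)
  then obtain V where V: "open V" "{0..1} \<inter> \<gamma> -` W = {0..1} \<inter> V" by (auto simp: openin_open)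
  have "t \<in> {0..1} \<inter> \<gamma> -` W" using t W by simp
  then have "t \<in> V" using V(2) by blast
  then obtain d where d: "d > 0" "ball t d \<subseteq> V" using V(1) open_contains_ball by blast
  have "\<gamma> s \<in> N" if s: "s \<in> {0..1}" "\<bar>s - t\<bar> < d" for s
  proof -
    have "s \<in> ball t d" using s by (simp add: dist_real_def)
    then have "s \<in> {0..1} \<inter> \<gamma> -` W" using d(2) V(2) s by blast
    then show ?thesis using \<gamma>(2) W(2) by (auto simp: path_image_def)
  qed
  with d(1) that show ?thesis by blast
qed

text \<open>Read in a chart, the arc near \<open>t\<close> is an injective map into the line, so by
  invariance of domain its image is open there. Hence it cannot touch the end of a half-open
  interval, and it covers a neighbourhood in \<open>C\<close>.\<close>

lemma arc_interior_nhd: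
  assumes \<gamma>: "arc \<gamma>" "path_image \<gamma> \<subseteq> C" and t: "t \<in> {0<..<1}"
  shows "\<gamma> t \<notin> B" "\<exists>T. openin (top_of_set C) T \<and> \<gamma> t \<in> T \<and> T \<subseteq> \<gamma> ` {0<..<1}"
proof -
  have "\<gamma> t \<in> C" using \<gamma> t by (auto simp: path_image_def)
  then obtain N e f g where N: "openin (top_of_set C) N" "\<gamma> t \<in> N" "(e::real) > 0" "f (\<gamma> t) = 0"
    and h: "homeomorphism N (if \<gamma> t \<in> B then {0..<e} else {-e<..<e}) f g"
    by (rule bc_chart)
  obtain W where W: "open W" "N = C \<inter> W" using N(1) by (auto simp: openin_open)
  define J where "J = {0<..<1} \<inter> \<gamma> -` W"
  have cont: "continuous_on {0..1} \<gamma>" and inj: "inj_on \<gamma> {0..1}"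
    using \<gamma> by (auto simp: arc_def path_def)
  have "open J" unfolding J_def
    by (intro continuous_open_preimage continuous_on_subset[OF cont] W) auto
  have JN: "\<gamma> ` J \<subseteq> N" using \<gamma> by (auto simp: J_def W path_image_def)
  have tJ: "t \<in> J" using t N(2) W by (auto simp: J_def)
  have Jsub: "J \<subseteq> {0..1}" by (auto simp: J_def)
  have fc: "continuous_on N f" and fi: "inj_on f N"
    using h by (auto simp: homeomorphism_def intro: inj_on_inverseI)
  have "open ((f \<circ> \<gamma>) ` J)"
  proof (rule invariance_of_domain)
    show "continuous_on J (f \<circ> \<gamma>)"
      by (intro continuous_on_compose continuous_on_subset[OF cont Jsub] continuous_on_subset[OF fc JN])
    show "inj_on (f \<circ> \<gamma>) J"
      by (intro comp_inj_on inj_on_subset[OF inj Jsub] inj_on_subset[OF fi JN])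
  qed fact
  then have opn: "open (f ` \<gamma> ` J)" by (simp add: image_comp)
  have 0: "0 \<in> f ` \<gamma> ` J" using tJ N(4) by force
  show "\<gamma> t \<notin> B"
  proof
    assume "\<gamma> t \<in> B"
    then have "f ` \<gamma> ` J \<subseteq> {0..}" using h JN by (auto simp: homeomorphism_def)
    moreover obtain d where "d > 0" "ball 0 d \<subseteq> f ` \<gamma> ` J"
      using opn 0 open_contains_ball by blast
    moreover have "-d/2 \<in> ball 0 d" using \<open>d > 0\<close> by (simp add: dist_real_def)
    ultimately have "-d/2 \<in> {0..}" by blast
    with \<open>d > 0\<close> show False by simp
  qed
  have eq: "\<gamma> ` J = N \<inter> f -` (f ` \<gamma> ` J)"
    using JN fi by (auto dest: inj_onD)
  have "openin (top_of_set N) (\<gamma> ` J)"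
    by (subst eq) (rule continuous_openin_preimage_gen[OF fc opn])
  then have "openin (top_of_set C) (\<gamma> ` J)" using N(1) openin_trans by blast
  then show "\<exists>T. openin (top_of_set C) T \<and> \<gamma> t \<in> T \<and> T \<subseteq> \<gamma> ` {0<..<1}"
    using tJ by (intro exI[of _ "\<gamma> ` J"]) (auto simp: J_def)
qed

text \<open>At a boundary point the intermediate value theorem replaces invariance of domain: the
  arc covers an initial segment \<open>{0..c}\<close> of the half-open chart.\<close>

lemma arc_start_nhd:
  assumes \<gamma>: "arc \<gamma>" "path_image \<gamma> \<subseteq> C" and B: "pathstart \<gamma> \<in> B"
  shows "\<exists>T. openin (top_of_set C) T \<and> \<gamma> 0 \<in> T \<and> T \<subseteq> \<gamma> ` {0..<1}"
proof -
  have B0: "\<gamma> 0 \<in> B" using B by (simp add: pathstart_def)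
  have "\<gamma> 0 \<in> C" using \<gamma> by (auto simp: path_image_def)
  then obtain N e f g where N: "openin (top_of_set C) N" "\<gamma> 0 \<in> N" "(e::real) > 0" "f (\<gamma> 0) = 0"
    and h': "homeomorphism N (if \<gamma> 0 \<in> B then {0..<e} else {-e<..<e}) f g"
    by (rule bc_chart)
  have h: "homeomorphism N {0..<e} f g" using h' B0 by simp
  have cont: "continuous_on {0..1} \<gamma>" and inj: "inj_on \<gamma> {0..1}"
    using \<gamma> by (auto simp: arc_def path_def)
  have fc: "continuous_on N f" and fi: "inj_on f N"
    using h by (auto simp: homeomorphism_def intro: inj_on_inverseI)
  obtain d where d: "d > 0" "\<And>s. s \<in> {0..1} \<Longrightarrow> \<bar>s - 0\<bar> < d \<Longrightarrow> \<gamma> s \<in> N"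
    using arc_stays_near[OF \<gamma> N(1), of 0] N(2) by auto
  define s\<^sub>1 where "s\<^sub>1 = min (d / 2) (1 / 2)"
  have s\<^sub>1: "0 < s\<^sub>1" "s\<^sub>1 < 1" "s\<^sub>1 < d" "{0..s\<^sub>1} \<subseteq> {0..1}"
    using d(1) by (auto simp: s\<^sub>1_def)
  have sN: "\<gamma> ` {0..s\<^sub>1} \<subseteq> N"
  proof (rule image_subsetI)
    show "\<gamma> s \<in> N" if "s \<in> {0..s\<^sub>1}" for s using that s\<^sub>1 by (intro d(2)) auto
  qed
  have "connected ((f \<circ> \<gamma>) ` {0..s\<^sub>1})"
    by (intro connected_continuous_image continuous_on_compose continuous_on_subset[OF cont s\<^sub>1(4)]
        continuous_on_subset[OF fc sN]) simp
  moreover define c where "c = f (\<gamma> s\<^sub>1)"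
  ultimately have I: "{0..c} \<subseteq> (f \<circ> \<gamma>) ` {0..s\<^sub>1}"
    using s\<^sub>1 N(4) by (intro connected_contains_Icc) (auto intro: rev_image_eqI[of 0])
  have "\<gamma> s\<^sub>1 \<noteq> \<gamma> 0" using inj_onD[OF inj, of s\<^sub>1 0] s\<^sub>1 by auto
  moreover have s\<^sub>1N: "\<gamma> s\<^sub>1 \<in> N" using sN s\<^sub>1 by auto
  ultimately have "c \<noteq> 0" using inj_onD[OF fi, of "\<gamma> s\<^sub>1" "\<gamma> 0"] N by (auto simp: c_def)
  have fN: "f ` N = {0..<e}" using h by (simp add: homeomorphism_def)
  then have "c \<in> {0..<e}" using s\<^sub>1N unfolding c_def by blast
  then have "c > 0" using \<open>c \<noteq> 0\<close> by simp
  define T where "T = N \<inter> f -` {..<c}"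
  have "openin (top_of_set N) T"
    unfolding T_def by (rule continuous_openin_preimage_gen[OF fc]) simp
  then have "openin (top_of_set C) T" using N(1) openin_trans by blast
  moreover have "\<gamma> 0 \<in> T" using N \<open>c > 0\<close> by (simp add: T_def)
  moreover have "T \<subseteq> \<gamma> ` {0..<1}"
  proof
    fix y assume y: "y \<in> T"
    then have "f y \<in> {0..c}" using fN by (force simp: T_def)
    then obtain s where s: "s \<in> {0..s\<^sub>1}" "f y = f (\<gamma> s)" using I by auto
    then have "y = \<gamma> s" using inj_onD[OF fi s(2)] y sN s(1) unfolding T_def by blast
    with s s\<^sub>1 show "y \<in> \<gamma> ` {0..<1}" by auto
  qed
  ultimately show ?thesis by blast
qed

lemma arc_tail_open:
  assumes \<gamma>: "arc \<gamma>" "path_image \<gamma> \<subseteq> C" and B: "pathstart \<gamma> \<in> B"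
  shows "openin (top_of_set C) (\<gamma> ` {0..<1})"
proof (subst openin_subopen, rule ballI)
  fix x assume "x \<in> \<gamma> ` {0..<1}"
  then obtain t where t: "t \<in> {0..<1}" "x = \<gamma> t" by blast
  show "\<exists>T. openin (top_of_set C) T \<and> x \<in> T \<and> T \<subseteq> \<gamma> ` {0..<1}"
  proof (cases "t = 0")
    case True
    then show ?thesis using arc_start_nhd[OF assms] t by simp
  next
    case False
    then have "t \<in> {0<..<1}" using t by auto
    moreover have "\<gamma> ` {0<..<1} \<subseteq> \<gamma> ` {0..<1}" by auto
    ultimately show ?thesis using arc_interior_nhd(2)[OF \<gamma>] t(2) by (meson subset_trans)
  qed
qed

lemma arc_image_open:
  assumes \<gamma>: "arc \<gamma>" "path_image \<gamma> \<subseteq> C" and B: "pathstart \<gamma> \<in> B" "pathfinish \<gamma> \<in> B"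
  shows "openin (top_of_set C) (path_image \<gamma>)"
proof -
  have "openin (top_of_set C) (reversepath \<gamma> ` {0..<1})"
    by (rule arc_tail_open) (use \<gamma> B in \<open>auto intro: arc_reversepath\<close>)
  moreover have "reversepath \<gamma> ` {0..<1} = \<gamma> ` {0<..1}"
    by (force simp: reversepath_def image_iff Bex_def intro!: exI[of _ "1 - _"])
  ultimately have "openin (top_of_set C) (\<gamma> ` {0..<1} \<union> \<gamma> ` {0<..1})"
    using arc_tail_open[OF \<gamma> B(1)] by (simp add: openin_Un)
  moreover have "\<gamma> ` {0..<1} \<union> \<gamma> ` {0<..1} = path_image \<gamma>"
    unfolding path_image_def image_Un[symmetric] by (rule arg_cong[of _ _ "image \<gamma>"]) auto
  ultimately show ?thesis by simp
qed

text \<open>In a chart the arc reaches its end from one side only, since it cannot pass through the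
  end point earlier. A short segment \<open>\<eta>\<close> on the other side prolongs it.\<close>

lemma arc_extend:
  assumes \<gamma>: "arc \<gamma>" "path_image \<gamma> \<subseteq> C" and B: "pathfinish \<gamma> \<notin> B"
  shows "\<exists>\<beta>. arc \<beta> \<and> path_image \<beta> \<subseteq> C \<and> pathstart \<beta> = pathstart \<gamma> \<and> pathfinish \<gamma> \<in> \<beta> ` {0..<1}"
proof -
  define x where "x = \<gamma> 1"
  have x: "x \<in> C" "x \<notin> B" using \<gamma> B by (auto simp: path_image_def pathfinish_def x_def)
  obtain N e f g where N: "openin (top_of_set C) N" "x \<in> N" "(e::real) > 0" "f x = 0"
    and h': "homeomorphism N (if x \<in> B then {0..<e} else {-e<..<e}) f g"
    by (rule bc_chart[OF x(1)])
  have h: "homeomorphism N {-e<..<e} f g" using h' x by simp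
  have cont: "continuous_on {0..1} \<gamma>" and inj: "inj_on \<gamma> {0..1}"
    using \<gamma> by (auto simp: arc_def path_def)
  have fc: "continuous_on N f" and gc: "continuous_on {-e<..<e} g"
    and fg: "\<And>r. r \<in> {-e<..<e} \<Longrightarrow> f (g r) = r" and gN: "\<And>r. r \<in> {-e<..<e} \<Longrightarrow> g r \<in> N"
    and gf: "\<And>y. y \<in> N \<Longrightarrow> g (f y) = y"
    using h by (auto simp: homeomorphism_def)
  have g0: "g 0 = x" using gf[OF N(2)] N(4) by simp
  obtain d where d: "d > 0" "\<And>s. s \<in> {0..1} \<Longrightarrow> \<bar>s - 1\<bar> < d \<Longrightarrow> \<gamma> s \<in> N"
    using arc_stays_near[OF \<gamma> N(1), of 1] N(2) by (auto simp: x_def)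
  define s\<^sub>1 where "s\<^sub>1 = max (1 - d / 2) (1 / 2)"
  have s\<^sub>1: "0 < s\<^sub>1" "s\<^sub>1 < 1" "1 - s\<^sub>1 < d" "{s\<^sub>1..<1} \<subseteq> {0..1}"
    using d(1) by (auto simp: s\<^sub>1_def)
  have sN: "\<gamma> ` {s\<^sub>1..<1} \<subseteq> N"
  proof (rule image_subsetI)
    show "\<gamma> s \<in> N" if "s \<in> {s\<^sub>1..<1}" for s using that s\<^sub>1 by (intro d(2)) auto
  qed
  define I where "I = (f \<circ> \<gamma>) ` {s\<^sub>1..<1}"
  have "connected I" unfolding I_def
    by (intro connected_continuous_image continuous_on_compose continuous_on_subset[OF cont s\<^sub>1(4)]
        continuous_on_subset[OF fc sN]) simp
  moreover have "0 \<notin> I"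
  proof
    assume "0 \<in> I"
    then obtain s where s: "s \<in> {s\<^sub>1..<1}" "f (\<gamma> s) = 0" by (auto simp: I_def)
    then have "\<gamma> s = x" using gf[of "\<gamma> s"] sN g0 by force
    then show False using inj_onD[OF inj, of s 1] s s\<^sub>1 by (auto simp: x_def)
  qed
  ultimately have "I \<subseteq> {..<0} \<or> I \<subseteq> {0<..}"
    unfolding connected_iff_interval by (meson greaterThan_iff lessThan_iff not_le order.order_iff_strict subsetI)
  text \<open>The sign \<open>\<sigma>\<close> of the side of \<open>x\<close> that the arc does not come from.\<close>
  then obtain \<sigma> :: real where \<sigma>: "\<sigma> = 1 \<or> \<sigma> = -1" "\<And>r. r \<in> I \<Longrightarrow> \<sigma> * r < 0"
  proof (elim disjE)
    assume "I \<subseteq> {..<0}"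
    then show ?thesis by (intro that[of 1]) auto
  next
    assume "I \<subseteq> {0<..}"
    then show ?thesis by (intro that[of "-1"]) auto
  qed
  define K where "K = \<gamma> ` {0..s\<^sub>1}"
  have "compact K" unfolding K_def
    by (intro compact_continuous_image continuous_on_subset[OF cont]) (use s\<^sub>1 in auto)
  then have "open (- K)" by (simp add: compact_imp_closed open_Compl)
  moreover have "x \<notin> K"
  proof
    assume "x \<in> K"
    then obtain s where "s \<in> {0..s\<^sub>1}" "\<gamma> s = \<gamma> 1" by (auto simp: K_def x_def)
    then show False using inj_onD[OF inj, of s 1] s\<^sub>1 by auto
  qed
  ultimately have "openin (top_of_set {-e<..<e}) ({-e<..<e} \<inter> g -` (- K))"
    by (intro continuous_openin_preimage_gen[OF gc])
  then have "open ({-e<..<e} \<inter> g -` (- K))" by (simp add: openin_open_eq)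
  moreover have "0 \<in> {-e<..<e} \<inter> g -` (- K)" using N(3) g0 \<open>x \<notin> K\<close> by simp
  \<comment> \<open>A small \<open>\<delta>\<close> keeps the prolongation away from the compact
    earlier part \<open>K\<close>; the later part of the arc lies on the opposite side in the
    chart.\<close>
  ultimately obtain \<delta> where \<delta>: "\<delta> > 0" "ball 0 \<delta> \<subseteq> {-e<..<e} \<inter> g -` (- K)"
    using open_contains_ball by blast
  define \<eta> where "\<eta> t = g (\<sigma> * (\<delta> / 2) * t)" for t
  have in_ball: "\<sigma> * (\<delta> / 2) * t \<in> ball 0 \<delta>" if "t \<in> {0..1}" for t
  proof -
    have "\<bar>\<sigma> * (\<delta> / 2) * t\<bar> = \<delta> / 2 * t" using \<sigma>(1) \<delta>(1) that by (auto simp: abs_mult)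
    also have "\<dots> \<le> \<delta> / 2" using that \<delta>(1) by (simp add: mult_left_le)
    also have "\<dots> < \<delta>" using \<delta>(1) by simp
    finally show ?thesis by (simp add: dist_real_def)
  qed
  then have in_e: "\<sigma> * (\<delta> / 2) * t \<in> {-e<..<e}" if "t \<in> {0..1}" for t using that \<delta>(2) by blast
  have f\<eta>: "f (\<eta> t) = \<sigma> * (\<delta> / 2) * t" if "t \<in> {0..1}" for t
    using fg[OF in_e[OF that]] by (simp add: \<eta>_def)
  have "arc \<eta>"
    unfolding arc_def path_def
  proof
    have "continuous_on {0..1} (g \<circ> (\<lambda>t. \<sigma> * (\<delta> / 2) * t))"
      by (intro continuous_on_compose continuous_intros continuous_on_subset[OF gc]) (use in_e in blast)
    then show "continuous_on {0..1} \<eta>" by (simp add: \<eta>_def o_def)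
    show "inj_on \<eta> {0..1}"
    proof (rule inj_onI)
      fix s t :: real assume "s \<in> {0..1}" "t \<in> {0..1}" "\<eta> s = \<eta> t"
      then have "\<sigma> * (\<delta> / 2) * s = \<sigma> * (\<delta> / 2) * t" using f\<eta> by metis
      then show "s = t" using \<sigma>(1) \<delta>(1) by auto
    qed
  qed
  moreover have "pathfinish \<gamma> = pathstart \<eta>"
    by (simp add: pathfinish_def pathstart_def \<eta>_def g0 x_def[symmetric])
  moreover have "path_image \<gamma> \<inter> path_image \<eta> \<subseteq> {pathstart \<eta>}"
  proof clarify
    fix y assume "y \<in> path_image \<gamma>" "y \<in> path_image \<eta>"
    then obtain s t where st: "s \<in> {0..1}" "y = \<gamma> s" "t \<in> {0..1}" "y = \<eta> t"
      by (auto simp: path_image_def)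
    have "y \<notin> K" using st(4) in_ball[OF st(3)] \<delta>(2) unfolding \<eta>_def by blast
    then have "s > s\<^sub>1" using st by (auto simp: K_def)
    have "s = 1"
    proof (rule ccontr)
      assume "s \<noteq> 1"
      then have "f y \<in> I" using st \<open>s > s\<^sub>1\<close> by (auto simp: I_def)
      then have "\<sigma> * (\<sigma> * (\<delta> / 2) * t) < 0" using \<sigma>(2) st(4) f\<eta>[OF st(3)] by metis
      then show False using \<sigma>(1) \<delta>(1) st(3) by (auto simp: mult_less_0_iff)
    qed
    then show "y = pathstart \<eta>" using st by (simp add: pathstart_def \<eta>_def g0 x_def)
  qed
  ultimately have "arc (\<gamma> +++ \<eta>)" using \<gamma> by (intro arc_join)
  moreover have "path_image (\<gamma> +++ \<eta>) \<subseteq> C"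
  proof -
    have "path_image \<eta> \<subseteq> N" using gN in_e by (auto simp: path_image_def \<eta>_def)
    also have "N \<subseteq> C" using N(1) by (rule openin_imp_subset)
    finally show ?thesis using path_image_join_subset[of \<gamma> \<eta>] \<gamma>(2) by blast
  qed
  moreover have "pathfinish \<gamma> \<in> (\<gamma> +++ \<eta>) ` {0..<1}"
    by (rule image_eqI[of _ _ "1/2"]) (auto simp: joinpaths_def pathfinish_def)
  ultimately show ?thesis by (intro exI[of _ "\<gamma> +++ \<eta>"]) simp
qed

lemma connected_arc_tail: "path \<gamma> \<Longrightarrow> connected (\<gamma> ` {0..<1})"
  by (intro connected_continuous_image) (auto simp: path_def intro: continuous_on_subset)

text \<open>The common part is open in the first tail, and also closed there, since adding the
  missing end of \<open>\<gamma>\<^sub>2\<close> does not change it. As the first tail is connected,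
  it is the common part.\<close>

lemma arc_tails_subset:
  assumes 1: "arc \<gamma>\<^sub>1" "path_image \<gamma>\<^sub>1 \<subseteq> C" and 2: "arc \<gamma>\<^sub>2" "path_image \<gamma>\<^sub>2 \<subseteq> C"
    and s: "pathstart \<gamma>\<^sub>1 = pathstart \<gamma>\<^sub>2" "pathstart \<gamma>\<^sub>1 \<in> B"
    and nin: "pathfinish \<gamma>\<^sub>2 \<notin> \<gamma>\<^sub>1 ` {0..<1}"
  shows "\<gamma>\<^sub>1 ` {0..<1} \<subseteq> \<gamma>\<^sub>2 ` {0..<1}"
proof -
  let ?U1 = "\<gamma>\<^sub>1 ` {0..<1}" and ?U2 = "\<gamma>\<^sub>2 ` {0..<1}"
  have "path_image \<gamma>\<^sub>2 = insert (pathfinish \<gamma>\<^sub>2) ?U2"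
    unfolding path_image_def pathfinish_def image_insert[symmetric]
    by (rule arg_cong[of _ _ "image \<gamma>\<^sub>2"]) auto
  then have eq: "?U1 \<inter> ?U2 = ?U1 \<inter> path_image \<gamma>\<^sub>2" using nin by auto
  have sub: "?U1 \<subseteq> C" using 1 by (auto simp: path_image_def)
  have "openin (top_of_set ?U1) (?U1 \<inter> ?U2)"
    using arc_tail_open[OF 2] s openin_subset_trans[of C "?U1 \<inter> ?U2" ?U1] arc_tail_open[OF 1]
    by (metis inf_le1 openin_Int sub)
  moreover have "closedin (top_of_set ?U1) (?U1 \<inter> ?U2)"
    unfolding eq using 2 by (intro closedin_closed_Int closed_path_image) (simp add: arc_imp_path)
  moreover have "connected ?U1" using 1 by (intro connected_arc_tail arc_imp_path)
  moreover have "\<gamma>\<^sub>1 0 \<in> ?U1 \<inter> ?U2"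
    using s by (force simp: pathstart_def)
  ultimately have "?U1 \<inter> ?U2 = ?U1" unfolding connected_clopen by blast
  then show ?thesis by blast
qed

text \<open>If the first arc runs past the end of the second, it is cut there and the roles are
  exchanged.\<close>

lemma arc_tails_nested:
  assumes 1: "arc \<gamma>\<^sub>1" "path_image \<gamma>\<^sub>1 \<subseteq> C" and 2: "arc \<gamma>\<^sub>2" "path_image \<gamma>\<^sub>2 \<subseteq> C"
    and s: "pathstart \<gamma>\<^sub>1 = pathstart \<gamma>\<^sub>2" "pathstart \<gamma>\<^sub>1 \<in> B"
  shows "\<gamma>\<^sub>1 ` {0..<1} \<subseteq> \<gamma>\<^sub>2 ` {0..<1} \<or> \<gamma>\<^sub>2 ` {0..<1} \<subseteq> \<gamma>\<^sub>1 ` {0..<1}"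
proof (cases "pathfinish \<gamma>\<^sub>2 \<in> \<gamma>\<^sub>1 ` {0..<1}")
  case False
  then show ?thesis using arc_tails_subset[OF 1 2 s] by blast
next
  case True
  then obtain t where t: "t \<in> {0..<1}" "\<gamma>\<^sub>1 t = pathfinish \<gamma>\<^sub>2" by force
  have inj2: "inj_on \<gamma>\<^sub>2 {0..1}" using 2 by (auto simp: arc_def)
  have "t \<noteq> 0" using t s inj_onD[OF inj2, of 0 1] by (auto simp: pathstart_def pathfinish_def)
  define \<beta> where "\<beta> = subpath 0 t \<gamma>\<^sub>1"
  have \<beta>: "arc \<beta>" unfolding \<beta>_def using t \<open>t \<noteq> 0\<close> 1 by (intro arc_subpath_arc) auto
  have im: "\<beta> ` {0..<1} \<subseteq> \<gamma>\<^sub>1 ` {0..<1}"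
    using t by (auto simp: \<beta>_def subpath_def intro!: imageI mult_nonneg_nonneg
        order.strict_trans1[OF mult_left_le_one_le])
  have "path_image \<beta> \<subseteq> C"
    using path_image_subpath_subset[of 0 t \<gamma>\<^sub>1] 1 t by (auto simp: \<beta>_def arc_imp_path)
  moreover have "pathstart \<gamma>\<^sub>2 = pathstart \<beta>" "pathstart \<gamma>\<^sub>2 \<in> B"
    using s by (simp_all add: \<beta>_def pathstart_def subpath_def)
  moreover have "pathfinish \<beta> \<notin> \<gamma>\<^sub>2 ` {0..<1}"
  proof
    assume "pathfinish \<beta> \<in> \<gamma>\<^sub>2 ` {0..<1}"
    then obtain r where "r \<in> {0..<1}" "\<gamma>\<^sub>2 r = \<gamma>\<^sub>2 1"
      using t by (force simp: \<beta>_def pathfinish_def subpath_def)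
    then show False using inj_onD[OF inj2, of r 1] by auto
  qed
  ultimately have "\<gamma>\<^sub>2 ` {0..<1} \<subseteq> \<beta> ` {0..<1}"
    using arc_tails_subset[OF 2 \<beta>] by blast
  with im show ?thesis by blast
qed

text \<open>If no arc from \<open>p\<close> ended in \<open>B\<close>, every arc could be prolonged,
  so the union \<open>V\<close> of the half-open arcs from \<open>p\<close> would contain all their
  ends. Being open in \<open>C\<close> and compact, \<open>V\<close> is covered by finitely many
  half-open arcs; these are nested, so \<open>V\<close> is a single one, which misses its own
  end.\<close>

lemma bordered_curve_arc:
  assumes p: "p \<in> B"
  shows "\<exists>\<gamma>. arc \<gamma> \<and> path_image \<gamma> \<subseteq> C \<and> pathstart \<gamma> = p \<and> pathfinish \<gamma> \<in> B"
proof (rule ccontr)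
  assume neg: "\<not> ?thesis"
  define \<A> where "\<A> = {\<gamma>. arc \<gamma> \<and> path_image \<gamma> \<subseteq> C \<and> pathstart \<gamma> = p}"
  define tail where "tail \<gamma> = \<gamma> ` {0..<1::real}" for \<gamma> :: "real \<Rightarrow> 'a"
  define V where "V = \<Union>(tail ` \<A>)"
  have nB: "pathfinish \<gamma> \<notin> B" if "\<gamma> \<in> \<A>" for \<gamma> using neg that by (auto simp: \<A>_def)
  have fin: "pathfinish \<gamma> \<in> V" if \<gamma>: "\<gamma> \<in> \<A>" for \<gamma>
  proof -
    obtain \<beta> where "arc \<beta>" "path_image \<beta> \<subseteq> C" "pathstart \<beta> = p" "pathfinish \<gamma> \<in> tail \<beta>"
      using arc_extend[of \<gamma>] nB[OF \<gamma>] \<gamma> by (auto simp: \<A>_def tail_def)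
    then show ?thesis by (auto simp: V_def \<A>_def)
  qed
  have op: "openin (top_of_set C) (tail \<gamma>)" if "\<gamma> \<in> \<A>" for \<gamma>
    using arc_tail_open[of \<gamma>] that p by (auto simp: \<A>_def tail_def)
  have "V \<subseteq> C" using op openin_imp_subset by (fastforce simp: V_def)
  \<comment> \<open>A path contains an arc with the same ends, so \<open>V\<close> contains
    everything reachable from \<open>p\<close>.\<close>
  have path_V: "x \<in> V" if q: "path q" "path_image q \<subseteq> C" "pathstart q = p" "pathfinish q = x" "x \<noteq> p" for q x
  proof -
    obtain \<gamma> where "arc \<gamma>" "path_image \<gamma> \<subseteq> path_image q" "pathstart \<gamma> = p" "pathfinish \<gamma> = x"
      using path_contains_arc[OF q(1,3,4)] q(5) by metis
    then show ?thesis using fin[of \<gamma>] q(2) by (auto simp: \<A>_def)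
  qed
  have pc: "path_connected N" if "homeomorphism N (if x \<in> B then {0..<e} else {-e<..<e::real}) f g"
    for N x e and f :: "'a \<Rightarrow> real" and g
  proof -
    have "path_connected (g ` (if x \<in> B then {0..<e} else {-e<..<e}))"
      using that by (intro path_connected_continuous_image)
        (auto simp: homeomorphism_def intro: convex_imp_path_connected split: if_splits)
    then show ?thesis using that by (simp add: homeomorphism_def)
  qed
  have "p \<in> V"
  proof -
    have "p \<in> C" using p bc_sub by auto
    obtain N e f g where N: "openin (top_of_set C) N" "p \<in> N" "(e::real) > 0" "f p = 0"
      and h: "homeomorphism N (if p \<in> B then {0..<e} else {-e<..<e}) f g"
      by (rule bc_chart[OF \<open>p \<in> C\<close>])
    then have "g (e/2) \<in> N" "f (g (e/2)) = e/2" using p by (auto simp: homeomorphism_def)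
    moreover have "g (e/2) \<noteq> p" using calculation N by force
    moreover have "N \<subseteq> C" using N openin_imp_subset by blast
    ultimately have "g (e/2) \<in> V" using pc[OF h] N(2) path_V
      unfolding path_connected_def by (metis subset_trans)
    then obtain \<gamma> where "\<gamma> \<in> \<A>" by (auto simp: V_def)
    then show ?thesis by (force simp: V_def tail_def \<A>_def pathstart_def)
  qed
  \<comment> \<open>A limit point of \<open>V\<close> shares a path-connected chart with a point of
    \<open>V\<close>, so it is reachable too.\<close>
  have clos: "x \<in> V" if x: "x \<in> C" "x \<in> closure V" for x
  proof (cases "x = p")
    case True
    with \<open>p \<in> V\<close> show ?thesis by simp
  next
    case False
    obtain N e f g where N: "openin (top_of_set C) N" "x \<in> N" "(e::real) > 0" "f x = 0"
      and h: "homeomorphism N (if x \<in> B then {0..<e} else {-e<..<e}) f g"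
      by (rule bc_chart[OF x(1)])
    obtain W where W: "open W" "N = C \<inter> W" using N(1) by (auto simp: openin_open)
    then have "W \<inter> V \<noteq> {}" using x N by (meson IntD2 disjoint_iff open_Int_closure_eq_empty)
    then obtain y where y: "y \<in> N" "y \<in> V" using \<open>V \<subseteq> C\<close> W by blast
    obtain \<gamma> t where \<gamma>: "\<gamma> \<in> \<A>" "t \<in> {0..<1}" "y = \<gamma> t" using y by (auto simp: V_def tail_def)
    obtain q where q: "path q" "path_image q \<subseteq> N" "pathstart q = y" "pathfinish q = x"
      using pc[OF h] y N(2) unfolding path_connected_def by metis
    have "path (subpath 0 t \<gamma> +++ q)"
      using \<gamma> q by (intro path_join_imp path_subpath) (auto simp: \<A>_def arc_imp_path)
    moreover have "path_image (subpath 0 t \<gamma> +++ q) \<subseteq> C"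
    proof -
      have "path_image (subpath 0 t \<gamma>) \<subseteq> path_image \<gamma>"
        by (rule path_image_subpath_subset) (use \<gamma> in auto)
      moreover have "path_image \<gamma> \<subseteq> C" using \<gamma>(1) by (simp add: \<A>_def)
      ultimately show ?thesis
        using path_image_join_subset[of "subpath 0 t \<gamma>" q] q(2) W(2) by blast
    qed
    moreover have "pathstart (subpath 0 t \<gamma> +++ q) = p"
      using \<gamma> by (simp add: \<A>_def) (simp add: pathstart_def)
    moreover have "pathfinish (subpath 0 t \<gamma> +++ q) = x" using q by simp
    ultimately show ?thesis using path_V False by blast
  qed
  have "openin (top_of_set C) V" unfolding V_def using op by blast
  have "closed V"
  proof -
    have "closure V \<subseteq> C" using \<open>V \<subseteq> C\<close> bc_compact by (simp add: closure_minimal compact_imp_closed)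
    then have "closure V \<subseteq> V" using clos by blast
    then show ?thesis by (simp add: closure_subset_eq)
  qed
  then have "compact V" using bc_compact \<open>V \<subseteq> C\<close> by (metis compact_Int_closed inf.absorb_iff2)
  moreover have "openin (top_of_set V) (tail \<gamma>)" if "\<gamma> \<in> \<A>" for \<gamma>
    using op[OF that] that \<open>V \<subseteq> C\<close> by (auto simp: V_def intro: openin_subset_trans)
  ultimately obtain \<D> where \<D>: "\<D> \<subseteq> tail ` \<A>" "finite \<D>" "V \<subseteq> \<Union>\<D>"
    unfolding compact_eq_openin_cover V_def
    by (metis (no_types, lifting) image_iff order_refl)
  have "\<D> \<noteq> {}" using \<D> \<open>p \<in> V\<close> by auto
  moreover have "subset.chain UNIV \<D>"
    unfolding subset_chain_def
  proof (intro conjI ballI)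
    fix X Y assume "X \<in> \<D>" "Y \<in> \<D>"
    then obtain \<gamma>\<^sub>1 \<gamma>\<^sub>2 where "\<gamma>\<^sub>1 \<in> \<A>" "\<gamma>\<^sub>2 \<in> \<A>" "X = tail \<gamma>\<^sub>1" "Y = tail \<gamma>\<^sub>2" using \<D>(1) by blast
    then show "X \<subseteq> Y \<or> Y \<subseteq> X"
      using arc_tails_nested[of \<gamma>\<^sub>1 \<gamma>\<^sub>2] p by (auto simp: \<A>_def tail_def)
  qed simp
  ultimately have "\<Union>\<D> \<in> \<D>" using \<D>(2) by (intro Union_in_chain)
  then obtain \<gamma> where \<gamma>: "\<gamma> \<in> \<A>" "\<Union>\<D> = tail \<gamma>" using \<D>(1) by blast
  then have "pathfinish \<gamma> \<in> tail \<gamma>" using fin[OF \<gamma>(1)] \<D>(3) by blast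
  then obtain r where "r \<in> {0..<1}" "\<gamma> r = \<gamma> 1" by (force simp: tail_def pathfinish_def)
  moreover have "inj_on \<gamma> {0..1}" using \<gamma> by (auto simp: \<A>_def arc_def)
  ultimately show False using inj_onD[of \<gamma> "{0..1}" r 1] by auto
qed

end


section \<open>Regular level sets of corank one\<close>

lemma dim_image_kernel:
  fixes f :: "'a::euclidean_space \<Rightarrow> 'b::euclidean_space"
  assumes f: "linear f" and S: "subspace S"
  shows "dim S = dim (f ` S) + dim (S \<inter> {x. f x = 0})"
proof -
  define K where "K = S \<inter> {x. f x = 0}"
  have K: "subspace K" unfolding K_def using S f by (intro subspace_inter linear_subspace_kernel)
  define P where "P = {y \<in> S. \<forall>x\<in>K. orthogonal x y}"
  have P: "subspace P"
    unfolding P_def using S by (auto simp: subspace_def orthogonal_def inner_right_distrib)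
  have "dim P + dim K = dim S"
    unfolding P_def by (rule dim_subspace_orthogonal_to_vectors[OF K S]) (auto simp: K_def)
  moreover have "inj_on f (span P)"
  proof -
    have "x = y" if "x \<in> P" "y \<in> P" "f x = f y" for x y
    proof -
      have "x - y \<in> P" using P that by (simp add: subspace_diff)
      moreover have "x - y \<in> K"
        using calculation that f by (auto simp: K_def P_def linear_diff)
      ultimately have "orthogonal (x - y) (x - y)" by (auto simp: P_def)
      then show ?thesis by (simp add: orthogonal_self)
    qed
    then show ?thesis using P by (auto simp: span_eq_iff[THEN iffD2] intro!: inj_onI)
  qed
  then have "dim (f ` P) = dim P" by (rule dim_image_eq[OF f])
  moreover have "f ` S \<subseteq> f ` P"
  proof
    fix z assume "z \<in> f ` S"
    then obtain x where x: "x \<in> S" "z = f x" by blast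
    obtain y w where yw: "y \<in> span K" "\<And>w'. w' \<in> span K \<Longrightarrow> orthogonal w w'" "x = y + w"
      using orthogonal_subspace_decomp_exists[of K x] by metis
    have "y \<in> K" using yw(1) K by (simp add: span_eq_iff[THEN iffD2])
    then have "w \<in> S" using x yw(3) S by (metis IntE K_def add_diff_cancel_left' subspace_diff)
    then have "w \<in> P" using yw(2) by (auto simp: P_def orthogonal_commute span_base)
    moreover have "f w = z" using x yw(3) \<open>y \<in> K\<close> f by (simp add: K_def linear_add)
    ultimately show "z \<in> f ` P" by blast
  qed
  then have "f ` S = f ` P" by (auto simp: P_def)
  ultimately show ?thesis by (simp add: K_def)
qed

text \<open>At \<open>y\<^sub>0\<close> the kernel of \<open>l\<close> meets that of the
  differential trivially, so \<open>F\<close> and \<open>l\<close> together form a local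
  diffeomorphism by the inverse function theorem, and \<open>l\<close> is a coordinate on the zero
  set.\<close>

lemma regular_curve_chart:
  fixes F :: "'a::euclidean_space \<times> real \<Rightarrow> 'a"
  assumes der: "\<And>y. (F has_derivative F' y) (at y)"
    and cont: "\<And>z. continuous_on UNIV (\<lambda>y. F' y z)"
    and y0: "F y\<^sub>0 = 0" and l: "bounded_linear l"
    and inj: "\<And>z. F' y\<^sub>0 z = 0 \<Longrightarrow> l z = 0 \<Longrightarrow> z = 0"
  obtains U e g where "open U" "y\<^sub>0 \<in> U" "(e::real) > 0"
    "homeomorphism (U \<inter> {y. F y = 0}) {-e<..<e} (\<lambda>y. l (y - y\<^sub>0)) g"
proof -
  define P where "P y = (F y, l (y - y\<^sub>0))" for y
  define P' where "P' y = Blinfun (\<lambda>z. (F' y z, l z))" for y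
  have P'_apply: "blinfun_apply (P' y) z = (F' y z, l z)" for y z
    unfolding P'_def
    by (subst bounded_linear_Blinfun_apply)
      (auto intro!: bounded_linear_Pair has_derivative_bounded_linear[OF der] l)
  have derP: "(P has_derivative blinfun_apply (P' y)) (at y)" for y
  proof -
    have "((\<lambda>y. l (y - y\<^sub>0)) has_derivative l) (at y)"
      by (auto intro!: derivative_eq_intros bounded_linear.has_derivative[OF l])
    then have "(P has_derivative (\<lambda>z. (F' y z, l z))) (at y)"
      unfolding P_def by (intro has_derivative_Pair der)
    then show ?thesis by (simp add: P'_apply[abs_def])
  qed
  have contP: "continuous_on UNIV P'"
    by (rule continuous_on_blinfun_componentwise)
      (auto simp: P'_apply intro!: continuous_intros cont)
  have lin: "linear (blinfun_apply (P' y\<^sub>0))"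
    by (intro bounded_linear.linear blinfun.bounded_linear_right)
  moreover have "inj (blinfun_apply (P' y\<^sub>0))"
    using inj by (subst linear_injective_0[OF lin]) (auto simp: P'_apply zero_prod_def)
  ultimately obtain h where h: "linear h" "\<And>z. h (P' y\<^sub>0 z) = z"
    by (metis linear_injective_left_inverse comp_apply id_apply)
  have "Blinfun h o\<^sub>L P' y\<^sub>0 = id_blinfun"
    using h by (intro blinfun_eqI) (simp add: bounded_linear_Blinfun_apply linear_linear)
  from inverse_function_theorem[OF open_UNIV derP contP UNIV_I this]
  obtain U V g where U: "open U" "y\<^sub>0 \<in> U" and V: "open V" "P y\<^sub>0 \<in> V" and hom: "homeomorphism U V P g"
    by metis
  have l0: "l 0 = 0" using l by (simp add: bounded_linear.linear linear_0)
  have P0: "P y\<^sub>0 = (0, 0)" by (simp add: P_def y0 l0)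
  have "open ((\<lambda>r. (0, r)) -` V)"
    by (intro open_vimage V continuous_intros)
  moreover have "(0::real) \<in> (\<lambda>r. (0, r)) -` V" using V P0 by simp
  ultimately obtain e where e: "e > 0" "ball 0 e \<subseteq> (\<lambda>r. (0, r)) -` V"
    using open_contains_ball by blast
  define U' where "U' = U \<inter> {y. \<bar>l (y - y\<^sub>0)\<bar> < e}"
  have lc: "continuous_on S (\<lambda>y. l (y - y\<^sub>0))" for S
    by (intro bounded_linear.continuous_on[OF l] continuous_intros)
  show ?thesis
  proof (rule that)
    show "open U'" unfolding U'_def
      by (intro open_Int U open_Collect_less continuous_intros lc)
    show "y\<^sub>0 \<in> U'" using U e by (simp add: U'_def l0)
    show "e > 0" by fact
    have inV: "(0, r) \<in> V" if "r \<in> {-e<..<e}" for r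
    proof -
      have "r \<in> ball 0 e" using that by (auto simp: dist_real_def)
      then show ?thesis using e(2) by blast
    qed
    have Pg: "P (g v) = v" "g v \<in> U" if "v \<in> V" for v
      using homeomorphism_apply2[OF hom that] homeomorphism_image2[OF hom] that by blast+
    have gP: "g (P y) = y" if "y \<in> U" for y
      using homeomorphism_apply1[OF hom that] .
    show "homeomorphism (U' \<inter> {y. F y = 0}) {-e<..<e} (\<lambda>y. l (y - y\<^sub>0)) (\<lambda>r. g (0, r))"
    proof (rule homeomorphismI)
      show "continuous_on {-e<..<e} (\<lambda>r. g (0, r))"
        by (rule continuous_on_compose2[OF homeomorphism_cont2[OF hom]])
          (use inV in \<open>auto intro!: continuous_intros\<close>)
      show "l (g (0, r) - y\<^sub>0) = r" if "r \<in> {-e<..<e}" for r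
        using Pg(1)[OF inV[OF that]] by (simp add: P_def)
      show "(\<lambda>r. g (0, r)) ` {-e<..<e} \<subseteq> U' \<inter> {y. F y = 0}"
        using Pg inV by (auto simp: U'_def P_def)
      show "g (0, l (y - y\<^sub>0)) = y" if "y \<in> U' \<inter> {y. F y = 0}" for y
        using gP[of y] that by (auto simp: U'_def P_def)
    qed (auto simp: U'_def lc)
  qed
qed

lemma surj_kernel_line:
  fixes f :: "'a::euclidean_space \<times> real \<Rightarrow> 'a"
  assumes f: "linear f" and "surj f"
  obtains v where "v \<noteq> 0" "{z. f z = 0} = span {v}"
proof -
  let ?K = "{z. f z = 0}"
  have K: "subspace ?K" by (rule linear_subspace_kernel[OF f])
  have "dim ?K = 1"
    using dim_image_kernel[OF f subspace_UNIV] assms(2) by simp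
  then obtain v where v: "v \<in> ?K" "v \<noteq> 0"
    by (metis One_nat_def dim_eq_0 subsetI singleton_iff zero_neq_one)
  have "span {v} = span ?K"
    by (rule dim_eq_span) (use v \<open>dim ?K = 1\<close> in auto)
  then have "?K = span {v}" using K by (metis span_eq_iff)
  with v that show ?thesis by blast
qed

text \<open>The zero set has one spare dimension, hence is a curve. By \<open>flat\<close> its
  tangent at a point with last coordinate 0 is spanned by \<open>(0, 1)\<close>, so the curve
  crosses the hyperplane transversally and the last coordinate is a chart of the half
  \<open>C\<close>.\<close>

lemma regular_curve_arc:
  fixes F :: "'a::euclidean_space \<times> real \<Rightarrow> 'a"
  defines "C \<equiv> {y. F y = 0 \<and> snd y \<ge> 0}"
  assumes der: "\<And>y. (F has_derivative F' y) (at y)"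
    and cont: "\<And>z. continuous_on UNIV (\<lambda>y. F' y z)"
    and surj: "\<And>y. F y = 0 \<Longrightarrow> surj (F' y)"
    and flat: "\<And>x. F' (x, 0) (0, 1) = 0"
    and compact: "compact C"
    and p: "F (p, 0) = 0"
  shows "\<exists>\<gamma>. arc \<gamma> \<and> path_image \<gamma> \<subseteq> C \<and> pathstart \<gamma> = (p, 0) \<and> snd (pathfinish \<gamma>) = 0 \<and>
    openin (top_of_set C) (path_image \<gamma>)"
proof -
  define B where "B = {y \<in> C. snd y = 0}"
  have chart: "\<exists>N f g (e::real). openin (top_of_set C) N \<and> x \<in> N \<and> e > 0 \<and> f x = 0 \<and>
        homeomorphism N (if x \<in> B then {0..<e} else {-e<..<e}) f g" if x: "x \<in> C" for x
  proof -
    have Fx: "F x = 0" using x by (simp add: C_def)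
    obtain v where v: "v \<noteq> 0" "{z. F' x z = 0} = span {v}"
      using surj_kernel_line[OF has_derivative_linear[OF der] surj[OF Fx]] .
    show ?thesis
    proof (cases "x \<in> B")
      case True
      then have sx: "snd x = 0" by (simp add: B_def)
      then have "F' x (0, 1) = 0" using flat[of "fst x"] by (metis prod.collapse)
      then have "(0, 1) \<in> span {v}" using v(2) by blast
      then obtain k where k: "(0, 1) = k *\<^sub>R v" by (auto simp: span_singleton)
      have "z = 0" if z: "F' x z = 0" "snd z = 0" for z
      proof -
        have "z \<in> span {v}" using v(2) z by blast
        then obtain k' where "z = k' *\<^sub>R v" by (auto simp: span_singleton)
        moreover have "k * snd v = 1" using arg_cong[OF k, of snd] by simp
        ultimately show ?thesis using z(2) by auto
      qed
      from regular_curve_chart[OF der cont Fx bounded_linear_snd this]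
      obtain U e g where U: "open U" "x \<in> U" "(e::real) > 0"
        and h: "homeomorphism (U \<inter> {y. F y = 0}) {-e<..<e} (\<lambda>y. snd (y - x)) g" .
      have snd: "snd (y - x) = snd y" for y using sx by simp
      have "homeomorphism (U \<inter> C) {0..<e} snd g"
      proof (rule homeomorphismI)
        show "continuous_on {0..<e} g"
          by (rule continuous_on_subset[OF homeomorphism_cont2[OF h]]) (use U(3) in auto)
        show "snd ` (U \<inter> C) \<subseteq> {0..<e}"
        proof clarify
          fix a b assume ab: "(a, b) \<in> U" "(a, b) \<in> C"
          then have "snd (a, b) \<in> {-e<..<e}"
            using homeomorphism_image1[OF h] unfolding snd by (force simp: C_def)
          then show "snd (a, b) \<in> {0..<e}" using ab by (simp add: C_def)
        qed
        show gC: "g ` {0..<e} \<subseteq> U \<inter> C"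
        proof
          fix y assume "y \<in> g ` {0..<e}"
          then obtain r where r: "r \<in> {0..<e}" "y = g r" by blast
          then have "r \<in> {-e<..<e}" using U(3) by auto
          then have "y \<in> U \<inter> {y. F y = 0}" "snd y = r"
            using homeomorphism_image2[OF h] homeomorphism_apply2[OF h] r(2) unfolding snd by blast+
          then show "y \<in> U \<inter> C" using r by (simp add: C_def)
        qed
        show "g (snd y) = y" if "y \<in> U \<inter> C" for y
          using homeomorphism_apply1[OF h, of y] that unfolding snd by (auto simp: C_def)
        show "snd (g r) = r" if "r \<in> {0..<e}" for r
          using homeomorphism_apply2[OF h, of r] that U(3) unfolding snd by auto
      qed (auto intro!: continuous_intros)
      moreover have "openin (top_of_set C) (U \<inter> C)" using U by (simp add: openin_open_Int Int_commute)
      ultimately show ?thesis using U x sx True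
        by (intro exI[of _ "U \<inter> C"] exI[of _ snd] exI[of _ g] exI[of _ e]) simp
    next
      case False
      then have sx: "snd x > 0" using x by (auto simp: B_def C_def)
      \<comment> \<open>Off the boundary the tangent vector \<open>v\<close> provides the chart,
        later shrunk to keep the last coordinate positive.\<close>
      have "z = 0" if z: "F' x z = 0" "v \<bullet> z = 0" for z
      proof -
        have "z \<in> span {v}" using v(2) z by blast
        then obtain k where "z = k *\<^sub>R v" by (auto simp: span_singleton)
        with z(2) v(1) show ?thesis by auto
      qed
      from regular_curve_chart[OF der cont Fx bounded_linear_inner_right this]
      obtain U e g where U: "open U" "x \<in> U" "(e::real) > 0"
        and h: "homeomorphism (U \<inter> {y. F y = 0}) {-e<..<e} (\<lambda>y. v \<bullet> (y - x)) g" .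
      have "g (v \<bullet> (x - x)) = x" by (rule homeomorphism_apply1[OF h]) (use U Fx in simp)
      then have g0: "g 0 = x" by simp
      have gc: "continuous_on {-e<..<e} g" using h by (simp add: homeomorphism_def)
      have "openin (top_of_set {-e<..<e}) ({-e<..<e} \<inter> g -` {y. snd y > 0})"
        by (intro continuous_openin_preimage_gen[OF gc] open_Collect_less continuous_intros)
      then have "open ({-e<..<e} \<inter> g -` {y. snd y > 0})" by (simp add: openin_open_eq)
      moreover have "0 \<in> {-e<..<e} \<inter> g -` {y. snd y > 0}" using U(3) g0 sx by simp
      ultimately obtain d where d: "d > 0" "ball 0 d \<subseteq> {-e<..<e} \<inter> g -` {y. snd y > 0}"
        using open_contains_ball by blast
      have ball: "ball 0 d = {-d<..<d}" by (auto simp: dist_real_def)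
      define N where "N = C \<inter> (U \<inter> {y. \<bar>v \<bullet> (y - x)\<bar> < d})"
      have "homeomorphism N {-d<..<d} (\<lambda>y. v \<bullet> (y - x)) g"
      proof (rule homeomorphismI)
        show "continuous_on {-d<..<d} g"
          using d(2) unfolding ball by (intro continuous_on_subset[OF gc]) auto
        show "g ` {-d<..<d} \<subseteq> N"
        proof
          fix y assume "y \<in> g ` {-d<..<d}"
          then obtain r where r: "r \<in> {-d<..<d}" "y = g r" by blast
          then have r': "r \<in> {-e<..<e}" "snd y > 0" using d(2) unfolding ball by auto
          then have "y \<in> U \<inter> {y. F y = 0}" "v \<bullet> (y - x) = r"
            using homeomorphism_image2[OF h] homeomorphism_apply2[OF h] r(2) by blast+
          then show "y \<in> N" using r r' by (auto simp: C_def N_def)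
        qed
        show "g (v \<bullet> (y - x)) = y" if "y \<in> N" for y
          using homeomorphism_apply1[OF h, of y] that by (auto simp: C_def N_def)
        show "v \<bullet> (g r - x) = r" if "r \<in> {-d<..<d}" for r
          using homeomorphism_apply2[OF h, of r] that d(2) unfolding ball by blast
      qed (auto simp: N_def intro!: continuous_intros)
      moreover have "openin (top_of_set C) N"
        unfolding N_def by (intro openin_open_Int open_Int U open_Collect_less continuous_intros)
      ultimately show ?thesis using x U d False
        by (intro exI[of _ N] exI[of _ "\<lambda>y. v \<bullet> (y - x)"] exI[of _ g] exI[of _ d]) (simp add: N_def)
    qed
  qed
  have curve: "bordered_curve C B"
    unfolding bordered_curve_def using compact chart by (auto simp: B_def)
  moreover have "(p, 0) \<in> B" using p by (simp add: B_def C_def)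
  ultimately obtain \<gamma> where \<gamma>: "arc \<gamma>" "path_image \<gamma> \<subseteq> C" "pathstart \<gamma> = (p, 0)" "pathfinish \<gamma> \<in> B"
    using bordered_curve_arc by blast
  moreover have "openin (top_of_set C) (path_image \<gamma>)"
    using arc_image_open[OF curve \<gamma>(1,2)] \<gamma>(3,4) \<open>(p, 0) \<in> B\<close> by simp
  ultimately show ?thesis by (auto simp: B_def)
qed

text \<open>The arc is open and closed in \<open>C\<close>, and its image under \<open>T\<close> is
  connected and meets it, so \<open>T\<close> maps the arc into itself. In the parameter interval
  Brouwer's theorem applies.\<close>

lemma open_arc_fixed_point:
  fixes T :: "'a::euclidean_space \<Rightarrow> 'a"
  assumes \<gamma>: "arc \<gamma>" "path_image \<gamma> \<subseteq> C" "openin (top_of_set C) (path_image \<gamma>)"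
    and T: "continuous_on C T" "T ` C \<subseteq> C" "T (pathstart \<gamma>) \<in> path_image \<gamma>"
  shows "\<exists>y\<in>path_image \<gamma>. T y = y"
proof -
  define A where "A = path_image \<gamma>"
  have TA: "T ` A \<subseteq> A"
  proof -
    have "connected (T ` A)"
      unfolding A_def using \<gamma>
      by (intro connected_continuous_image continuous_on_subset[OF T(1)] connected_path_image arc_imp_path)
    moreover have sub: "T ` A \<subseteq> C" using T(2) \<gamma>(2) by (auto simp: A_def)
    moreover have "openin (top_of_set (T ` A)) (T ` A \<inter> A)"
      using \<gamma>(3) sub unfolding A_def openin_open by blast
    moreover have "closedin (top_of_set (T ` A)) (T ` A \<inter> A)"
      unfolding A_def using \<gamma>(1) by (intro closedin_closed_Int closed_path_image arc_imp_path)
    moreover have "T ` A \<inter> A \<noteq> {}" using T(3) by (auto simp: A_def)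
    ultimately show ?thesis unfolding connected_clopen by blast
  qed
  obtain h where h: "homeomorphism {0..1} (path_image \<gamma>) \<gamma> h"
    using homeomorphism_arc[OF \<gamma>(1)] .
  have im: "\<gamma> ` {0..1} = A" "h ` A = {0..1}"
    using homeomorphism_image1[OF h] homeomorphism_image2[OF h] by (auto simp: A_def)
  have "continuous_on A T" unfolding A_def by (rule continuous_on_subset[OF T(1) \<gamma>(2)])
  moreover have "continuous_on (T ` A) h"
    using homeomorphism_cont2[OF h] TA unfolding A_def by (rule continuous_on_subset)
  ultimately have "continuous_on A (h \<circ> T)" by (rule continuous_on_compose)
  then have "continuous_on {0..1} (h \<circ> T \<circ> \<gamma>)"
    using continuous_on_compose[OF homeomorphism_cont1[OF h], of "h \<circ> T"] im(1) by simp
  moreover have "(h \<circ> T \<circ> \<gamma>) \<in> {0..1} \<rightarrow> {0..1}"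
  proof
    fix t :: real assume "t \<in> {0..1}"
    then have "T (\<gamma> t) \<in> A" using im(1) TA by blast
    then show "(h \<circ> T \<circ> \<gamma>) t \<in> {0..1}" using im(2) by force
  qed
  ultimately obtain x where x: "x \<in> {0..1}" "(h \<circ> T \<circ> \<gamma>) x = x"
    using brouwer[of "{0..1::real}" "h \<circ> T \<circ> \<gamma>"] by auto
  have "\<gamma> x \<in> A" using x by (auto simp: A_def path_image_def)
  then have "T (\<gamma> x) \<in> A" using TA by blast
  then have "\<gamma> (h (T (\<gamma> x))) = T (\<gamma> x)" using homeomorphism_apply2[OF h] by (simp add: A_def)
  then have "T (\<gamma> x) = \<gamma> x" using x by simp
  then show ?thesis using \<open>\<gamma> x \<in> A\<close> by (auto simp: A_def)
qed


section \<open>Stresses\<close>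

lemma sum_UNIV_pairs:
  "(\<Sum>p\<in>UNIV. f p) = (\<Sum>u\<in>UNIV. \<Sum>w\<in>UNIV. f (u::'v::finite, w::'w::finite))"
  unfolding UNIV_Times_UNIV[symmetric] sum.cartesian_product by simp

text \<open>The polarised squared edge lengths: \<open>rig E p p\<close> lists the squared lengths,
  and \<open>rig E p\<close> is half their differential at \<open>p\<close>, the rigidity matrix.
  Indexing by all ordered pairs makes the codomain independent of \<open>E\<close>.\<close>

definition rig :: "'v::finite set set \<Rightarrow> ('n::finite, 'v) framework \<Rightarrow> ('n, 'v) framework \<Rightarrow> real ^ ('v \<times> 'v)" where
  "rig E p c = (\<chi> e. if {fst e, snd e} \<in> E then (p $ fst e - p $ snd e) \<bullet> (c $ fst e - c $ snd e) else 0)"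

text \<open>The contribution of a single coordinate to \<open>rig\<close>; for \<open>h = g\<close>
  it is the gain in squared edge lengths when \<open>h\<close> is added as a further
  coordinate.\<close>

definition edge_prod :: "'v::finite set set \<Rightarrow> real ^ 'v \<Rightarrow> real ^ 'v \<Rightarrow> real ^ ('v \<times> 'v)" where
  "edge_prod E h g = (\<chi> e. if {fst e, snd e} \<in> E then (h $ fst e - h $ snd e) * (g $ fst e - g $ snd e) else 0)"

definition coord :: "'n \<Rightarrow> ('n::finite, 'v::finite) framework \<Rightarrow> real ^ 'v" where
  "coord i p = (\<chi> v. p $ v $ i)"

definition edge_supported :: "'v::finite set set \<Rightarrow> real ^ ('v \<times> 'v) \<Rightarrow> bool" where
  "edge_supported E y \<longleftrightarrow> (\<forall>u w. y $ (u, w) = y $ (w, u)) \<and> (\<forall>u w. {u, w} \<notin> E \<longrightarrow> y $ (u, w) = 0)"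

text \<open>The bilinear form of the stress matrix (weighted graph Laplacian) of \<open>\<omega>\<close>.\<close>

definition stress_form :: "real ^ ('v::finite \<times> 'v) \<Rightarrow> real ^ 'v \<Rightarrow> real ^ 'v \<Rightarrow> real" where
  "stress_form \<omega> h g = (\<Sum>u\<in>UNIV. \<Sum>w\<in>UNIV. \<omega> $ (u, w) * (h $ u - h $ w) * g $ u)"

definition stress :: "'v::finite set set \<Rightarrow> ('n::finite, 'v) framework \<Rightarrow> real ^ ('v \<times> 'v) \<Rightarrow> bool" where
  "stress E p \<omega> \<longleftrightarrow> edge_supported E \<omega> \<and> (\<forall>i g. stress_form \<omega> (coord i p) g = 0)"

definition stress_kernel :: "'v::finite set set \<Rightarrow> ('n::finite, 'v) framework \<Rightarrow> (real ^ 'v) set" where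
  "stress_kernel E p = {h. \<forall>\<omega> g. stress E p \<omega> \<longrightarrow> stress_form \<omega> h g = 0}"

lemma rig_nth: "rig E p c $ (u, w) = (if {u, w} \<in> E then (p $ u - p $ w) \<bullet> (c $ u - c $ w) else 0)"
  and edge_prod_nth: "edge_prod E h g $ (u, w) = (if {u, w} \<in> E then (h $ u - h $ w) * (g $ u - g $ w) else 0)"
  and coord_nth: "coord i p $ v = p $ v $ i"
  by (simp_all add: rig_def edge_prod_def coord_def)

lemma rig_commute: "rig E p c = rig E c p"
  by (simp add: vec_eq_iff rig_nth inner_commute)

lemma linear_rig: "linear (rig E p)"
  by (rule linearI) (auto simp: vec_eq_iff rig_nth algebra_simps)

lemma bilinear_rig: "bilinear (rig E :: ('n::finite, 'v::finite) framework \<Rightarrow> _)"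
proof -
  have "(\<lambda>x. rig E x y) = rig E y" for y :: "('n, 'v) framework"
    by (rule ext) (rule rig_commute)
  then show ?thesis by (simp add: bilinear_def linear_rig)
qed

lemma rig_eq_sum_edge_prod: "rig E p c = (\<Sum>i\<in>UNIV. edge_prod E (coord i p) (coord i c))"
  by (auto simp: vec_eq_iff rig_nth edge_prod_nth coord_nth inner_vec_def)

lemma edge_supported_rig: "edge_supported E (rig E p c)"
  by (auto simp: edge_supported_def rig_nth insert_commute inner_diff_left inner_diff_right)

lemma edge_supported_edge_prod: "edge_supported E (edge_prod E h g)"
  by (auto simp: edge_supported_def edge_prod_nth insert_commute algebra_simps)

lemma stress_form_sym:
  assumes "edge_supported E \<omega>"
  shows "stress_form \<omega> h g = stress_form \<omega> g h"
proof -
  have sym: "\<omega> $ (w, u) = \<omega> $ (u, w)" for u w using assms by (simp add: edge_supported_def)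
  have "(\<Sum>u\<in>UNIV. \<Sum>w\<in>UNIV. \<omega> $ (u, w) * h $ w * g $ u) = (\<Sum>u\<in>UNIV. \<Sum>w\<in>UNIV. \<omega> $ (u, w) * g $ w * h $ u)"
    by (subst sum.swap) (simp add: sym mult_ac)
  then show ?thesis
    unfolding stress_form_def by (simp add: algebra_simps sum_subtractf)
qed

text \<open>Every edge occurs in both orientations, whence the factor 2.\<close>

lemma inner_edge_prod:
  assumes "edge_supported E \<omega>"
  shows "\<omega> \<bullet> edge_prod E h g = 2 * stress_form \<omega> h g"
proof -
  have sym: "\<omega> $ (w, u) = \<omega> $ (u, w)" and supp: "{u, w} \<notin> E \<Longrightarrow> \<omega> $ (u, w) = 0" for u w
    using assms by (simp_all add: edge_supported_def)
  have "\<omega> \<bullet> edge_prod E h g = (\<Sum>u\<in>UNIV. \<Sum>w\<in>UNIV. \<omega> $ (u, w) * ((h $ u - h $ w) * (g $ u - g $ w)))"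
    unfolding inner_vec_def sum_UNIV_pairs using supp by (intro sum.cong refl) (auto simp: edge_prod_nth)
  also have "\<dots> = stress_form \<omega> h g - (\<Sum>u\<in>UNIV. \<Sum>w\<in>UNIV. \<omega> $ (u, w) * (h $ u - h $ w) * g $ w)"
    unfolding stress_form_def sum_subtractf[symmetric] by (intro sum.cong refl) (simp add: algebra_simps)
  also have "(\<Sum>u\<in>UNIV. \<Sum>w\<in>UNIV. \<omega> $ (u, w) * (h $ u - h $ w) * g $ w) = - stress_form \<omega> h g"
    unfolding stress_form_def sum_negf[symmetric]
    by (subst sum.swap) (intro sum.cong refl, simp add: sym algebra_simps)
  finally show ?thesis by simp
qed

lemma inner_rig:
  assumes "edge_supported E \<omega>"
  shows "\<omega> \<bullet> rig E p c = 2 * (\<Sum>i\<in>UNIV. stress_form \<omega> (coord i p) (coord i c))"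
  unfolding rig_eq_sum_edge_prod inner_sum_right inner_edge_prod[OF assms] by (simp add: sum_distrib_left)

lemma stress_form_axis: "stress_form \<omega> h (axis u 1) = (\<Sum>w\<in>UNIV. \<omega> $ (u, w) * (h $ u - h $ w))"
proof -
  have "stress_form \<omega> h (axis u 1) =
      (\<Sum>u'\<in>UNIV. if u' = u then (\<Sum>w\<in>UNIV. \<omega> $ (u, w) * (h $ u - h $ w)) else 0)"
    unfolding stress_form_def by (intro sum.cong refl) (auto simp: axis_def)
  then show ?thesis by simp
qed

lemma stress_form_eq: "stress_form \<omega> h g = (\<Sum>u\<in>UNIV. g $ u * stress_form \<omega> h (axis u 1))"
  by (simp only: stress_form_axis) (simp add: stress_form_def sum_distrib_left mult_ac)

lemma stress_form_linear_left: "linear (\<lambda>h. stress_form \<omega> h g)"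
  by (rule linearI)
    (auto simp: stress_form_def algebra_simps sum.distrib sum_subtractf sum_distrib_left)

lemma subspace_stress_kernel: "subspace (stress_kernel E p)"
  unfolding stress_kernel_def subspace_def
  by (simp add: linear_0[OF stress_form_linear_left] linear_add[OF stress_form_linear_left]
    linear_scale[OF stress_form_linear_left])

lemma const_in_stress_kernel: "(\<chi> v. a) \<in> stress_kernel E p"
  by (simp add: stress_kernel_def stress_form_def)

lemma coord_in_stress_kernel: "coord i p \<in> stress_kernel E p"
  by (simp add: stress_kernel_def stress_def)

lemma stress_inner_rig: "stress E p \<omega> \<Longrightarrow> \<omega> \<bullet> rig E p c = 0"
  by (simp add: stress_def inner_rig)

lemma coord_axis: "coord i (axis u (axis j 1)) = (if i = j then axis u 1 else 0)"
  by (simp add: vec_eq_iff coord_nth axis_def)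

lemma stress_form_0: "stress_form \<omega> h 0 = 0"
  by (simp add: stress_form_def)

text \<open>Displacing one vertex in one coordinate direction isolates one entry of the equilibrium
  condition.\<close>

lemma stressI:
  assumes "edge_supported E \<omega>" "\<And>c. \<omega> \<bullet> rig E p c = 0"
  shows "stress E p \<omega>"
proof -
  have "stress_form \<omega> (coord j p) (axis u 1) = 0" for j u
  proof -
    have "(\<Sum>i\<in>UNIV. stress_form \<omega> (coord i p) (coord i (axis u (axis j 1)))) =
        (\<Sum>i\<in>UNIV. if i = j then stress_form \<omega> (coord j p) (axis u 1) else 0)"
      by (intro sum.cong refl) (auto simp: coord_axis stress_form_0)
    then show ?thesis using assms(2)[of "axis u (axis j 1)"] by (simp add: inner_rig[OF assms(1)])
  qed
  then have "stress_form \<omega> (coord j p) g = 0" for j g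
    by (subst stress_form_eq) simp
  then show ?thesis using assms(1) by (simp add: stress_def)
qed

text \<open>The component of \<open>y\<close> orthogonal to the range is again supported on edges,
  so it is a stress; hence it is orthogonal to \<open>y\<close> and must vanish.\<close>

lemma range_rig_eq_stress_orthogonal:
  assumes y: "edge_supported E y" and orth: "\<And>\<omega>. stress E p \<omega> \<Longrightarrow> \<omega> \<bullet> y = 0"
  obtains c where "rig E p c = y"
proof -
  have R: "subspace (range (rig E p))"
    by (simp add: linear_rig linear_subspace_image)
  obtain r z where rz: "r \<in> span (range (rig E p))"
      "\<And>w. w \<in> span (range (rig E p)) \<Longrightarrow> orthogonal z w" "y = r + z"
    using orthogonal_subspace_decomp_exists[of "range (rig E p)" y] by metis
  have sp: "span (range (rig E p)) = range (rig E p)" using R by (simp add: span_eq_iff)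
  obtain c where c: "r = rig E p c" using rz(1) sp by auto
  have "edge_supported E z"
  proof -
    have "z = y - rig E p c" using rz(3) c by simp
    then show ?thesis using y edge_supported_rig[of E p c] by (simp add: edge_supported_def)
  qed
  moreover have "z \<bullet> rig E p c' = 0" for c'
    using rz(2) sp by (auto simp: orthogonal_def)
  ultimately have "stress E p z" by (rule stressI)
  then have "z \<bullet> y = 0" by (rule orth)
  moreover have "z \<bullet> r = 0" using rz(1,2) by (auto simp: orthogonal_def)
  ultimately have "z = 0" using rz(3) by (simp add: inner_add_right)
  then show ?thesis using that c rz(3) by simp
qed

section \<open>Derivations applied to frameworks and stresses\<close>

definition dvec :: "(real \<Rightarrow> real) \<Rightarrow> real ^ 'i \<Rightarrow> real ^ 'i" where
  "dvec D x = (\<chi> i. D (x $ i))"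

definition dfw :: "(real \<Rightarrow> real) \<Rightarrow> ('n::finite, 'v::finite) framework \<Rightarrow> ('n, 'v) framework" where
  "dfw D p = (\<chi> v. dvec D (p $ v))"

lemma dvec_nth [simp]: "dvec D x $ i = D (x $ i)"
  by (simp add: dvec_def)

lemma dfw_nth [simp]: "dfw D p $ v = dvec D (p $ v)"
  by (simp add: dfw_def)

lemma coord_dfw: "coord i (dfw D p) = dvec D (coord i p)"
  by (simp add: vec_eq_iff coord_nth)

lemma generic_alg_indep: "generic_framework \<rho> \<longleftrightarrow> alg_indep (\<lambda>(v, i). \<rho> $ v $ i)"
  by (simp add: generic_framework_def alg_indep_def)

lemma generic_derivation:
  assumes "generic_framework \<rho>"
  obtains D where "derivation D" "dfw D \<rho> = c"
proof -
  obtain D where D: "derivation D" "\<And>x. D ((\<lambda>(v, i). \<rho> $ v $ i) x) = (\<lambda>(v, i). c $ v $ i) x"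
    using alg_indep_derivation[of "\<lambda>(v, i). \<rho> $ v $ i" "\<lambda>(v, i). c $ v $ i"] assms
    by (metis generic_alg_indep)
  have "dfw D \<rho> = c" using D(2)[of "(_, _)"] by (simp add: vec_eq_iff)
  with D(1) that show ?thesis by blast
qed

context
  fixes D assumes D: "derivation D"
begin

lemma dvec_rig: "dvec D (rig E p p) = 2 *\<^sub>R rig E p (dfw D p)"
proof -
  have "D ((p $ u - p $ w) \<bullet> (p $ u - p $ w)) = 2 * ((p $ u - p $ w) \<bullet> (dfw D p $ u - dfw D p $ w))" for u w
    by (simp add: inner_vec_def derivation_sum[OF D] derivation_mult[OF D] derivation_diff[OF D]
        sum_distrib_left mult.commute)
  then show ?thesis
    by (auto simp: vec_eq_iff rig_nth derivation_0[OF D])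
qed

text \<open>The product rule, applied to the equation that \<open>\<omega>\<close> annihilates
  \<open>h\<close>. The entries of \<open>\<omega>\<close> may be any reals, as \<open>D\<close>
  acts on the whole field.\<close>

lemma stress_form_dvec:
  assumes "\<And>g. stress_form \<omega> h g = 0"
  shows "stress_form (dvec D \<omega>) h g = - stress_form \<omega> (dvec D h) g"
proof -
  have "stress_form (dvec D \<omega>) h (axis u 1) + stress_form \<omega> (dvec D h) (axis u 1) = 0" for u
  proof -
    have "0 = D (\<Sum>w\<in>UNIV. \<omega> $ (u, w) * (h $ u - h $ w))"
      using assms[of "axis u 1"] by (simp add: stress_form_axis derivation_0[OF D])
    also have "\<dots> = (\<Sum>w\<in>UNIV. \<omega> $ (u, w) * (D (h $ u) - D (h $ w)) + D (\<omega> $ (u, w)) * (h $ u - h $ w))"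
      by (simp add: derivation_sum[OF D] derivation_mult[OF D] derivation_diff[OF D])
    finally show ?thesis by (simp add: stress_form_axis sum.distrib)
  qed
  then have "stress_form (dvec D \<omega>) h (axis u 1) = - stress_form \<omega> (dvec D h) (axis u 1)" for u
    by (simp add: eq_neg_iff_add_eq_0)
  then show ?thesis
    by (subst (1 2) stress_form_eq) (simp add: sum_negf)
qed

lemma edge_supported_dvec: "edge_supported E \<omega> \<Longrightarrow> edge_supported E (dvec D \<omega>)"
  by (simp add: edge_supported_def derivation_0[OF D])

text \<open>By the product rule the equilibrium defect of \<open>dvec D \<omega>\<close> is, up to
  sign, \<open>\<omega>\<close> applied to the derived coordinates, and these lie in the stress
  kernel.\<close>

lemma stress_dvec:
  assumes "\<And>i. coord i (dfw D p) \<in> stress_kernel E p" "stress E p \<omega>"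
  shows "stress E p (dvec D \<omega>)"
  using assms unfolding stress_def stress_kernel_def
  by (auto simp: edge_supported_dvec stress_form_dvec coord_dfw)

lemma dvec_stress_kernel:
  assumes "\<And>i. coord i (dfw D p) \<in> stress_kernel E p" "h \<in> stress_kernel E p"
  shows "dvec D h \<in> stress_kernel E p"
  unfolding stress_kernel_def
proof clarify
  fix \<omega> g assume \<omega>: "stress E p \<omega>"
  have "stress_form (dvec D \<omega>) h g = 0"
    using stress_dvec[OF assms(1) \<omega>] assms(2) by (simp add: stress_kernel_def)
  moreover have "stress_form (dvec D \<omega>) h g = - stress_form \<omega> (dvec D h) g"
    using assms(2) \<omega> by (intro stress_form_dvec) (simp add: stress_kernel_def)
  ultimately show "stress_form \<omega> (dvec D h) g = 0" by simp
qed

end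

text \<open>
  The linearity of the fibres of the Gauss map.  The stress \<open>\<omega>\<close> is deformed along with \<open>\<rho>\<close> by a
  derivation; since the deformation keeps annihilating both sides, \<open>c\<close> lies in the kernel of \<open>\<omega>\<close>.
\<close>

lemma rig_preimage_in_stress_kernel:
  assumes \<rho>: "generic_framework \<rho>"
    and h: "h \<in> stress_kernel E \<rho>" and g: "g \<in> stress_kernel E \<rho>" and c: "rig E \<rho> c = edge_prod E h g"
  shows "coord i c \<in> stress_kernel E \<rho>"
proof -
  have "stress_form \<omega> (coord i c) (axis u 1) = 0" if \<omega>: "stress E \<rho> \<omega>" for \<omega> u
  proof -
    \<comment> \<open>The direction \<open>b\<close> moves one coordinate of one vertex and so
      singles out one entry of \<open>\<omega>\<close> applied to \<open>c\<close>.\<close>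
    define b :: "('a, 'b) framework" where "b = axis u (axis i 1)"
    obtain D where D: "derivation D" "dfw D \<rho> = b" using generic_derivation[OF \<rho>] .
    have supp: "edge_supported E \<omega>" using \<omega> by (simp add: stress_def)
    then have supp': "edge_supported E (dvec D \<omega>)" by (rule edge_supported_dvec[OF D(1)])
    have h0: "stress_form \<omega> h f = 0" and g0: "stress_form \<omega> g f = 0" for f
      using h g \<omega> by (simp_all add: stress_kernel_def)
    \<comment> \<open>Whatever the derivative of \<open>h\<close> is, the form vanishes because
      \<open>\<omega>\<close> annihilates \<open>g\<close>.\<close>
    have "dvec D \<omega> \<bullet> edge_prod E h g = - (2 * stress_form \<omega> (dvec D h) g)"
      by (simp add: inner_edge_prod[OF supp'] stress_form_dvec[OF D(1) h0])
    also have "\<dots> = 0" by (simp add: stress_form_sym[OF supp, of "dvec D h"] g0)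
    finally have "0 = dvec D \<omega> \<bullet> rig E \<rho> c" by (simp add: c)
    also have "\<dots> = - (2 * (\<Sum>j\<in>UNIV. stress_form \<omega> (coord j b) (coord j c)))"
    proof -
      have "stress_form (dvec D \<omega>) (coord j \<rho>) (coord j c) = - stress_form \<omega> (coord j b) (coord j c)" for j
        using \<omega> stress_form_dvec[OF D(1), of \<omega> "coord j \<rho>" "coord j c"]
        by (simp add: stress_def D(2)[symmetric] coord_dfw)
      then show ?thesis by (simp add: inner_rig[OF supp'] sum_negf)
    qed
    also have "(\<Sum>j\<in>UNIV. stress_form \<omega> (coord j b) (coord j c)) =
        (\<Sum>j\<in>UNIV. if j = i then stress_form \<omega> (coord i c) (axis u 1) else 0)"
      unfolding stress_form_sym[OF supp, of "coord _ b"]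
      by (intro sum.cong refl) (auto simp: b_def coord_axis stress_form_0)
    finally show ?thesis by simp
  qed
  then have "stress_form \<omega> (coord i c) f = 0" if "stress E \<rho> \<omega>" for \<omega> f
    using that by (subst stress_form_eq) simp
  then show ?thesis by (simp add: stress_kernel_def)
qed

text \<open>A stress annihilates \<open>h\<close>, so it is orthogonal to the product. Thus length
  changes quadratic in the stress kernel can be balanced by displacements within the kernel.\<close>

lemma edge_prod_in_range_rig:
  assumes \<rho>: "generic_framework \<rho>"
    and h: "h \<in> stress_kernel E \<rho>" and g: "g \<in> stress_kernel E \<rho>"
  obtains c where "rig E \<rho> c = edge_prod E h g" "\<And>i. coord i c \<in> stress_kernel E \<rho>"
proof -
  obtain c where c: "rig E \<rho> c = edge_prod E h g"
  proof (rule range_rig_eq_stress_orthogonal[OF edge_supported_edge_prod])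
    show "\<omega> \<bullet> edge_prod E h g = 0" if "stress E \<rho> \<omega>" for \<omega>
      using that h by (simp add: inner_edge_prod stress_def stress_kernel_def)
  qed
  then show ?thesis using that rig_preimage_in_stress_kernel[OF assms] by blast
qed


section \<open>Ranks at generic frameworks\<close>

definition fw_of :: "('v::finite \<times> 'n::finite \<Rightarrow> real) \<Rightarrow> ('n, 'v) framework" where
  "fw_of z = (\<chi> v i. z (v, i))"

lemma fw_of_coords: "fw_of (\<lambda>(v, i). \<rho> $ v $ i) = \<rho>"
  by (simp add: fw_of_def vec_eq_iff)

lemma Basis_vec_nth: "b \<in> Basis \<Longrightarrow> b $ i \<in> insert 0 Basis"
  by (auto simp: Basis_vec_def axis_def)

lemma rat_poly_fun_01: "x \<in> insert 0 Basis \<Longrightarrow> rat_poly_fun (\<lambda>z. x)"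
  by (auto simp: rat_poly_fun_0 rat_poly_fun_1)

lemma Basis_vec_nth0: "b \<in> insert 0 Basis \<Longrightarrow> b $ i \<in> insert 0 Basis"
  using Basis_vec_nth by auto

lemma rat_poly_fun_rig:
  assumes "\<And>u i. rat_poly_fun (\<lambda>z::'v \<times> 'n \<Rightarrow> real. c $ u $ i)"
  shows "rat_poly_fun (\<lambda>z. rig E (fw_of z :: ('n::finite, 'v::finite) framework) c $ e)"
proof (cases e)
  case (Pair u w)
  have "rat_poly_fun (\<lambda>z::'v \<times> 'n \<Rightarrow> real. \<Sum>i\<in>UNIV. (z (u, i) - z (w, i)) * (c $ u $ i - c $ w $ i))"
    by (intro rat_poly_fun_intros assms)
  then show ?thesis
    by (cases "{u, w} \<in> E") (simp_all add: Pair rig_nth inner_vec_def fw_of_def rat_poly_fun_0)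
qed

lemma generic_rank_le:
  fixes L :: "('n::finite, 'v::finite) framework \<Rightarrow> 'a::euclidean_space \<Rightarrow> 'b::euclidean_space"
  assumes "generic_framework \<rho>" "\<And>p. linear (L p)"
    and "\<And>a b. a \<in> Basis \<Longrightarrow> b \<in> Basis \<Longrightarrow> rat_poly_fun (\<lambda>z. L (fw_of z) a \<bullet> b)"
  shows "dim (range (L p)) \<le> dim (range (L \<rho>))"
  using alg_indep_rank[of "\<lambda>(v, i). \<rho> $ v $ i" "\<lambda>z. L (fw_of z)" "\<lambda>(v, i). p $ v $ i"] assms
  by (simp add: generic_alg_indep fw_of_coords)

lemma rig_rank_le:
  fixes \<rho> p :: "('n::finite, 'v::finite) framework"
  assumes "generic_framework \<rho>"
  shows "dim (range (rig E p)) \<le> dim (range (rig E \<rho>))"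
proof (rule generic_rank_le[OF assms linear_rig])
  fix a :: "('n, 'v) framework" and b :: "real ^ ('v \<times> 'v)"
  assume "a \<in> Basis" "b \<in> Basis"
  then show "rat_poly_fun (\<lambda>z. rig E (fw_of z) a \<bullet> b)"
    by (auto simp: Basis_vec_def inner_axis intro!: rat_poly_fun_rig rat_poly_fun_01) (auto simp: axis_def)
qed

text \<open>Infinitesimal rigidity: \<open>rig UNIV p c = 0\<close> says that \<open>c\<close>
  preserves all distances to first order, which avoids a description of the trivial flexes.\<close>

definition rigid :: "'v::finite set set \<Rightarrow> ('n::finite, 'v) framework \<Rightarrow> bool" where
  "rigid E p \<longleftrightarrow> (\<forall>c. rig E p c = 0 \<longrightarrow> rig UNIV p c = 0)"

definition affine_kernel :: "('n::finite, 'v::finite) framework \<Rightarrow> (real ^ 'v) set" where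
  "affine_kernel p = range (\<lambda>(a, x). \<chi> v. a + x \<bullet> p $ v)"

lemma linear_affine_fun: "linear (\<lambda>(a, x). \<chi> v. a + x \<bullet> p $ v)"
  by (rule linearI) (auto simp: vec_eq_iff algebra_simps)

lemma subspace_affine_kernel: "subspace (affine_kernel p)"
  unfolding affine_kernel_def by (intro linear_subspace_image linear_affine_fun subspace_UNIV)

lemma affine_kernel_subset: "affine_kernel p \<subseteq> stress_kernel E p"
proof
  fix h assume "h \<in> affine_kernel p"
  then obtain a x where h: "h = (\<chi> v. a + x \<bullet> p $ v)" by (auto simp: affine_kernel_def)
  have "h = (\<chi> v. a) + (\<Sum>i\<in>UNIV. (x $ i) *\<^sub>R coord i p)"
    by (simp add: h vec_eq_iff inner_vec_def coord_nth)
  then show "h \<in> stress_kernel E p"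
    using subspace_stress_kernel[of E p]
    by (auto intro!: subspace_add subspace_sum subspace_scale const_in_stress_kernel coord_in_stress_kernel)
qed

lemma dim_kernel_eq: "linear f \<Longrightarrow> dim {x. f x = 0} = DIM('a) - dim (range f)"
  for f :: "'a::euclidean_space \<Rightarrow> 'b::euclidean_space"
  using dim_image_kernel[of f UNIV] by simp

text \<open>The kernels for \<open>E\<close> and for all pairs are nested, with dimensions that are
  the same at all generic frameworks; so equality at one of them gives equality at the
  other.\<close>

lemma rigid_transfer:
  fixes \<rho> \<rho>\<^sub>0 :: "('n::finite, 'v::finite) framework"
  assumes "generic_framework \<rho>" "generic_framework \<rho>\<^sub>0" "rigid E \<rho>"
  shows "rigid E \<rho>\<^sub>0"
proof -
  have rk: "dim (range (rig F \<rho>)) = dim (range (rig F \<rho>\<^sub>0))" for F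
    using rig_rank_le assms(1,2) by (intro antisym) auto
  have sub: "{c. rig UNIV p c = 0} \<subseteq> {c. rig E p c = 0}" for p :: "('n, 'v) framework"
    by (auto simp: vec_eq_iff rig_nth)
  have "{c. rig UNIV \<rho> c = 0} = {c. rig E \<rho> c = 0}"
    using sub assms(3) by (auto simp: rigid_def)
  then have "dim (range (rig UNIV \<rho>)) = dim (range (rig E \<rho>))"
    using dim_image_kernel[OF linear_rig subspace_UNIV, of UNIV \<rho>]
      dim_image_kernel[OF linear_rig subspace_UNIV, of E \<rho>] by simp
  then have "dim {c. rig E \<rho>\<^sub>0 c = 0} = dim {c. rig UNIV \<rho>\<^sub>0 c = 0}"
    by (simp add: dim_kernel_eq linear_rig rk)
  then have "{c. rig UNIV \<rho>\<^sub>0 c = 0} = {c. rig E \<rho>\<^sub>0 c = 0}"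
    using sub by (intro subspace_dim_equal) (auto intro: linear_subspace_kernel linear_rig)
  then show ?thesis by (auto simp: rigid_def)
qed

text \<open>
  Whether \<open>h\<close> lies in the stress kernel is decided by solving the linear system \<open>kernel_map\<close>, whose
  coefficients are polynomials in the coordinates of the framework (those of the stresses are not).
\<close>

definition kernel_map :: "'v::finite set set \<Rightarrow> ('n::finite, 'v) framework \<Rightarrow>
    (real ^ 'v) \<times> (real ^ 'n ^ 'v ^ 'v) \<Rightarrow> real ^ ('v \<times> 'v) ^ 'v" where
  "kernel_map E p hQ = (\<chi> u. edge_prod E (fst hQ) (axis u 1) - rig E p (snd hQ $ u))"

text \<open>Up to sign the part of \<open>kernel_map\<close> with \<open>h = 0\<close>; its null
  space measures the ambiguity of \<open>Q\<close>.\<close>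

definition rig_family :: "'v::finite set set \<Rightarrow> ('n::finite, 'v) framework \<Rightarrow>
    real ^ 'n ^ 'v ^ 'v \<Rightarrow> real ^ ('v \<times> 'v) ^ 'v" where
  "rig_family E p Q = (\<chi> u. rig E p (Q $ u))"

lemma linear_rig_family: "linear (rig_family E p)"
  by (rule linearI) (simp_all add: rig_family_def vec_eq_iff linear_add[OF linear_rig] linear_scale[OF linear_rig])

lemma linear_edge_prod: "linear (\<lambda>h. edge_prod E h g)"
  by (rule linearI) (auto simp: vec_eq_iff edge_prod_nth algebra_simps)

lemma linear_kernel_map: "linear (kernel_map E p)"
  by (rule linearI)
    (simp_all add: kernel_map_def vec_eq_iff linear_add[OF linear_rig] linear_scale[OF linear_rig]
      linear_add[OF linear_edge_prod] linear_scale[OF linear_edge_prod] algebra_simps)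

text \<open>All stresses annihilate \<open>h\<close> iff they are orthogonal to its product with
  every vertex indicator, that is, iff these products are values of \<open>rig E p\<close>;
  \<open>Q\<close> collects the preimages.\<close>

lemma stress_kernel_eq_image: "stress_kernel E p = fst ` {x. kernel_map E p x = 0}"
proof
  show "stress_kernel E p \<subseteq> fst ` {x. kernel_map E p x = 0}"
  proof
    fix h assume h: "h \<in> stress_kernel E p"
    have "\<exists>c. rig E p c = edge_prod E h (axis u 1)" for u
    proof -
      have "\<omega> \<bullet> edge_prod E h (axis u 1) = 0" if "stress E p \<omega>" for \<omega>
        using that h by (simp add: inner_edge_prod stress_def stress_kernel_def)
      from range_rig_eq_stress_orthogonal[OF edge_supported_edge_prod this] show ?thesis by blast
    qed
    then have "\<forall>u. \<exists>c. rig E p c = edge_prod E h (axis u 1)" by blast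
    from choice[OF this] obtain Q where "\<forall>u. rig E p (Q u) = edge_prod E h (axis u 1)" by blast
    then have "kernel_map E p (h, \<chi> u. Q u) = 0" by (simp add: kernel_map_def vec_eq_iff)
    then show "h \<in> fst ` {x. kernel_map E p x = 0}" by force
  qed
  show "fst ` {x. kernel_map E p x = 0} \<subseteq> stress_kernel E p"
  proof clarify
    fix h Q assume 0: "kernel_map E p (h, Q) = 0"
    have "stress_form \<omega> h g = 0" if \<omega>: "stress E p \<omega>" for \<omega> g
    proof -
      have "stress_form \<omega> h (axis u 1) = 0" for u
      proof -
        have "kernel_map E p (h, Q) $ u = 0" using 0 by simp
        then have "edge_prod E h (axis u 1) = rig E p (Q $ u)" by (simp add: kernel_map_def)
        then show ?thesis
          using stress_inner_rig[OF \<omega>, of "Q $ u"] \<omega> inner_edge_prod[of E \<omega> h "axis u 1"]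
          by (simp add: stress_def)
      qed
      then show ?thesis by (subst stress_form_eq) simp
    qed
    then show "fst (h, Q) \<in> stress_kernel E p" by (simp add: stress_kernel_def)
  qed
qed

lemma dim_stress_kernel:
  fixes p :: "('n::finite, 'v::finite) framework"
  shows "dim (stress_kernel E p) + dim {Q. rig_family E p Q = 0} = dim {x. kernel_map E p x = 0}"
proof -
  let ?S = "{x. kernel_map E p x = 0}"
  have S: "subspace ?S" by (intro linear_subspace_kernel linear_kernel_map)
  have e0: "edge_prod E 0 g = 0" for g :: "real ^ 'v" by (simp add: vec_eq_iff edge_prod_nth)
  have "?S \<inter> {x. fst x = 0} = Pair 0 ` {Q. rig_family E p Q = 0}"
  proof (rule set_eqI, rule iffI)
    fix x assume "x \<in> ?S \<inter> {x. fst x = 0}"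
    then have x: "x = (0, snd x)" "kernel_map E p x = 0" by (auto simp: prod_eq_iff)
    then have "kernel_map E p (0, snd x) = 0" by metis
    then have "rig_family E p (snd x) = 0"
      by (simp add: kernel_map_def rig_family_def e0 vec_eq_iff)
    with x(1) show "x \<in> Pair 0 ` {Q. rig_family E p Q = 0}" by blast
  qed (auto simp: kernel_map_def rig_family_def e0 vec_eq_iff)
  moreover have "dim (Pair (0::real ^ 'v) ` {Q. rig_family E p Q = 0}) = dim {Q. rig_family E p Q = 0}"
    by (rule dim_image_eq) (auto intro!: linearI inj_onI)
  moreover have "dim ?S = dim (fst ` ?S) + dim (?S \<inter> {x. fst x = 0})"
    by (rule dim_image_kernel[OF linear_fst S])
  ultimately show ?thesis by (simp add: stress_kernel_eq_image)
qed

lemma rat_poly_fun_edge_prod: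
  assumes "\<And>u. rat_poly_fun (\<lambda>z::'x::finite \<Rightarrow> real. h $ u)" "\<And>u. rat_poly_fun (\<lambda>z::'x \<Rightarrow> real. g $ u)"
  shows "rat_poly_fun (\<lambda>z::'x \<Rightarrow> real. edge_prod E h g $ e)"
proof (cases e)
  case (Pair u w)
  have "rat_poly_fun (\<lambda>z::'x \<Rightarrow> real. (h $ u - h $ w) * (g $ u - g $ w))"
    by (intro rat_poly_fun_intros assms)
  then show ?thesis
    by (cases "{u, w} \<in> E") (simp_all add: Pair edge_prod_nth rat_poly_fun_0)
qed

text \<open>The dimension is a difference of two nullities, each of them constant on generic
  frameworks because the rank there is maximal.\<close>

lemma stress_kernel_rank_eq:
  fixes \<rho> \<rho>\<^sub>0 :: "('n::finite, 'v::finite) framework"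
  assumes "generic_framework \<rho>" "generic_framework \<rho>\<^sub>0"
  shows "dim (stress_kernel E \<rho>) = dim (stress_kernel E \<rho>\<^sub>0)"
proof -
  have "dim (range (kernel_map E p)) \<le> dim (range (kernel_map E \<rho>))"
    if "generic_framework \<rho>" for p \<rho> :: "('n, 'v) framework"
  proof (rule generic_rank_le[OF that linear_kernel_map])
    fix a :: "(real ^ 'v) \<times> (real ^ 'n ^ 'v ^ 'v)" and b :: "real ^ ('v \<times> 'v) ^ 'v"
    assume a: "a \<in> Basis" and b: "b \<in> Basis"
    have a1: "fst a \<in> insert 0 Basis" "snd a \<in> insert 0 Basis"
      using a by (auto simp: Basis_prod_def)
    obtain u e where b: "b = axis u (axis e 1)" using b by (auto simp: Basis_vec_def)
    have "rat_poly_fun (\<lambda>z. edge_prod E (fst a) (axis u 1) $ e - rig E (fw_of z) (snd a $ u) $ e)"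
      by (intro rat_poly_fun_diff rat_poly_fun_edge_prod rat_poly_fun_rig rat_poly_fun_01 Basis_vec_nth0 a1)
        (simp add: axis_in_Basis_iff)
    then show "rat_poly_fun (\<lambda>z. kernel_map E (fw_of z) a \<bullet> b)"
      by (simp add: b inner_axis kernel_map_def)
  qed
  then have 1: "dim (range (kernel_map E \<rho>)) = dim (range (kernel_map E \<rho>\<^sub>0))"
    using assms by (intro antisym) auto
  have "dim (range (rig_family E p)) \<le> dim (range (rig_family E \<rho>))"
    if "generic_framework \<rho>" for p \<rho> :: "('n, 'v) framework"
  proof (rule generic_rank_le[OF that linear_rig_family])
    fix a :: "real ^ 'n ^ 'v ^ 'v" and b :: "real ^ ('v \<times> 'v) ^ 'v"
    assume a: "a \<in> Basis" and b: "b \<in> Basis"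
    obtain u e where b: "b = axis u (axis e 1)" using b by (auto simp: Basis_vec_def)
    have "rat_poly_fun (\<lambda>z. rig E (fw_of z) (a $ u) $ e)"
      by (intro rat_poly_fun_rig rat_poly_fun_01 Basis_vec_nth0) (use a in auto)
    then show "rat_poly_fun (\<lambda>z. rig_family E (fw_of z) a \<bullet> b)"
      by (simp add: b inner_axis rig_family_def)
  qed
  then have 2: "dim (range (rig_family E \<rho>)) = dim (range (rig_family E \<rho>\<^sub>0))"
    using assms by (intro antisym) auto
  from dim_stress_kernel[of E \<rho>] dim_stress_kernel[of E \<rho>\<^sub>0] show ?thesis
    by (simp add: dim_kernel_eq[OF linear_kernel_map] dim_kernel_eq[OF linear_rig_family] 1 2)
qed

lemma affine_kernel_rank_eq:
  fixes \<rho> \<rho>\<^sub>0 :: "('n::finite, 'v::finite) framework"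
  assumes "generic_framework \<rho>" "generic_framework \<rho>\<^sub>0"
  shows "dim (affine_kernel \<rho>) = dim (affine_kernel \<rho>\<^sub>0)"
proof -
  define L :: "('n, 'v) framework \<Rightarrow> real \<times> (real ^ 'n) \<Rightarrow> real ^ 'v"
    where "L p = (\<lambda>(a, x). \<chi> v. a + x \<bullet> p $ v)" for p
  have "dim (range (L p)) \<le> dim (range (L \<rho>))"
    if "generic_framework \<rho>" for p \<rho> :: "('n, 'v) framework"
  proof (rule generic_rank_le[OF that])
    show "linear (L p)" for p unfolding L_def by (rule linear_affine_fun)
    fix a :: "real \<times> (real ^ 'n)" and b :: "real ^ 'v"
    assume a: "a \<in> Basis" and b: "b \<in> Basis"
    have a1: "fst a \<in> insert 0 Basis" "snd a \<in> insert 0 Basis"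
      using a by (auto simp: Basis_prod_def)
    obtain v where b: "b = axis v 1" using b by (auto simp: Basis_vec_def)
    have "rat_poly_fun (\<lambda>z. fst a + (\<Sum>i\<in>UNIV. snd a $ i * z (v, i)))"
      by (intro rat_poly_fun_intros rat_poly_fun_01 Basis_vec_nth0 a1)
    then show "rat_poly_fun (\<lambda>z. L (fw_of z) a \<bullet> b)"
      unfolding b L_def by (simp add: inner_axis fw_of_def case_prod_beta) (simp add: inner_vec_def)
  qed
  then show ?thesis
    using assms unfolding affine_kernel_def L_def by (intro antisym) auto
qed

lemma affine_kernel_transfer:
  fixes \<rho> \<rho>\<^sub>0 :: "('n::finite, 'v::finite) framework"
  assumes "generic_framework \<rho>" "generic_framework \<rho>\<^sub>0" "stress_kernel E \<rho> = affine_kernel \<rho>"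
  shows "stress_kernel E \<rho>\<^sub>0 = affine_kernel \<rho>\<^sub>0"
proof -
  have "dim (stress_kernel E \<rho>\<^sub>0) = dim (affine_kernel \<rho>\<^sub>0)"
    using stress_kernel_rank_eq[OF assms(1,2), of E] affine_kernel_rank_eq[OF assms(1,2)] assms(3) by simp
  then have "affine_kernel \<rho>\<^sub>0 = stress_kernel E \<rho>\<^sub>0"
    by (intro subspace_dim_equal[OF subspace_affine_kernel subspace_stress_kernel affine_kernel_subset]) simp
  then show ?thesis by simp
qed


section \<open>Congruence, and frameworks with minimal stress kernel\<close>

text \<open>Householder reflection in the hyperplane orthogonal to \<open>a - b\<close>.\<close>

lemma orthogonal_transformation_swap:
  fixes a b :: "'a::euclidean_space"
  assumes "norm a = norm b"
  obtains R where "orthogonal_transformation R" "R a = b" "\<And>y. y \<bullet> (a - b) = 0 \<Longrightarrow> R y = y"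
proof (cases "a = b")
  case True
  then show ?thesis using that[of "\<lambda>x. x"] by simp
next
  case False
  define c where "c = a - b"
  have c: "c \<bullet> c \<noteq> 0" using False by (simp add: c_def)
  have aa: "a \<bullet> a = b \<bullet> b" using assms by (simp add: dot_square_norm)
  define R where "R x = x - (2 * (x \<bullet> c) / (c \<bullet> c)) *\<^sub>R c" for x
  show ?thesis
  proof (rule that)
    have "linear R"
      by (rule linearI) (simp_all add: R_def inner_add_left algebra_simps add_divide_distrib)
    moreover have "R x \<bullet> R y = x \<bullet> y" for x y
      using c by (simp add: R_def inner_diff_left inner_diff_right inner_commute field_simps)
    ultimately show "orthogonal_transformation R" by (simp add: orthogonal_transformation_def)
    have "2 * (a \<bullet> c) = c \<bullet> c"
      unfolding c_def using aa by (simp add: inner_diff_left inner_diff_right inner_commute)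
    then show "R a = b" using c by (simp add: R_def) (simp add: c_def)
    show "R y = y" if "y \<bullet> (a - b) = 0" for y using that by (simp add: R_def c_def)
  qed
qed

text \<open>The vectors are placed one after another: a reflection corrects the image of the new one
  and, as inner products agree, fixes those already placed.\<close>

lemma orthogonal_transformation_extend:
  fixes x y :: "'i \<Rightarrow> 'a::euclidean_space"
  assumes "finite S" "\<And>i j. i \<in> S \<Longrightarrow> j \<in> S \<Longrightarrow> x i \<bullet> x j = y i \<bullet> y j"
  shows "\<exists>T. orthogonal_transformation T \<and> (\<forall>i\<in>S. T (x i) = y i)"
  using assms
proof (induction S rule: finite_induct)
  case empty
  then show ?case by (intro exI[of _ "\<lambda>x. x"]) simp
next
  case (insert k S)
  then obtain T where T: "orthogonal_transformation T" "\<And>i. i \<in> S \<Longrightarrow> T (x i) = y i" by auto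
  have ip: "T u \<bullet> T v = u \<bullet> v" for u v using T(1) by (simp add: orthogonal_transformation_def)
  have "norm (T (x k)) = norm (y k)"
    using ip[of "x k" "x k"] insert.prems[of k k] by (simp add: norm_eq_sqrt_inner)
  then obtain R where R: "orthogonal_transformation R" "R (T (x k)) = y k"
      "\<And>z. z \<bullet> (T (x k) - y k) = 0 \<Longrightarrow> R z = z"
    using orthogonal_transformation_swap by blast
  have "R (y i) = y i" if "i \<in> S" for i
    using ip[of "x i" "x k"] insert.prems[of i k] T(2)[OF that] that by (intro R(3)) (simp add: inner_diff_right)
  then have "\<forall>i\<in>insert k S. (R \<circ> T) (x i) = y i" using R(2) T(2) by simp
  with orthogonal_transformation_compose[OF R(1) T(1)] show ?case by blast
qed

lemma rig_UNIV_self: "rig UNIV p p = rig UNIV q q \<longleftrightarrow> (\<forall>u w. dist (p $ u) (p $ w) = dist (q $ u) (q $ w))"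
  by (simp add: vec_eq_iff rig_nth dist_norm norm_eq_sqrt_inner)

lemma same_edge_lengths_rig: "same_edge_lengths E p q \<longleftrightarrow> rig E p p = rig E q q"
  by (auto simp: same_edge_lengths_def vec_eq_iff rig_nth dist_norm norm_eq_sqrt_inner)

text \<open>With one vertex as origin, the distances determine the Gram matrix, and equal Gram
  matrices are related by an orthogonal map.\<close>

lemma congruent_frameworks_rig: "congruent_frameworks p q \<longleftrightarrow> rig UNIV p p = rig UNIV q q"
proof
  assume "congruent_frameworks p q"
  then obtain T a where T: "orthogonal_transformation T" "\<And>v. q $ v = a + T (p $ v)"
    by (auto simp: congruent_frameworks_def)
  then have "q $ u - q $ w = T (p $ u - p $ w)" for u w
    by (simp add: linear_diff orthogonal_transformation_linear)
  then have "(q $ u - q $ w) \<bullet> (q $ u - q $ w) = (p $ u - p $ w) \<bullet> (p $ u - p $ w)" for u w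
    using T(1) by (simp only: orthogonal_transformation_def)
  then show "rig UNIV p p = rig UNIV q q" by (simp add: vec_eq_iff[where ?'b = "'b \<times> 'b"] rig_nth)
next
  assume eq: "rig UNIV p p = rig UNIV q q"
  fix z :: 'b
  have n: "norm (p $ u - p $ w) = norm (q $ u - q $ w)" for u w
    using eq by (simp add: rig_UNIV_self dist_norm)
  have "(p $ u - p $ z) \<bullet> (p $ w - p $ z) = (q $ u - q $ z) \<bullet> (q $ w - q $ z)" for u w
    using n[of u w] n[of u z] n[of w z]
    by (simp add: dot_norm_neg)
  then obtain T where T: "orthogonal_transformation T" "\<And>u. T (p $ u - p $ z) = q $ u - q $ z"
    using orthogonal_transformation_extend[of UNIV "\<lambda>u. p $ u - p $ z" "\<lambda>u. q $ u - q $ z"] by auto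
  have "q $ v = (q $ z - T (p $ z)) + T (p $ v)" for v
    using T(2)[of v] by (simp add: linear_diff orthogonal_transformation_linear[OF T(1)] algebra_simps)
  then show "congruent_frameworks p q"
    unfolding congruent_frameworks_def using T(1) by blast
qed

lemma affine_kernel_coords:
  fixes p q :: "('n::finite, 'v::finite) framework"
  assumes "\<And>i. coord i q \<in> affine_kernel p"
  obtains A a where "linear A" "\<And>v. q $ v = a + A (p $ v)"
proof -
  have "\<forall>i. \<exists>a x. coord i q = (\<chi> v. a + x \<bullet> p $ v)"
    using assms unfolding affine_kernel_def by fast
  then obtain a x where ax: "\<And>i. coord i q = (\<chi> v. a i + x i \<bullet> p $ v)" by metis
  define A where "A y = (\<chi> i. x i \<bullet> y)" for y
  have "linear A" by (rule linearI) (simp_all add: A_def vec_eq_iff inner_add_right)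
  moreover have "q $ v = (\<chi> i. a i) + A (p $ v)" for v
  proof -
    have "q $ v $ i = coord i q $ v" for i by (simp add: coord_nth)
    then show ?thesis by (simp add: vec_eq_iff A_def ax)
  qed
  ultimately show ?thesis using that by blast
qed

text \<open>Applying a derivation that moves \<open>\<rho>\<close> along \<open>c\<close> to the
  equality of edge lengths exhibits \<open>rig E \<rho> c\<close> as a value of the differential at
  \<open>\<sigma>\<close>.\<close>

lemma generic_range_rig:
  assumes \<rho>: "generic_framework \<rho>" and len: "rig E \<sigma> \<sigma> = rig E \<rho> \<rho>"
  shows "range (rig E \<rho>) \<subseteq> range (rig E \<sigma>)"
proof clarify
  fix c
  obtain D where D: "derivation D" "dfw D \<rho> = c" using generic_derivation[OF \<rho>] .
  have "2 *\<^sub>R rig E \<sigma> (dfw D \<sigma>) = 2 *\<^sub>R rig E \<rho> c"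
    using dvec_rig[OF D(1), of E \<rho>] dvec_rig[OF D(1), of E \<sigma>] len D(2) by simp
  then have "rig E \<rho> c = rig E \<sigma> (dfw D \<sigma>)" by simp
  then show "rig E \<rho> c \<in> range (rig E \<sigma>)" by simp
qed

lemma stress_iff_orthogonal:
  "stress E p \<omega> \<longleftrightarrow> edge_supported E \<omega> \<and> (\<forall>y\<in>range (rig E p). \<omega> \<bullet> y = 0)"
  using stressI[of E \<omega> p] stress_inner_rig[of E p \<omega>] by (auto simp: stress_def)

text \<open>Connelly's theorem: a framework with the same edge lengths has the same stresses, so it is an affine
  image of \<open>\<rho>\<close>.\<close>

lemma minimal_stress_kernel_globally_rigid:
  assumes \<rho>: "generic_framework \<rho>" and rigid: "rigid E \<rho>" and K: "stress_kernel E \<rho> = affine_kernel \<rho>"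
  shows "globally_rigid E \<rho>"
  unfolding globally_rigid_def
proof clarify
  fix \<sigma> assume "same_edge_lengths E \<sigma> \<rho>"
  then have len: "rig E \<sigma> \<sigma> = rig E \<rho> \<rho>" by (simp add: same_edge_lengths_rig)
  \<comment> \<open>The inclusion comes from derivations, equality from the maximal rank at
    \<open>\<rho>\<close>.\<close>
  have "range (rig E \<rho>) = range (rig E \<sigma>)"
    using generic_range_rig[OF \<rho> len] rig_rank_le[OF \<rho>, of E \<sigma>]
    by (intro subspace_dim_equal) (auto intro: linear_subspace_image linear_rig)
  then have "stress E \<rho> \<omega> \<longleftrightarrow> stress E \<sigma> \<omega>" for \<omega>
    unfolding stress_iff_orthogonal by simp
  then have "coord i \<sigma> \<in> stress_kernel E \<rho>" for i
    by (simp add: stress_kernel_def stress_def)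
  then obtain A a where A: "linear A" "\<And>v. \<sigma> $ v = a + A (\<rho> $ v)"
    using affine_kernel_coords K by metis
  \<comment> \<open>The displacement whose value under \<open>rig\<close> is the difference of the
    squared lengths of \<open>\<sigma>\<close> and \<open>\<rho>\<close>. It is a flex for
    \<open>E\<close>, so by rigidity the difference vanishes on all pairs.\<close>
  define c where "c = (\<chi> v. adjoint A (A (\<rho> $ v)) - \<rho> $ v)"
  have c: "rig F \<rho> c = rig F \<sigma> \<sigma> - rig F \<rho> \<rho>" for F
  proof -
    have "(\<rho> $ u - \<rho> $ w) \<bullet> (c $ u - c $ w) =
        (\<sigma> $ u - \<sigma> $ w) \<bullet> (\<sigma> $ u - \<sigma> $ w) - (\<rho> $ u - \<rho> $ w) \<bullet> (\<rho> $ u - \<rho> $ w)" for u w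
    proof -
      define x where "x = \<rho> $ u - \<rho> $ w"
      have "c $ u - c $ w = adjoint A (A x) - x"
        by (simp add: c_def x_def linear_diff[OF A(1)] linear_diff[OF adjoint_linear[OF A(1)]])
      moreover have "\<sigma> $ u - \<sigma> $ w = A x" by (simp add: A(2) x_def linear_diff[OF A(1)])
      ultimately show ?thesis
        by (simp add: x_def[symmetric] inner_diff_right adjoint_works[OF A(1)])
    qed
    then show ?thesis by (simp add: vec_eq_iff rig_nth)
  qed
  have "rig UNIV \<rho> c = 0" using rigid c[of E] len by (simp add: rigid_def)
  then show "congruent_frameworks \<rho> \<sigma>" using c[of UNIV] by (simp add: congruent_frameworks_rig)
qed

section \<open>Embedded paths and affine flexes\<close>

lemma rig_embed: "rig E (embed_framework p) (embed_framework p) = rig E p p"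
proof -
  have "(embed_framework p $ u - embed_framework p $ w) \<bullet> (embed_framework p $ u - embed_framework p $ w) =
      (p $ u - p $ w) \<bullet> (p $ u - p $ w)" for u w
    by (simp add: inner_vec_def embed_framework_def UNIV_option_conv sum.reindex)
  then show ?thesis by (simp add: vec_eq_iff rig_nth)
qed

lemma linear_embed_framework: "linear embed_framework"
  by (rule linearI) (auto simp: embed_framework_def vec_eq_iff split: option.split)

text \<open>The map from \<open>A\<close> to \<open>transpose A ** A\<close> is singular at the
  identity, where it loses the antisymmetric directions. Adding \<open>A - transpose A\<close> in
  \<open>G\<close> restores them: the differential at the identity becomes multiplication by 2, and
  for symmetric values the added part cancels on transposing.\<close>

lemma matrix_square_root_path:
  fixes C :: "real ^ 'n ^ 'n"
  assumes "transpose C = C"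
  obtains e A where "(e::real) > 0" "continuous_on {0..e} A" "A 0 = mat 1"
    "\<And>t. t \<in> {0..e} \<Longrightarrow> transpose (A t) ** A t = mat 1 + t *\<^sub>R C"
proof -
  define G where "G A = transpose A ** A + A - transpose A" for A :: "real ^ 'n ^ 'n"
  define G' where "G' A H = transpose A ** H + transpose H ** A + H - transpose H" for A H :: "real ^ 'n ^ 'n"
  have lt: "linear (transpose :: real ^ 'n ^ 'n \<Rightarrow> _)"
    by (rule linearI) (simp_all add: transpose_def vec_eq_iff)
  have "linear (\<lambda>B :: real ^ 'n ^ 'n. transpose A ** B)" "linear (\<lambda>A :: real ^ 'n ^ 'n. transpose A ** B)"
    for A B :: "real ^ 'n ^ 'n"
    by (rule linearI; simp add: matrix_matrix_mult_def transpose_def vec_eq_iff sum.distrib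
        sum_distrib_left algebra_simps)+
  then have bil: "bilinear (\<lambda>(A :: real ^ 'n ^ 'n) (B :: real ^ 'n ^ 'n). transpose A ** B)" by (simp add: bilinear_def)
  then have blin: "bounded_bilinear (\<lambda>(A :: real ^ 'n ^ 'n) (B :: real ^ 'n ^ 'n). transpose A ** B)"
    by (simp add: bilinear_conv_bounded_bilinear)
  have lG: "linear (G' A)" for A
    using bil lt unfolding G'_def bilinear_def
    by (auto intro!: linear_compose_add linear_compose_sub linear_ident)
  have cG: "continuous_on UNIV (\<lambda>A. G' A H)" for H
    using bil unfolding G'_def bilinear_def
    by (intro continuous_intros linear_continuous_on) (auto simp: linear_linear)
  have der: "(G has_derivative G' A) (at A)" for A
    unfolding G_def G'_def
    by (intro has_derivative_diff has_derivative_add bounded_bilinear.FDERIV[OF blin] has_derivative_ident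
        bounded_linear.has_derivative[OF linear_linear[THEN iffD2, OF lt]])
  define P where "P A = Blinfun (G' A)" for A
  have P: "blinfun_apply (P A) = G' A" for A
    unfolding P_def by (rule bounded_linear_Blinfun_apply) (simp add: linear_linear lG)
  have derP: "(G has_derivative blinfun_apply (P A)) (at A)" for A by (simp add: P der)
  have contP: "continuous_on UNIV P"
    by (rule continuous_on_blinfun_componentwise) (simp add: P cG)
  have "((1 / 2) *\<^sub>R id_blinfun) o\<^sub>L P (mat 1) = id_blinfun"
    by (rule blinfun_eqI) (simp add: P G'_def scaleR_blinfun.rep_eq transpose_mat scaleR_2[symmetric])
  from inverse_function_theorem[OF open_UNIV derP contP UNIV_I this]
  obtain U V g where U: "mat 1 \<in> U" and V: "open V" "G (mat 1) \<in> V" and hom: "homeomorphism U V G g"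
    by metis
  have G1: "G (mat 1) = mat 1" by (simp add: G_def transpose_mat)
  define l where "l t = mat 1 + t *\<^sub>R C" for t
  have lc: "continuous_on S l" for S unfolding l_def by (intro continuous_intros)
  have "open (l -` V)" by (intro open_vimage V(1) lc)
  moreover have "0 \<in> l -` V" using V(2) G1 by (simp add: l_def)
  ultimately obtain d where d: "d > 0" "ball 0 d \<subseteq> l -` V" using open_contains_ball by blast
  have lV: "l t \<in> V" if "t \<in> {0..d / 2}" for t
  proof -
    have "t \<in> ball 0 d" using that d(1) by (simp add: dist_real_def)
    then show ?thesis using d(2) by blast
  qed
  show ?thesis
  proof (rule that)
    show "d / 2 > 0" using d(1) by simp
    show "continuous_on {0..d / 2} (\<lambda>t. g (l t))"
      by (rule continuous_on_compose2[OF homeomorphism_cont2[OF hom] lc]) (use lV in blast)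
    have "g (G (mat 1)) = mat 1" by (rule homeomorphism_apply1[OF hom U])
    then show "g (l 0) = mat 1" by (simp add: G1 l_def)
    fix t assume t: "t \<in> {0..d / 2}"
    define X where "X = g (l t)"
    have GX: "transpose X ** X + X - transpose X = mat 1 + t *\<^sub>R C"
      using homeomorphism_apply2[OF hom lV[OF t]] by (simp add: G_def X_def l_def)
    then have "transpose (transpose X ** X + X - transpose X) = mat 1 + t *\<^sub>R C"
      by (simp add: linear_add[OF lt] linear_scale[OF lt] assms transpose_mat)
    then have "transpose X ** X + transpose X - X = mat 1 + t *\<^sub>R C"
      by (simp add: linear_add[OF lt] linear_diff[OF lt] matrix_transpose_mul)
    from arg_cong2[OF GX this, of "(+)"] have "2 *\<^sub>R (transpose X ** X) = 2 *\<^sub>R (mat 1 + t *\<^sub>R C)"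
      by (simp add: scaleR_2)
    then show "transpose (g (l t)) ** g (l t) = mat 1 + t *\<^sub>R C" by (simp only: X_def scaleR_cancel_left) simp
  qed
qed

lemma embedded_path:
  assumes "path \<gamma>" "pathstart \<gamma> = \<rho>" "pathfinish \<gamma> = \<sigma>"
    and "\<And>t. t \<in> {0..1} \<Longrightarrow> rig E (\<gamma> t) (\<gamma> t) = rig E \<rho> \<rho>"
  shows "connected_with_constant_lengths E (embed_framework \<rho>) (embed_framework \<sigma>)"
  unfolding connected_with_constant_lengths_def
proof (intro exI[of _ "embed_framework \<circ> \<gamma>"] conjI ballI)
  show "path (embed_framework \<circ> \<gamma>)"
    using assms(1) unfolding path_def
    by (rule continuous_on_compose) (intro linear_continuous_on, simp add: linear_linear linear_embed_framework)
qed (use assms in \<open>auto simp: pathstart_def pathfinish_def same_edge_lengths_rig rig_embed\<close>)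

text \<open>
  An infinitesimal flex that is an affine image of \<open>\<rho>\<close> makes the edge directions lie on a conic;
  deforming the metric along the conic is a genuine flex.
\<close>

lemma affine_flex:
  fixes \<rho> :: "('n::finite, 'v::finite) framework"
  assumes \<rho>: "generic_framework \<rho>" and nonrigid: "\<not> rigid E \<rho>" and K: "stress_kernel E \<rho> = affine_kernel \<rho>"
  shows "\<exists>\<sigma> :: ('n, 'v) framework. \<not> congruent_frameworks \<rho> \<sigma> \<and>
    connected_with_constant_lengths E (embed_framework \<rho>) (embed_framework \<sigma>)"
proof -
  obtain c where c: "rig E \<rho> c = 0" "rig UNIV \<rho> c \<noteq> 0" using nonrigid by (auto simp: rigid_def)
  \<comment> \<open>A flex is a preimage of the zero product, so its coordinates lie in the stress
    kernel.\<close>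
  have "edge_prod E 0 0 = 0" by (simp add: vec_eq_iff edge_prod_nth)
  then have "coord i c \<in> affine_kernel \<rho>" for i
    using rig_preimage_in_stress_kernel[OF \<rho>, of 0 E 0 c i] subspace_0[OF subspace_stress_kernel[of E \<rho>]] c K by simp
  then obtain B b where B: "linear B" "\<And>v. c $ v = b + B (\<rho> $ v)"
    using affine_kernel_coords by metis
  define M where "M = matrix B"
  have M: "M *v x = B x" for x using B(1) by (simp add: M_def matrix_works)
  \<comment> \<open>Only the symmetric part of \<open>B\<close> affects lengths; its quadratic form
    vanishes on the edge directions and is the conic.\<close>
  define C where "C = M + transpose M"
  have Cx: "x \<bullet> (C *v x) = 2 * (x \<bullet> B x)" for x
    by (simp add: C_def matrix_vector_mult_add_rdistrib inner_add_right M[symmetric] dot_lmul_matrix[symmetric]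
        transpose_matrix_vector inner_commute)
  have "transpose C = C"
    by (simp add: C_def transpose_def vec_eq_iff)
  then obtain e A where A: "(e::real) > 0" "continuous_on {0..e} A" "A 0 = mat 1"
    "\<And>t. t \<in> {0..e} \<Longrightarrow> transpose (A t) ** A t = mat 1 + t *\<^sub>R C"
    using matrix_square_root_path by metis
  have nA: "(A t *v x) \<bullet> (A t *v x) = x \<bullet> x + 2 * t * (x \<bullet> B x)" if "t \<in> {0..e}" for t x
  proof -
    have "(A t *v x) \<bullet> (A t *v x) = x \<bullet> ((transpose (A t) ** A t) *v x)"
      by (simp add: dot_lmul_matrix[symmetric] matrix_vector_mul_assoc[symmetric] inner_commute transpose_matrix_vector)
    also have "\<dots> = x \<bullet> x + t * (x \<bullet> (C *v x))"
      by (simp add: A(4)[OF that] matrix_vector_mult_add_rdistrib inner_add_right scaleR_matrix_vector_assoc[symmetric])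
    finally show ?thesis by (simp add: Cx)
  qed
  \<comment> \<open>Along this path squared lengths change linearly in \<open>t\<close>, at the rate
    given by \<open>c\<close>: not at all on \<open>E\<close>, but on some other pair.\<close>
  define \<gamma> where "\<gamma> t = (\<chi> v. A (e * t) *v \<rho> $ v)" for t
  have rig_\<gamma>: "rig F (\<gamma> t) (\<gamma> t) = rig F \<rho> \<rho> + (2 * (e * t)) *\<^sub>R rig F \<rho> c" if "t \<in> {0..1}" for F t
  proof -
    have "e * t \<in> {0..e}" using that A(1) by (auto simp: mult_left_le)
    then show ?thesis
      by (auto simp: vec_eq_iff rig_nth \<gamma>_def matrix_vector_mult_diff_distrib[symmetric] nA B(2) linear_diff[OF B(1)])
  qed
  have \<gamma>0: "\<gamma> 0 = \<rho>" by (simp add: \<gamma>_def A(3) vec_eq_iff)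
  have "path \<gamma>"
  proof -
    have "continuous_on {0..1} (\<lambda>t. A (e * t))"
      by (rule continuous_on_compose2[OF A(2)]) (use A(1) in \<open>auto intro!: continuous_intros simp: mult_left_le\<close>)
    then show ?thesis
      unfolding path_def \<gamma>_def matrix_vector_mult_def
      by (intro continuous_intros)
  qed
  moreover have "rig E (\<gamma> t) (\<gamma> t) = rig E \<rho> \<rho>" if "t \<in> {0..1}" for t
    using rig_\<gamma>[OF that, of E] c(1) by simp
  ultimately have "connected_with_constant_lengths E (embed_framework \<rho>) (embed_framework (\<gamma> 1))"
    using \<gamma>0 by (intro embedded_path[of \<gamma>]) (auto simp: pathstart_def pathfinish_def)
  moreover have "\<not> congruent_frameworks \<rho> (\<gamma> 1)"
    using rig_\<gamma>[of 1 UNIV] c(2) A(1) by (simp add: congruent_frameworks_rig)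
  ultimately show ?thesis by blast
qed

section \<open>Added edges, pivots and triangular position\<close>

lemma rigid_extension:
  fixes \<rho> :: "('n::finite, 'v::finite) framework"
  obtains F where "E \<subseteq> F" "rigid F \<rho>" "stress_kernel F \<rho> = stress_kernel E \<rho>"
proof -
  define P where "P F \<longleftrightarrow> E \<subseteq> F \<and> stress_kernel F \<rho> = stress_kernel E \<rho>" for F
  have "\<exists>F. P F \<and> (\<forall>F'. P F' \<longrightarrow> F \<subseteq> F' \<longrightarrow> F = F')"
  proof -
    have "finite {F. P F}" "{F. P F} \<noteq> {}" by (auto simp: P_def)
    from finite_has_maximal[OF this] show ?thesis by blast
  qed
  then obtain F where F: "P F" and max: "\<And>F'. P F' \<Longrightarrow> F \<subseteq> F' \<Longrightarrow> F = F'" by blast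
  have "rigid F \<rho>"
  proof (rule ccontr)
    assume "\<not> rigid F \<rho>"
    then obtain c where c: "rig F \<rho> c = 0" "rig UNIV \<rho> c \<noteq> 0" by (auto simp: rigid_def)
    then obtain u w where uw: "rig UNIV \<rho> c $ (u, w) \<noteq> 0" by (auto simp: vec_eq_iff)
    define r where "r = (\<rho> $ u - \<rho> $ w) \<bullet> (c $ u - c $ w)"
    have r: "r \<noteq> 0" using uw by (simp add: rig_nth r_def)
    then have "u \<noteq> w" by (auto simp: r_def)
    have "rig F \<rho> c $ (u, w) = 0" using c by simp
    then have "{u, w} \<notin> F" using r by (auto simp: rig_nth r_def split: if_splits)
    \<comment> \<open>The new edge is one whose length \<open>c\<close> changes to first order. On
      \<open>F'\<close> the displacement \<open>c\<close> changes no other edge, so every stress of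
      \<open>F'\<close> vanishes on the new edge and the stress kernel stays the same.\<close>
    define F' where "F' = insert {u, w} F"
    have rF': "rig F' \<rho> c = r *\<^sub>R (axis (u, w) 1 + axis (w, u) 1)"
    proof -
      have "rig F' \<rho> c $ (a, b) = (r *\<^sub>R (axis (u, w) 1 + axis (w, u) 1)) $ (a, b)" for a b
      proof (cases "{a, b} = {u, w}")
        case True
        then show ?thesis using \<open>u \<noteq> w\<close>
          by (auto simp: doubleton_eq_iff rig_nth F'_def axis_def r_def inner_diff_left inner_diff_right)
      next
        case False
        have "rig F' \<rho> c $ (a, b) = rig F \<rho> c $ (a, b)" using False by (simp add: rig_nth F'_def)
        moreover have "(a, b) \<noteq> (u, w)" "(a, b) \<noteq> (w, u)"
          using False by (metis insert_commute prod.inject)+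
        then have "axis (u, w) (1::real) $ (a, b) = 0" "axis (w, u) (1::real) $ (a, b) = 0"
          by (auto simp only: axis_def vec_lambda_beta split: if_splits)
        ultimately show ?thesis unfolding c(1) by simp
      qed
      then show ?thesis by (simp add: vec_eq_iff)
    qed
    have "stress F' \<rho> \<omega> \<longleftrightarrow> stress F \<rho> \<omega>" for \<omega>
    proof
      assume \<omega>: "stress F' \<rho> \<omega>"
      then have sym: "\<omega> $ (w, u) = \<omega> $ (u, w)" by (simp add: stress_def edge_supported_def)
      have "\<omega> \<bullet> rig F' \<rho> c = 0" by (rule stress_inner_rig[OF \<omega>])
      then have "\<omega> $ (u, w) = 0" "\<omega> $ (w, u) = 0"
        using r by (auto simp: rF' inner_add_right inner_axis sym)
      then show "stress F \<rho> \<omega>"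
        using \<omega> unfolding stress_def edge_supported_def F'_def
        by (metis doubleton_eq_iff insertE)
    next
      assume "stress F \<rho> \<omega>"
      then show "stress F' \<rho> \<omega>" by (auto simp: stress_def edge_supported_def F'_def)
    qed
    then have "stress_kernel F' \<rho> = stress_kernel F \<rho>" by (simp add: stress_kernel_def)
    then have "P F'" using F by (auto simp: P_def F'_def)
    then have "F = F'" using max by (auto simp: F'_def)
    then show False using \<open>{u, w} \<notin> F\<close> by (auto simp: F'_def)
  qed
  then show ?thesis using that F by (auto simp: P_def)
qed

text \<open>The residual of the system is orthogonal to its range, which makes its entries the
  coefficients of a linear relation among the \<open>r j\<close>.\<close>

lemma family_solve:
  fixes r :: "'v::finite \<Rightarrow> 'a::euclidean_space"
  assumes ind: "\<And>a. (\<Sum>j\<in>J. a j *\<^sub>R r j) = 0 \<Longrightarrow> \<forall>j\<in>J. a j = 0"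
  obtains x where "\<And>j. j \<in> J \<Longrightarrow> x \<bullet> r j = b j"
proof -
  define L :: "'a \<Rightarrow> real ^ 'v" where "L x = (\<chi> j. if j \<in> J then x \<bullet> r j else 0)" for x
  define B :: "real ^ 'v" where "B = (\<chi> j. if j \<in> J then b j else 0)"
  have L: "linear L" by (rule linearI) (auto simp: L_def vec_eq_iff inner_add_left)
  have sp: "span (range L) = range L" by (simp add: span_eq_iff L linear_subspace_image)
  obtain y z where yz: "y \<in> span (range L)" "\<And>w. w \<in> span (range L) \<Longrightarrow> orthogonal z w" "B = y + z"
    using orthogonal_subspace_decomp_exists[of "range L" B] by metis
  obtain x where x: "y = L x" using yz(1) sp by auto
  have z: "z = B - L x" using yz(3) x by simp
  have "z $ j = 0" if "j \<notin> J" for j using that by (simp add: z B_def L_def)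
  then have "z \<bullet> L x' = x' \<bullet> (\<Sum>j\<in>J. z $ j *\<^sub>R r j)" for x'
    unfolding inner_sum_right inner_vec_def L_def
    by (intro sum.mono_neutral_cong_right) auto
  moreover have "z \<bullet> L x' = 0" for x' using yz(2)[of "L x'"] sp by (auto simp: orthogonal_def)
  ultimately have "(\<Sum>j\<in>J. z $ j *\<^sub>R r j) = 0" by (metis inner_eq_zero_iff)
  then have "\<forall>j\<in>J. z $ j = 0" by (rule ind)
  then have "x \<bullet> r j = b j" if "j \<in> J" for j using that z by (auto simp: B_def L_def vec_eq_iff)
  with that show ?thesis by blast
qed

lemma generic_points_independent:
  fixes \<rho> :: "('n::finite, 'v::finite) framework"
  assumes \<rho>: "generic_framework \<rho>" and J: "card J \<le> CARD('n)" "z \<notin> J"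
    and 0: "(\<Sum>j\<in>J. a j *\<^sub>R (\<rho> $ j - \<rho> $ z)) = 0"
  shows "\<forall>j\<in>J. a j = 0"
proof -
  obtain f :: "'v \<Rightarrow> 'n" where f: "inj_on f J"
    using card_le_inj[of J "UNIV :: 'n set"] J(1) by auto
  \<comment> \<open>The position to compare with: the vertices in \<open>J\<close> at distinct unit
    vectors, \<open>z\<close> at the origin.\<close>
  define q :: "'v \<times> 'n \<Rightarrow> real" where "q = (\<lambda>(v, i). if v \<in> J \<and> i = f v then 1 else 0)"
  define v where "v j x = fw_of x $ j - (fw_of x :: ('n, 'v) framework) $ z" for j x
  have vq: "v j q = axis (f j) 1" if "j \<in> J" for j
    using that J(2) by (auto simp: v_def fw_of_def q_def vec_eq_iff axis_def)
  show ?thesis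
  proof (rule alg_indep_linear_indep[of "\<lambda>(v, i). \<rho> $ v $ i" J v q])
    show "alg_indep (\<lambda>(v, i). \<rho> $ v $ i)" using \<rho> by (simp add: generic_alg_indep)
    show "rat_poly_fun (\<lambda>x. v j x \<bullet> b)" if b: "b \<in> Basis" for j b
    proof -
      obtain i where "b = axis i 1" using b by (auto simp: Basis_vec_def)
      then show ?thesis
        by (auto simp: v_def inner_axis fw_of_def intro: rat_poly_fun_intros)
    qed
    show "\<forall>j\<in>J. c j = 0" if c: "(\<Sum>j\<in>J. c j *\<^sub>R v j q) = 0" for c
    proof
      fix k assume k: "k \<in> J"
      have "0 = (\<Sum>j\<in>J. c j *\<^sub>R v j q) $ f k" using c by simp
      also have "\<dots> = (\<Sum>j\<in>J. if j = k then c k else 0)"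
        unfolding sum_component by (intro sum.cong refl) (use f k in \<open>auto simp: vq axis_def inj_on_def\<close>)
      finally show "c k = 0" using k by simp
    qed
    show "(\<Sum>j\<in>J. a j *\<^sub>R v j (\<lambda>(v, i). \<rho> $ v $ i)) = 0"
      using 0 by (simp add: v_def fw_of_coords)
  qed simp
qed

text \<open>\<open>P\<close> is a minimal set of coordinates that determines the elements of
  \<open>S\<close>; minimality supplies for each pivot an element vanishing at all the
  others.\<close>

lemma subspace_pivots:
  fixes S :: "(real ^ 'v) set"
  assumes S: "subspace S"
  obtains P \<kappa> where "\<And>h. h \<in> S \<Longrightarrow> (\<And>i. i \<in> P \<Longrightarrow> h $ i = 0) \<Longrightarrow> h = 0"
    "\<And>j. j \<in> P \<Longrightarrow> \<kappa> j \<in> S" "\<And>i j. i \<in> P \<Longrightarrow> j \<in> P \<Longrightarrow> \<kappa> j $ i = (if i = j then 1 else 0)"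
proof -
  define Q where "Q P \<longleftrightarrow> (\<forall>h\<in>S. (\<forall>i\<in>P. h $ i = 0) \<longrightarrow> h = 0)" for P
  have "finite {P. Q P}" "{P. Q P} \<noteq> {}"
    by (auto simp: Q_def vec_eq_iff)
  from finite_has_minimal[OF this] obtain P where P: "Q P" and min: "\<And>P'. Q P' \<Longrightarrow> P' \<subseteq> P \<Longrightarrow> P = P'"
    by blast
  have "\<exists>k\<in>S. \<forall>i\<in>P. k $ i = (if i = j then 1 else 0)" if j: "j \<in> P" for j
  proof -
    have "\<not> Q (P - {j})" using min[of "P - {j}"] j by blast
    then obtain h where h: "h \<in> S" "\<forall>i\<in>P - {j}. h $ i = 0" "h \<noteq> 0" by (auto simp: Q_def)
    then have "h $ j \<noteq> 0" using P by (auto simp: Q_def)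
    then show ?thesis
      using h S by (intro bexI[of _ "(1 / h $ j) *\<^sub>R h"]) (auto simp: subspace_scale)
  qed
  then obtain \<kappa> where "\<forall>j\<in>P. \<kappa> j \<in> S \<and> (\<forall>i\<in>P. \<kappa> j $ i = (if i = j then 1 else 0))" by metis
  then show ?thesis using that[of P \<kappa>] P by (auto simp: Q_def)
qed

text \<open>QR factorisation by reflections, in the order given by \<open>ord\<close>, whose values
  may have gaps.\<close>

lemma orthogonal_triangularization:
  fixes x :: "'n::finite \<Rightarrow> real ^ 'n" and ord :: "'n \<Rightarrow> nat"
  assumes ord: "inj ord"
  obtains T :: "real ^ 'n \<Rightarrow> real ^ 'n" where "orthogonal_transformation T" "\<And>i j. ord j < ord i \<Longrightarrow> T (x j) $ i = 0"
proof -
  have "\<exists>T :: real ^ 'n \<Rightarrow> real ^ 'n. orthogonal_transformation T \<and> (\<forall>i j. ord j < m \<longrightarrow> ord j < ord i \<longrightarrow> T (x j) $ i = 0)" for m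
  proof (induction m)
    case 0
    show ?case by (intro exI[of _ "\<lambda>x::real ^ 'n. x"]) simp
  next
    case (Suc m)
    then obtain T :: "real ^ 'n \<Rightarrow> real ^ 'n" where T: "orthogonal_transformation T"
        "\<And>i j. ord j < m \<Longrightarrow> ord j < ord i \<Longrightarrow> T (x j) $ i = 0" by blast
    show ?case
    proof (cases "\<exists>k. ord k = m")
      case False
      then have "ord j < m" if "ord j < Suc m" for j using that less_Suc_eq by blast
      with T show ?thesis by blast
    next
      case True
      then obtain k where k: "ord k = m" by blast
      define z where "z = T (x k)"
      \<comment> \<open>\<open>b\<close> keeps the first entries of \<open>z\<close> and gathers the
        norm of the rest in entry \<open>k\<close>. The reflection taking \<open>z\<close> to
        \<open>b\<close> fixes the earlier vectors, which live in the first entries only.\<close>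
      define r where "r = sqrt (\<Sum>i | m \<le> ord i. (z $ i)\<^sup>2)"
      define b :: "real ^ 'n" where "b = (\<chi> i. if ord i < m then z $ i else if i = k then r else 0)"
      have split: "(\<Sum>i\<in>UNIV. f i) = (\<Sum>i | ord i < m. f i) + (\<Sum>i | m \<le> ord i. f i)" for f :: "'n \<Rightarrow> real"
        by (subst sum.union_disjoint[symmetric]) (auto intro: sum.cong)
      have "(\<Sum>i | m \<le> ord i. (b $ i)\<^sup>2) = (\<Sum>i | m \<le> ord i. if i = k then r\<^sup>2 else 0)"
        by (intro sum.cong refl) (auto simp: b_def)
      also have "\<dots> = r\<^sup>2" using k by simp
      also have "\<dots> = (\<Sum>i | m \<le> ord i. (z $ i)\<^sup>2)" unfolding r_def by (simp add: sum_nonneg)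
      finally have "(\<Sum>i\<in>UNIV. (b $ i)\<^sup>2) = (\<Sum>i\<in>UNIV. (z $ i)\<^sup>2)"
        unfolding split by (simp add: b_def)
      then have "norm z = norm b" by (simp add: norm_vec_def L2_set_def)
      then obtain R where R: "orthogonal_transformation R" "R z = b" "\<And>y. y \<bullet> (z - b) = 0 \<Longrightarrow> R y = y"
        using orthogonal_transformation_swap by blast
      have "R (T (x j)) = T (x j)" if j: "ord j < m" for j
      proof (rule R(3))
        have "T (x j) $ i * (z - b) $ i = 0" for i
          using T(2)[OF j, of i] j by (cases "ord i < m") (auto simp: b_def)
        then show "T (x j) \<bullet> (z - b) = 0"
          unfolding inner_vec_def by (intro sum.neutral) simp
      qed
      then have "(R \<circ> T) (x j) $ i = 0" if "ord j < Suc m" "ord j < ord i" for i j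
      proof (cases "ord j = m")
        case True
        then have "j = k" using k ord by (auto dest: injD)
        then show ?thesis using R(2) that(2) k by (auto simp: z_def[symmetric] b_def)
      qed (use that T(2) in auto)
      with orthogonal_transformation_compose[OF R(1) T(1)] show ?thesis by blast
    qed
  qed
  from this[of "Suc (Max (range ord))"] obtain T :: "real ^ 'n \<Rightarrow> real ^ 'n" where "orthogonal_transformation T"
    "\<And>i j. ord j < Suc (Max (range ord)) \<Longrightarrow> ord j < ord i \<Longrightarrow> T (x j) $ i = 0" by blast
  then show ?thesis using that[of T] by (simp add: less_Suc_eq_le)
qed


section \<open>Frameworks with large stress kernel\<close>

text \<open>
  \<open>P\<close> is a set of pivots for the subspace of the stress kernel of functions vanishing at \<open>z\<close>, with
  dual basis \<open>\<kappa>\<close>.  The rotation \<open>T\<close> puts the framework in triangular position with respect to the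
  vertices \<open>s j\<close>, the coordinates being ordered by \<open>ord\<close>.
\<close>

locale triangular_frame =
  fixes E :: "'v::finite set set" and \<rho> :: "('n::finite, 'v) framework"
    and z :: 'v and P :: "'v set" and \<kappa> :: "'v \<Rightarrow> real ^ 'v" and s :: "'n \<Rightarrow> 'v" and ord :: "'n \<Rightarrow> nat"
    and T :: "real ^ 'n \<Rightarrow> real ^ 'n"
  assumes generic: "generic_framework \<rho>" and rigid: "rigid E \<rho>"
    and pivot_zero: "\<And>h. h \<in> stress_kernel E \<rho> \<Longrightarrow> h $ z = 0 \<Longrightarrow> (\<And>i. i \<in> P \<Longrightarrow> h $ i = 0) \<Longrightarrow> h = 0"
    and kappa_kernel: "\<And>j. j \<in> P \<Longrightarrow> \<kappa> j \<in> stress_kernel E \<rho>"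
    and kappa_z: "\<And>j. j \<in> P \<Longrightarrow> \<kappa> j $ z = 0"
    and kappa: "\<And>i j. i \<in> P \<Longrightarrow> j \<in> P \<Longrightarrow> \<kappa> j $ i = (if i = j then 1 else 0)"
    and card_P: "CARD('n) < card P"
    and inj_s: "inj s" and s_P: "s j \<in> P"
    and inj_ord: "inj ord"
    and T: "orthogonal_transformation T"
    and T_triangular: "\<And>i j. ord j < ord i \<Longrightarrow> T (\<rho> $ s j - \<rho> $ z) $ i = 0"
begin

abbreviation K where "K \<equiv> stress_kernel E \<rho>"

text \<open>A linear slice for the isometries: pinning \<open>z\<close> removes translations, and
  the triangular zeros remove infinitesimal rotations.\<close>

definition G :: "('n, 'v) framework set" where
  "G = {q. (\<forall>i. coord i q \<in> K) \<and> q $ z = 0 \<and> (\<forall>i j. ord j < ord i \<longrightarrow> q $ s j $ i = 0)}"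

definition \<tau> :: "('n, 'v) framework" where
  "\<tau> = (\<chi> v. T (\<rho> $ v - \<rho> $ z))"

lemma linear_T: "linear T" and T_inner: "T x \<bullet> T y = x \<bullet> y"
  using T by (simp_all add: orthogonal_transformation_def)

lemma adjoint_T: "adjoint T (T x) = x"
proof -
  have "adjoint T (T x) \<bullet> y = x \<bullet> y" for y
    by (simp add: adjoint_clauses(2)[OF linear_T] T_inner)
  then show ?thesis by (meson vector_eq_rdot)
qed

lemma coord_add: "coord i (p + q) = coord i p + coord i q"
  and coord_scale: "coord i (a *\<^sub>R p) = a *\<^sub>R coord i p"
  by (simp_all add: vec_eq_iff coord_nth)

lemma z_notin_P: "z \<notin> P"
  using kappa_z[of z] kappa[of z z] by auto

lemma subspace_G: "subspace G"
  unfolding subspace_def G_def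
  using subspace_stress_kernel[of E \<rho>]
  by (auto simp: coord_add coord_scale subspace_add subspace_scale)
    (simp add: coord_def zero_vec_def[symmetric] subspace_0)

lemma coord_linear_image_in_K:
  assumes A: "linear A" and q: "\<And>i. coord i q \<in> K"
  shows "coord i (\<chi> v. A (q $ v)) \<in> K"
proof -
  have "coord i (\<chi> v. A (q $ v)) = (\<Sum>j\<in>UNIV. matrix A $ i $ j *\<^sub>R coord j q)"
  proof -
    have "matrix A *v x = A x" for x using A by (simp add: matrix_works)
    then have "A (q $ v) $ i = (matrix A *v (q $ v)) $ i" for v by simp
    then have "A (q $ v) $ i = (\<Sum>j\<in>UNIV. matrix A $ i $ j *\<^sub>R coord j q) $ v" for v
      by (simp add: matrix_vector_mult_def coord_nth)
    then show ?thesis unfolding vec_eq_iff coord_nth vec_lambda_beta by blast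
  qed
  then show ?thesis
    using q subspace_stress_kernel[of E \<rho>] by (simp add: subspace_sum subspace_scale)
qed

lemma tau_in_G: "\<tau> \<in> G"
proof -
  have "coord i (\<chi> v. \<rho> $ v - \<rho> $ z) \<in> K" for i
  proof -
    have "coord i (\<chi> v. \<rho> $ v - \<rho> $ z) = coord i \<rho> - (\<chi> v. \<rho> $ z $ i)"
      by (simp add: vec_eq_iff coord_nth)
    then show ?thesis
      using subspace_diff[OF subspace_stress_kernel coord_in_stress_kernel const_in_stress_kernel] by simp
  qed
  then have "coord i \<tau> \<in> K" for i
    unfolding \<tau>_def using coord_linear_image_in_K[OF linear_T, of "\<chi> v. \<rho> $ v - \<rho> $ z"] by simp
  then show ?thesis
    by (auto simp: G_def) (simp_all add: \<tau>_def linear_0[OF linear_T] T_triangular)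
qed

lemma rig_tau: "rig F \<tau> \<tau> = rig F \<rho> \<rho>"
proof -
  have "\<tau> $ u - \<tau> $ w = T (\<rho> $ u - \<rho> $ w)" for u w
    by (simp add: \<tau>_def linear_diff[OF linear_T, symmetric])
  then have "(\<tau> $ u - \<tau> $ w) \<bullet> (\<tau> $ u - \<tau> $ w) = (\<rho> $ u - \<rho> $ w) \<bullet> (\<rho> $ u - \<rho> $ w)" for u w
    by (simp only: T_inner)
  then show ?thesis unfolding rig_def by (simp only:)
qed

lemma dfw_in_G:
  assumes D: "derivation D" "\<And>i. coord i (dfw D \<rho>) \<in> K" and q: "q \<in> G"
  shows "dfw D q \<in> G"
  using q dvec_stress_kernel[OF D]
  by (auto simp: G_def coord_dfw derivation_0[OF D(1)] vec_eq_iff)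

text \<open>The entries at \<open>z\<close> and at the pivots are 0 or 1, which derivations kill,
  and they determine an element of \<open>K\<close>.\<close>

lemma kappa_const:
  assumes D: "derivation D" "\<And>i. coord i (dfw D \<rho>) \<in> K" and j: "j \<in> P"
  shows "dvec D (\<kappa> j) = 0"
proof (rule pivot_zero)
  show "dvec D (\<kappa> j) \<in> K" by (rule dvec_stress_kernel[OF D kappa_kernel[OF j]])
qed (use j in \<open>auto simp: kappa_z kappa derivation_0[OF D(1)] derivation_1[OF D(1)]\<close>)

lemma kernel_derivation:
  assumes "\<And>i. coord i c \<in> K"
  obtains D where "derivation D" "dfw D \<rho> = c" "\<And>i. coord i (dfw D \<rho>) \<in> K"
  using generic_derivation[OF generic, of c] assms by metis

definition W :: "(real ^ ('v \<times> 'v)) set" where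
  "W = rig E \<rho> ` {c. \<forall>i. coord i c \<in> K}"

lemma subspace_W: "subspace W"
  unfolding W_def
proof (rule linear_subspace_image[OF linear_rig])
  show "subspace {c. \<forall>i. coord i c \<in> K}"
    using subspace_stress_kernel[of E \<rho>]
    by (auto simp: subspace_def coord_add coord_scale) (simp add: coord_def zero_vec_def[symmetric] subspace_0)
qed

lemma edge_prod_in_W:
  assumes "h \<in> K" "g \<in> K"
  shows "edge_prod E h g \<in> W"
proof -
  obtain c where "rig E \<rho> c = edge_prod E h g" "\<And>i. coord i c \<in> K"
    using edge_prod_in_range_rig[OF generic assms] by blast
  then show ?thesis unfolding W_def by force
qed

lemma rig_in_W: "q \<in> G \<Longrightarrow> c \<in> G \<Longrightarrow> rig E q c \<in> W"
  unfolding rig_eq_sum_edge_prod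
  by (intro subspace_sum[OF subspace_W] edge_prod_in_W) (simp_all add: G_def)

text \<open>A derivation moving \<open>\<rho>\<close> along \<open>c\<close> moves
  \<open>\<tau>\<close> within the slice \<open>G\<close> and has the same effect on the edge
  lengths, so displacements in \<open>K\<close> can be traded for displacements in
  \<open>G\<close>.\<close>

lemma W_eq: "W = rig E \<tau> ` G"
proof
  show "rig E \<tau> ` G \<subseteq> W" using rig_in_W tau_in_G by blast
  show "W \<subseteq> rig E \<tau> ` G"
  proof
    fix y assume "y \<in> W"
    then obtain c where c: "y = rig E \<rho> c" "\<And>i. coord i c \<in> K" by (auto simp: W_def)
    obtain D where D: "derivation D" "dfw D \<rho> = c" "\<And>i. coord i (dfw D \<rho>) \<in> K"
      using kernel_derivation[OF c(2)] by blast
    have "2 *\<^sub>R rig E \<tau> (dfw D \<tau>) = 2 *\<^sub>R rig E \<rho> c"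
      using dvec_rig[OF D(1), of E \<tau>] dvec_rig[OF D(1), of E \<rho>] rig_tau[of E] D(2) by simp
    then show "y \<in> rig E \<tau> ` G" using dfw_in_G[OF D(1,3) tau_in_G] c(1) by force
  qed
qed

lemma ord_cases:
  obtains "ord k < ord i" | "k = i" | "ord i < ord k"
  using inj_ord by (metis injD linorder_neqE_nat)

lemma tau_vertices_independent:
  assumes "(\<Sum>j\<in>UNIV. a j *\<^sub>R \<tau> $ s j) = 0"
  shows "a j = 0"
proof -
  have "(\<Sum>j\<in>UNIV. a j *\<^sub>R \<tau> $ s j) = T (\<Sum>j\<in>UNIV. a j *\<^sub>R (\<rho> $ s j - \<rho> $ z))"
    by (simp add: \<tau>_def linear_sum[OF linear_T] linear_scale[OF linear_T])
  then have "adjoint T (T (\<Sum>j\<in>UNIV. a j *\<^sub>R (\<rho> $ s j - \<rho> $ z))) = 0"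
    using assms by (simp add: linear_0 adjoint_linear[OF linear_T])
  then have "(\<Sum>j\<in>UNIV. a j *\<^sub>R (\<rho> $ s j - \<rho> $ z)) = 0" by (simp add: adjoint_T)
  then have "(\<Sum>v\<in>range s. a (inv s v) *\<^sub>R (\<rho> $ v - \<rho> $ z)) = 0"
    using inj_s by (simp add: sum.reindex)
  then have "\<forall>v\<in>range s. a (inv s v) = 0"
    by (rule generic_points_independent[OF generic, rotated 2])
      (use s_P z_notin_P in \<open>auto intro: card_image_le\<close>)
  then show ?thesis using inj_s by simp
qed

lemma axis_in_span:
  assumes "\<And>k. ord k \<le> m \<Longrightarrow> \<tau> $ s k $ k \<noteq> 0" "ord i \<le> m"
  shows "axis i 1 \<in> span {\<tau> $ s j |j. ord j \<le> ord i}"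
  using assms(2)
proof (induction "ord i" arbitrary: i rule: less_induct)
  case less
  let ?S = "span {\<tau> $ s j |j. ord j \<le> ord i}"
  have "axis l 1 \<in> ?S" if "ord l < ord i" for l
  proof -
    have "span {\<tau> $ s j |j. ord j \<le> ord l} \<subseteq> ?S" using that by (intro span_mono) auto
    then show ?thesis using less that by auto
  qed
  then have "(\<Sum>l | ord l < ord i. \<tau> $ s i $ l *\<^sub>R axis l 1) \<in> ?S"
    by (intro span_sum span_scale) simp
  moreover have "\<tau> $ s i \<in> ?S" by (intro span_base) blast
  ultimately have "\<tau> $ s i - (\<Sum>l | ord l < ord i. \<tau> $ s i $ l *\<^sub>R axis l 1) \<in> ?S"
    by (rule span_diff[rotated])
  moreover have "\<tau> $ s i - (\<Sum>l | ord l < ord i. \<tau> $ s i $ l *\<^sub>R axis l 1) = \<tau> $ s i $ i *\<^sub>R axis i 1"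
  proof -
    have "(\<tau> $ s i - (\<Sum>l | ord l < ord i. \<tau> $ s i $ l *\<^sub>R axis l 1)) $ k = (\<tau> $ s i $ i *\<^sub>R axis i 1) $ k" for k
    proof -
      have "(\<Sum>l | ord l < ord i. \<tau> $ s i $ l * axis l 1 $ k) = (\<Sum>l | ord l < ord i. if l = k then \<tau> $ s i $ k else 0)"
        by (intro sum.cong refl) (auto simp: axis_def)
      also have "\<dots> = (if ord k < ord i then \<tau> $ s i $ k else 0)" by simp
      finally have eq: "(\<tau> $ s i - (\<Sum>l | ord l < ord i. \<tau> $ s i $ l *\<^sub>R axis l 1)) $ k =
          \<tau> $ s i $ k - (if ord k < ord i then \<tau> $ s i $ k else 0)" by simp
      show ?thesis
        unfolding eq using tau_in_G by (cases rule: ord_cases[of k i]) (auto simp: G_def axis_def)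
    qed
    then show ?thesis by (simp add: vec_eq_iff)
  qed
  ultimately have "\<tau> $ s i $ i *\<^sub>R axis i 1 \<in> ?S" by simp
  from span_scale[OF this, of "1 / \<tau> $ s i $ i"] show ?case using assms(1)[OF less.prems] by simp
qed

text \<open>With a zero on the diagonal the vertex would lie in the span of the earlier axes, hence
  of the earlier vertices, against their independence.\<close>

lemma tau_diagonal: "\<tau> $ s k $ k \<noteq> 0"
proof (induction "ord k" arbitrary: k rule: less_induct)
  case less
  show ?case
  proof
    assume 0: "\<tau> $ s k $ k = 0"
    have fi: "inj (\<lambda>j. \<tau> $ s j)" "independent (range (\<lambda>j. \<tau> $ s j))"
      using family_independent[of UNIV "\<lambda>j. \<tau> $ s j"] tau_vertices_independent by auto
    have ax: "axis i 1 \<in> span {\<tau> $ s j |j. ord j < ord k}" if "ord i < ord k" for i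
    proof -
      have "axis i 1 \<in> span {\<tau> $ s j |j. ord j \<le> ord i}"
        by (rule axis_in_span[of "ord i"]) (use less that in auto)
      moreover have "span {\<tau> $ s j |j. ord j \<le> ord i} \<subseteq> span {\<tau> $ s j |j. ord j < ord k}"
        using that by (intro span_mono) auto
      ultimately show ?thesis by auto
    qed
    have "\<tau> $ s k = (\<Sum>i\<in>UNIV. \<tau> $ s k $ i *\<^sub>R axis i 1)"
      by (simp add: vec_eq_iff axis_def if_distrib cong: if_cong)
    also have "\<dots> \<in> span {\<tau> $ s j |j. ord j < ord k}"
    proof (intro span_sum)
      fix i
      show "\<tau> $ s k $ i *\<^sub>R axis i 1 \<in> span {\<tau> $ s j |j. ord j < ord k}"
        using 0 ax tau_in_G by (cases rule: ord_cases[of i k]) (auto simp: G_def span_scale span_0)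
    qed
    finally have "\<tau> $ s k \<in> span {\<tau> $ s j |j. ord j < ord k}" .
    moreover have "{\<tau> $ s j |j. ord j < ord k} \<subseteq> range (\<lambda>j. \<tau> $ s j) - {\<tau> $ s k}"
      using fi(1) by (auto dest: injD)
    ultimately have "\<tau> $ s k \<in> span (range (\<lambda>j. \<tau> $ s j) - {\<tau> $ s k})"
      using span_mono by blast
    then show False using fi(2) by (auto simp: dependent_def)
  qed
qed

lemma tau_inner:
  assumes "\<And>k. ord k < ord i \<Longrightarrow> x $ k = 0"
  shows "\<tau> $ s i \<bullet> x = \<tau> $ s i $ i * x $ i"
proof -
  have "\<tau> $ s i $ k * x $ k = (if k = i then \<tau> $ s i $ i * x $ i else 0)" for k
    using assms tau_in_G by (cases rule: ord_cases[of k i]) (auto simp: G_def)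
  then have "\<tau> $ s i \<bullet> x = (\<Sum>k\<in>UNIV. if k = i then \<tau> $ s i $ i * x $ i else 0)"
    unfolding inner_vec_def inner_real_def by (intro sum.cong refl)
  then show ?thesis by simp
qed

text \<open>By rigidity \<open>c\<close> preserves all distances to first order. As \<open>z\<close>
  is pinned, the pairing of \<open>\<tau>\<close> with \<open>c\<close> is skew in the vertices; the
  triangular shape then kills \<open>c\<close> at the vertices \<open>s j\<close> in turn, and so
  everywhere.\<close>

lemma rig_tau_inj:
  assumes c: "c \<in> G" and 0: "rig E \<tau> c = 0"
  shows "c = 0"
proof -
  define c' where "c' = (\<chi> v. adjoint T (c $ v))"
  have "(\<rho> $ u - \<rho> $ w) \<bullet> (c' $ u - c' $ w) = (\<tau> $ u - \<tau> $ w) \<bullet> (c $ u - c $ w)" for u w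
  proof -
    have "c' $ u - c' $ w = adjoint T (c $ u - c $ w)"
      by (simp add: c'_def linear_diff[OF adjoint_linear[OF linear_T]])
    moreover have "\<tau> $ u - \<tau> $ w = T (\<rho> $ u - \<rho> $ w)"
      by (simp add: \<tau>_def linear_diff[OF linear_T, symmetric])
    ultimately show ?thesis by (simp only: adjoint_works[OF linear_T])
  qed
  then have "rig F \<rho> c' = rig F \<tau> c" for F unfolding rig_def by (simp only:)
  then have all0: "rig UNIV \<tau> c = 0" using rigid 0 by (metis rigid_def)
  have pair: "(\<tau> $ u - \<tau> $ w) \<bullet> (c $ u - c $ w) = 0" for u w
    using arg_cong[OF all0, of "\<lambda>y. y $ (u, w)"] by (simp add: rig_nth)
  have z0: "\<tau> $ z = 0" "c $ z = 0" using tau_in_G c by (simp_all add: G_def)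
  have diag: "\<tau> $ u \<bullet> c $ u = 0" for u using pair[of u z] z0 by simp
  have cross: "\<tau> $ u \<bullet> c $ w = - (\<tau> $ w \<bullet> c $ u)" for u w
    using pair[of u w] diag[of u] diag[of w] by (simp add: inner_diff_left inner_diff_right)
  have orth0: "x = 0" if "\<And>k. \<tau> $ s k \<bullet> x = 0" for x
  proof -
    have "x $ i = 0" for i
    proof (induction "ord i" arbitrary: i rule: less_induct)
      case less
      then have "\<tau> $ s i \<bullet> x = \<tau> $ s i $ i * x $ i" by (intro tau_inner) blast
      then show ?case using that[of i] tau_diagonal[of i] by simp
    qed
    then show ?thesis by (simp add: vec_eq_iff)
  qed
  have cs: "c $ s j = 0" for j
  proof (induction "ord j" arbitrary: j rule: less_induct)
    case less
    show ?case
    proof (rule orth0)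
      fix k
      show "\<tau> $ s k \<bullet> c $ s j = 0"
      proof (cases rule: ord_cases[of k j])
        case 1
        then show ?thesis using less cross[of "s k" "s j"] by simp
      next
        case 2
        then show ?thesis using diag by simp
      next
        case 3
        \<comment> \<open>Coordinates beyond \<open>j\<close> vanish as \<open>c\<close> is
          triangular; the others follow in order, by skewness against vertices already
          treated.\<close>
        have "c $ s j $ i = 0" for i
        proof (induction "ord i" arbitrary: i rule: less_induct)
          case (less i)
          show ?case
          proof (cases "ord j < ord i")
            case True
            then show ?thesis using c by (simp add: G_def)
          next
            case False
            have "\<tau> $ s i \<bullet> c $ s j = \<tau> $ s i $ i * c $ s j $ i" by (rule tau_inner) (rule less)
            moreover have "\<tau> $ s i \<bullet> c $ s j = 0"
            proof (cases "i = j")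
              case True
              then show ?thesis using diag by simp
            next
              case False
              then have "ord i < ord j" using \<open>\<not> ord j < ord i\<close> inj_ord by (metis injD linorder_neqE_nat)
              then show ?thesis using \<open>\<And>ja. ord ja < ord j \<Longrightarrow> c $ s ja = 0\<close> cross[of "s i" "s j"] by simp
            qed
            ultimately show ?thesis using tau_diagonal[of i] by simp
          qed
        qed
        then have "c $ s j = 0" by (simp add: vec_eq_iff)
        then show ?thesis by simp
      qed
    qed
  qed
  have "c $ u = 0" for u
    by (rule orth0) (simp add: cross[of "s _" u] cs)
  then show "c = 0" by (simp add: vec_eq_iff)
qed

end

section \<open>The equations of the curve\<close>

context triangular_frame
begin

text \<open>Any \<open>\<kappa> j\<close> would serve: what matters is that it is killed by every
  derivation that moves \<open>\<rho>\<close> within \<open>K\<close>.\<close>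

definition w :: "real ^ 'v" where
  "w = \<kappa> (SOME j. j \<in> P)"

lemma w_pivot: "\<exists>j\<in>P. w = \<kappa> j"
  unfolding w_def using s_P by (metis someI)

lemma w_kernel: "w \<in> K"
  using w_pivot kappa_kernel by auto

definition lw :: "real ^ ('v \<times> 'v)" where
  "lw = edge_prod E w w"

lemma lw_in_W: "lw \<in> W"
  unfolding lw_def by (intro edge_prod_in_W w_kernel)

lemma lw_nonneg: "lw $ e \<ge> 0"
  by (simp add: lw_def edge_prod_def)

lemma generic_coords_distinct:
  assumes "u \<noteq> v"
  shows "\<rho> $ u $ i \<noteq> \<rho> $ v $ i"
proof
  assume eq: "\<rho> $ u $ i = \<rho> $ v $ i"
  let ?f = "\<lambda>x :: 'v \<times> 'n \<Rightarrow> real. x (u, i) - x (v, i)"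
  have "rat_poly_fun ?f" by (intro rat_poly_fun_intros)
  from alg_indep_zero[OF generic[unfolded generic_alg_indep] this, of "\<lambda>p. if p = (u, i) then 1 else 0"]
  show False using assms eq by simp
qed

text \<open>Otherwise moving each vertex along one axis by its value of \<open>w\<close> is a flex,
  hence trivial. Generic vertices have distinct coordinates, so \<open>w\<close> would be constant,
  yet it takes the values 0 and 1.\<close>

lemma lw_nonzero: "lw \<noteq> 0"
proof
  assume lw: "lw = 0"
  fix i :: 'n
  define c where "c = (\<chi> v. axis i (w $ v))"
  have c: "(\<rho> $ u - \<rho> $ v) \<bullet> (c $ u - c $ v) = (\<rho> $ u $ i - \<rho> $ v $ i) * (w $ u - w $ v)" for u v
  proof -
    have "c $ u - c $ v = axis i (w $ u - w $ v)" by (simp add: c_def axis_def vec_eq_iff)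
    then show ?thesis by (simp add: inner_axis)
  qed
  have "w $ u = w $ v" if "{u, v} \<in> E" for u v
    using arg_cong[OF lw, of "\<lambda>y. y $ (u, v)"] that by (simp add: lw_def edge_prod_nth)
  then have "rig E \<rho> c = 0" by (auto simp: vec_eq_iff rig_nth c)
  then have "rig UNIV \<rho> c = 0" using rigid by (simp add: rigid_def)
  then have "rig UNIV \<rho> c $ (u, z) = 0" for u by simp
  then have "(\<rho> $ u $ i - \<rho> $ z $ i) * (w $ u - w $ z) = 0" for u
    unfolding rig_nth c by (simp only: UNIV_I if_True)
  then have "w $ u = w $ z" for u using generic_coords_distinct[of u z i] by (cases "u = z") auto
  moreover obtain j where "j \<in> P" "w = \<kappa> j" using w_pivot by blast
  ultimately show False using kappa[of j j] kappa_z[of j] by (metis zero_neq_one)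
qed

text \<open>A left inverse of the differential on \<open>G\<close>. Together with the projection
  \<open>pr\<close> it turns equations between the subspaces \<open>G\<close> and \<open>W\<close>
  into one map on all frameworks, the form required by \<open>regular_curve_arc\<close>.\<close>

definition J :: "real ^ ('v \<times> 'v) \<Rightarrow> ('n, 'v) framework" where
  "J = (SOME J. range J \<subseteq> G \<and> linear J \<and> (\<forall>c\<in>G. J (rig E \<tau> c) = c))"

definition pr :: "('n, 'v) framework \<Rightarrow> ('n, 'v) framework" where
  "pr = (SOME f. range f \<subseteq> G \<and> linear f \<and> (\<forall>c\<in>G. f c = c))"

lemma J: "J y \<in> G" "linear J" "c \<in> G \<Longrightarrow> J (rig E \<tau> c) = c"
proof -
  have "inj_on (rig E \<tau>) G"
  proof (rule inj_onI)
    fix a b assume "a \<in> G" "b \<in> G" "rig E \<tau> a = rig E \<tau> b"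
    then have "a - b = 0"
      by (intro rig_tau_inj) (simp_all add: subspace_diff[OF subspace_G] linear_diff[OF linear_rig])
    then show "a = b" by simp
  qed
  from linear_exists_left_inverse_on[OF linear_rig subspace_G this]
  have "range J \<subseteq> G \<and> linear J \<and> (\<forall>c\<in>G. J (rig E \<tau> c) = c)"
    unfolding J_def by (rule someI_ex)
  then show "J y \<in> G" "linear J" "c \<in> G \<Longrightarrow> J (rig E \<tau> c) = c" by auto
qed

lemma pr: "pr x \<in> G" "linear pr" "c \<in> G \<Longrightarrow> pr c = c"
proof -
  from linear_exists_left_inverse_on[OF linear_id subspace_G, folded id_def]
  have "\<exists>f. range f \<subseteq> G \<and> linear f \<and> (\<forall>c\<in>G. f c = c)" by (auto simp: id_def)
  then have "range pr \<subseteq> G \<and> linear pr \<and> (\<forall>c\<in>G. pr c = c)"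
    unfolding pr_def by (rule someI_ex)
  then show "pr x \<in> G" "linear pr" "c \<in> G \<Longrightarrow> pr c = c" by auto
qed

text \<open>The first summand lies in \<open>G\<close> and carries the length equations; the second
  is killed by \<open>pr\<close> and forces the framework into \<open>G\<close>.\<close>

definition F :: "('n, 'v) framework \<times> real \<Rightarrow> ('n, 'v) framework" where
  "F y = J (rig E (pr (fst y)) (pr (fst y)) + (snd y)\<^sup>2 *\<^sub>R lw - rig E \<tau> \<tau>) + (fst y - pr (fst y))"

definition F' :: "('n, 'v) framework \<times> real \<Rightarrow> ('n, 'v) framework \<times> real \<Rightarrow> ('n, 'v) framework" where
  "F' y x = J (2 *\<^sub>R rig E (pr (fst y)) (pr (fst x)) + (2 * snd y * snd x) *\<^sub>R lw) + (fst x - pr (fst x))"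

text \<open>\<open>pr\<close> separates the two summands, and \<open>J\<close> is injective on
  \<open>W\<close>, which contains the argument of \<open>J\<close>.\<close>

lemma F_zero_iff: "F (x, t) = 0 \<longleftrightarrow> x \<in> G \<and> rig E x x + t\<^sup>2 *\<^sub>R lw = rig E \<tau> \<tau>"
proof
  assume 0: "F (x, t) = 0"
  define y where "y = rig E (pr x) (pr x) + t\<^sup>2 *\<^sub>R lw - rig E \<tau> \<tau>"
  have "y \<in> W"
    unfolding y_def
    by (intro subspace_diff subspace_add subspace_scale subspace_W rig_in_W lw_in_W pr tau_in_G)
  then obtain c where c: "c \<in> G" "y = rig E \<tau> c" unfolding W_eq by blast
  have "pr (F (x, t)) = J y"
    by (simp add: F_def y_def linear_add[OF pr(2)] linear_diff[OF pr(2)] pr(3) J(1) pr(1))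
  then have "J y = 0" using 0 by (simp add: linear_0[OF pr(2)])
  then have "y = 0" using c J(3) by (simp add: linear_0[OF linear_rig])
  then have "x = pr x" using 0 by (simp add: F_def y_def[symmetric] linear_0[OF J(2)])
  then show "x \<in> G \<and> rig E x x + t\<^sup>2 *\<^sub>R lw = rig E \<tau> \<tau>"
    using \<open>y = 0\<close> pr(1) unfolding y_def by (metis eq_iff_diff_eq_0)
next
  assume "x \<in> G \<and> rig E x x + t\<^sup>2 *\<^sub>R lw = rig E \<tau> \<tau>"
  then show "F (x, t) = 0" by (simp add: F_def pr(3) linear_0[OF J(2)])
qed

lemma bounded_bilinear_rig: "bounded_bilinear (rig E :: ('n, 'v) framework \<Rightarrow> _)"
  using bilinear_rig by (simp add: bilinear_conv_bounded_bilinear)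

lemma F_derivative: "(F has_derivative F' y) (at y)"
proof -
  have blJ: "bounded_linear J" and blpr: "bounded_linear pr"
    using J(2) pr(2) by (simp_all add: linear_linear)
  have p: "((\<lambda>y. pr (fst y)) has_derivative (\<lambda>x. pr (fst x))) (at y)"
    by (intro bounded_linear.has_derivative[OF blpr] has_derivative_fst has_derivative_ident)
  have q: "((\<lambda>y. rig E (pr (fst y)) (pr (fst y))) has_derivative
      (\<lambda>x. rig E (pr (fst y)) (pr (fst x)) + rig E (pr (fst x)) (pr (fst y)))) (at y)"
    by (rule bounded_bilinear.FDERIV[OF bounded_bilinear_rig p p])
  have t: "((\<lambda>y :: ('n, 'v) framework \<times> real. (snd y)\<^sup>2 *\<^sub>R lw) has_derivative (\<lambda>x. (2 * snd y * snd x) *\<^sub>R lw)) (at y)"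
    by (auto intro!: derivative_eq_intros simp: power2_eq_square)
  have "(F has_derivative (\<lambda>x. J (rig E (pr (fst y)) (pr (fst x)) + rig E (pr (fst x)) (pr (fst y))
      + (2 * snd y * snd x) *\<^sub>R lw - 0) + (fst x - pr (fst x)))) (at y)"
    unfolding F_def[abs_def]
    by (intro has_derivative_add has_derivative_diff bounded_linear.has_derivative[OF blJ] p q t
        has_derivative_const has_derivative_fst has_derivative_ident)
  moreover have "rig E (pr (fst y)) (pr (fst x)) + rig E (pr (fst x)) (pr (fst y)) =
      2 *\<^sub>R rig E (pr (fst y)) (pr (fst x))" for x :: "('n, 'v) framework \<times> real"
    unfolding rig_commute[of E "pr (fst x)"] scaleR_2 ..
  ultimately show ?thesis by (simp add: F'_def[abs_def])
qed

lemma F'_continuous: "continuous_on UNIV (\<lambda>y. F' y x)"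
proof -
  have "bounded_linear (\<lambda>p. rig E p (pr (fst x)))"
    by (rule bounded_bilinear.bounded_linear_left[OF bounded_bilinear_rig])
  then show ?thesis
    unfolding F'_def
    by (intro continuous_intros bounded_linear.continuous_on[of J]
        bounded_linear.continuous_on[of "\<lambda>p. rig E p (pr (fst x))"] bounded_linear.continuous_on[of pr])
      (simp_all add: linear_linear J(2) pr(2))
qed

text \<open>
  \<open>\<rho>\<close> being generic, \<open>rig E \<rho> \<rho>\<close> is a regular value: a derivation sends a solution of the equations
  to a preimage under the differential at that solution.
\<close>

lemma F'_surj:
  assumes 0: "F y = 0"
  shows "surj (F' y)"
proof (rule surjI)
  obtain x t where y: "y = (x, t)" by (cases y)
  have x: "x \<in> G" and eq: "rig E x x + t\<^sup>2 *\<^sub>R lw = rig E \<tau> \<tau>"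
    using 0 by (auto simp: y F_zero_iff)
  have ex: "\<exists>c. F' y c = a" for a
  proof -
    have "rig E \<tau> (pr a) \<in> W" by (intro rig_in_W tau_in_G pr(1))
    then obtain b where b: "rig E \<tau> (pr a) = rig E \<rho> b" "\<And>i. coord i b \<in> K" by (auto simp: W_def)
    obtain D where D: "derivation D" "dfw D \<rho> = b" "\<And>i. coord i (dfw D \<rho>) \<in> K"
      using kernel_derivation[OF b(2)] by blast
    \<comment> \<open>As \<open>w\<close> is constant for \<open>D\<close>, only \<open>t\<close> is
      differentiated in the height term.\<close>
    have Dw: "D (w $ v) = 0" for v
    proof -
      have "dvec D w = 0" using w_pivot kappa_const[OF D(1,3)] by auto
      then show ?thesis by (metis dvec_nth zero_index)
    qed
    have "D (t\<^sup>2 * lw $ e) = 2 * t * D t * lw $ e" for e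
    proof -
      have "D (lw $ e) = 0"
        by (simp add: lw_def edge_prod_def derivation_mult[OF D(1)] derivation_diff[OF D(1)]
            derivation_0[OF D(1)] Dw)
      then show ?thesis by (simp add: derivation_mult[OF D(1)] power2_eq_square algebra_simps)
    qed
    then have "dvec D (rig E x x + t\<^sup>2 *\<^sub>R lw) = 2 *\<^sub>R rig E x (dfw D x) + (2 * t * D t) *\<^sub>R lw"
      unfolding dvec_rig[OF D(1), symmetric] by (simp add: vec_eq_iff derivation_add[OF D(1)])
    moreover have "dvec D (rig E \<tau> \<tau>) = 2 *\<^sub>R rig E \<tau> (pr a)"
      by (simp add: rig_tau dvec_rig[OF D(1)] D(2) b(1))
    ultimately have key: "2 *\<^sub>R rig E x (dfw D x) + (2 * t * D t) *\<^sub>R lw = 2 *\<^sub>R rig E \<tau> (pr a)"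
      using eq by simp
    have Dx: "dfw D x \<in> G" by (rule dfw_in_G[OF D(1,3) x])
    \<comment> \<open>Halving turns the derived equation \<open>key\<close> into a value of
      \<open>F'\<close>; the part of \<open>a\<close> outside \<open>G\<close> is passed on
      unchanged.\<close>
    define c where "c = (1 / 2) *\<^sub>R dfw D x + (a - pr a)"
    have pc: "pr c = (1 / 2) *\<^sub>R dfw D x"
      by (simp add: c_def linear_add[OF pr(2)] linear_diff[OF pr(2)] pr(3) pr(1) Dx subspace_scale[OF subspace_G])
    have "2 *\<^sub>R rig E x ((1 / 2) *\<^sub>R dfw D x) + (2 * t * (D t / 2)) *\<^sub>R lw
        = (1 / 2) *\<^sub>R (2 *\<^sub>R rig E x (dfw D x) + (2 * t * D t) *\<^sub>R lw)"
      by (simp add: linear_scale[OF linear_rig] scaleR_add_right)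
    also have "\<dots> = rig E \<tau> (pr a)" unfolding key by simp
    finally have "F' y (c, D t / 2) = J (rig E \<tau> (pr a)) + (c - pr c)"
      by (simp add: F'_def y pc pr(3)[OF x])
    also have "\<dots> = a" by (simp add: J(3) pr(1) pc) (simp add: c_def)
    finally show ?thesis by blast
  qed
  show "F' y (SOME c. F' y c = a) = a" for a by (rule someI_ex[OF ex])
qed

text \<open>\<open>t\<close> enters only through its square.\<close>

lemma F'_flat: "F' (x, 0) (0, 1) = 0"
  by (simp add: F'_def linear_0[OF J(2)] linear_0[OF pr(2)] linear_0[OF linear_rig])

definition C :: "(('n, 'v) framework \<times> real) set" where
  "C = {y. F y = 0 \<and> 0 \<le> snd y}"

lemma C_iff: "(x, t) \<in> C \<longleftrightarrow> x \<in> G \<and> rig E x x + t\<^sup>2 *\<^sub>R lw = rig E \<tau> \<tau> \<and> 0 \<le> t"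
  by (auto simp: C_def F_zero_iff)

text \<open>Both terms of the length equation are nonnegative, so each is bounded by the lengths of
  \<open>\<tau>\<close>. By rigidity the edge vectors determine a framework in \<open>G\<close> and
  hence bound it; \<open>t\<close> is bounded since \<open>lw\<close> has a positive entry.\<close>

lemma compact_C: "compact C"
proof -
  have "continuous_on UNIV F"
    by (intro continuous_at_imp_continuous_on ballI has_derivative_continuous[OF F_derivative])
  then have "closed C"
    unfolding C_def Collect_conj_eq
    by (intro closed_Int closed_Collect_eq closed_Collect_le continuous_intros) auto
  define \<Delta> :: "('n, 'v) framework \<Rightarrow> real ^ 'n ^ ('v \<times> 'v)" where
    "\<Delta> x = (\<chi> e. if {fst e, snd e} \<in> E then x $ fst e - x $ snd e else 0)" for x
  have lin: "linear \<Delta>" by (rule linearI) (auto simp: \<Delta>_def vec_eq_iff algebra_simps)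
  have "\<forall>x\<in>G. \<Delta> x = 0 \<longrightarrow> x = 0"
  proof clarify
    fix x assume x: "x \<in> G" "\<Delta> x = 0"
    have "x $ u = x $ v" if "{u, v} \<in> E" for u v
      using arg_cong[OF x(2), of "\<lambda>y. y $ (u, v)"] that by (simp add: \<Delta>_def)
    then have "rig E \<tau> x $ (u, v) = 0" for u v by (simp add: rig_nth)
    then have "rig E \<tau> x = 0" by (simp add: vec_eq_iff)
    then show "x = 0" by (rule rig_tau_inj[OF x(1)])
  qed
  then obtain e where e: "e > 0" "\<And>x. x \<in> G \<Longrightarrow> norm (\<Delta> x) \<ge> e * norm x"
    using injective_imp_isometric[OF closed_subspace[OF subspace_G] subspace_G, of \<Delta>] lin
    by (auto simp: linear_linear)
  obtain k where k: "lw $ k > 0"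
    using lw_nonzero lw_nonneg by (metis order_le_less vec_eq_iff zero_index)
  define M where "M = (\<Sum>e\<in>UNIV. rig E \<tau> \<tau> $ e)"
  \<comment> \<open>A crude estimate that keeps square roots out of the bounds.\<close>
  have sq: "a \<le> (1 + a)\<^sup>2" if "a \<ge> 0" for a :: real
    using that by (simp add: power2_eq_square algebra_simps add_increasing)
  have bound: "norm x \<le> (1 + M) / e \<and> \<bar>t\<bar> \<le> 1 + M / lw $ k" if xt: "(x, t) \<in> C" for x t
  proof
    have x: "x \<in> G" and eq: "rig E x x + t\<^sup>2 *\<^sub>R lw = rig E \<tau> \<tau>" using xt by (auto simp: C_iff)
    have nn: "rig E x x $ e \<ge> 0" for e by (simp add: rig_def)
    have nn': "rig E \<tau> \<tau> $ e \<ge> 0" for e by (simp add: rig_def)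
    have le: "rig E x x $ e \<le> rig E \<tau> \<tau> $ e" "t\<^sup>2 * lw $ e \<le> rig E \<tau> \<tau> $ e" for e
    proof -
      have "rig E x x $ e + t\<^sup>2 * lw $ e = rig E \<tau> \<tau> $ e"
        using arg_cong[OF eq, of "\<lambda>y. y $ e"] by simp
      moreover have "0 \<le> t\<^sup>2 * lw $ e" using lw_nonneg by simp
      ultimately show "rig E x x $ e \<le> rig E \<tau> \<tau> $ e" "t\<^sup>2 * lw $ e \<le> rig E \<tau> \<tau> $ e"
        using nn[of e] by linarith+
    qed
    have "(norm (\<Delta> x))\<^sup>2 = (\<Sum>e\<in>UNIV. rig E x x $ e)"
      unfolding power2_norm_eq_inner inner_vec_def[of "\<Delta> x"]
      by (intro sum.cong refl) (simp add: \<Delta>_def rig_def)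
    also have "\<dots> \<le> M" unfolding M_def by (intro sum_mono le)
    finally have dM: "(norm (\<Delta> x))\<^sup>2 \<le> M" .
    have "M \<ge> 0" unfolding M_def by (intro sum_nonneg nn')
    have "norm (\<Delta> x) \<le> 1 + M"
    proof (rule power2_le_imp_le)
      show "(norm (\<Delta> x))\<^sup>2 \<le> (1 + M)\<^sup>2"
        using dM sq[OF \<open>M \<ge> 0\<close>] by linarith
    qed (use \<open>M \<ge> 0\<close> in simp)
    then show "norm x \<le> (1 + M) / e" using e(2)[OF x] e(1) by (simp add: field_simps)
    have "t\<^sup>2 * lw $ k \<le> M"
      using le(2)[of k] member_le_sum[of k UNIV "\<lambda>e. rig E \<tau> \<tau> $ e"] nn' unfolding M_def by force
    then have "t\<^sup>2 \<le> M / lw $ k" using k by (simp add: field_simps)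
    also have "\<dots> \<le> (1 + M / lw $ k)\<^sup>2"
      by (rule sq) (use k \<open>M \<ge> 0\<close> in simp)
    finally have "\<bar>t\<bar>\<^sup>2 \<le> (1 + M / lw $ k)\<^sup>2" by simp
    then show "\<bar>t\<bar> \<le> 1 + M / lw $ k"
      by (rule power2_le_imp_le) (use k \<open>M \<ge> 0\<close> in simp)
  qed
  have "C \<subseteq> cball 0 ((1 + M) / e) \<times> cball 0 (1 + M / lw $ k)"
    using bound by auto
  then have "bounded C" by (rule bounded_subset[rotated]) (intro bounded_Times bounded_cball)
  with \<open>closed C\<close> show ?thesis by (simp add: compact_eq_bounded_closed)
qed

end

section \<open>The far end of the arc\<close>

context triangular_frame
begin

text \<open>An isometry taking \<open>\<tau>\<close> into \<open>G\<close> fixes the origin and, as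
  the diagonal of \<open>\<tau>\<close> is nonzero, is itself triangular. Being orthogonal, it is
  then diagonal with entries 1 and -1, not all of them 1.\<close>

lemma congruent_in_G:
  assumes \<sigma>: "\<sigma> \<in> G" and cong: "rig UNIV \<tau> \<tau> = rig UNIV \<sigma> \<sigma>" and ne: "\<sigma> \<noteq> \<tau>"
  obtains U \<epsilon> i where "orthogonal_transformation U" "\<And>v. \<sigma> $ v = U (\<tau> $ v)"
    "\<And>x k. U x $ k = \<epsilon> k * x $ k" "\<epsilon> (i :: 'n) = (-1 :: real)"
proof -
  obtain U a where U: "orthogonal_transformation U" and a: "\<And>v. \<sigma> $ v = a + U (\<tau> $ v)"
    using cong congruent_frameworks_rig[of \<tau> \<sigma>] by (auto simp: congruent_frameworks_def)
  have lin: "linear U" and ip: "U x \<bullet> U y = x \<bullet> y" for x y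
    using U by (simp_all add: orthogonal_transformation_def)
  have "a = 0" using a[of z] \<sigma> tau_in_G by (simp add: G_def linear_0[OF lin])
  then have \<sigma>U: "\<sigma> $ v = U (\<tau> $ v)" for v using a by simp
  define \<epsilon> where "\<epsilon> k = U (axis k 1) $ k" for k
  have diag: "U (axis i 1) = \<epsilon> i *\<^sub>R axis i 1 \<and> (\<epsilon> i)\<^sup>2 = 1" for i
  proof (induction "ord i" arbitrary: i rule: less_induct)
    case less
    have "U (axis i 1) $ k = 0" if "k \<noteq> i" for k
    proof (cases "ord i < ord k")
      case True
      define S where "S = {x. U x $ k = 0}"
      have "subspace S" by (auto simp: S_def subspace_def linear_add[OF lin] linear_scale[OF lin] linear_0[OF lin])
      moreover have "{\<tau> $ s j |j. ord j \<le> ord i} \<subseteq> S"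
        using \<sigma> True by (auto simp: S_def G_def \<sigma>U[symmetric])
      ultimately have "span {\<tau> $ s j |j. ord j \<le> ord i} \<subseteq> S" by (intro span_minimal)
      moreover have "axis i 1 \<in> span {\<tau> $ s j |j. ord j \<le> ord i}"
        by (rule axis_in_span[of "ord i"]) (simp_all add: tau_diagonal)
      ultimately show ?thesis by (auto simp: S_def)
    next
      case False
      then have "ord k < ord i" using that inj_ord by (metis injD linorder_neqE_nat)
      then have k: "U (axis k 1) = \<epsilon> k *\<^sub>R axis k 1" "(\<epsilon> k)\<^sup>2 = 1" using less by auto
      have "U (axis k 1) \<bullet> U (axis i 1) = 0" using that by (simp add: ip inner_axis_axis)
      then have "\<epsilon> k * U (axis i 1) $ k = 0" by (simp add: k(1) inner_axis')
      then show ?thesis using k(2) by auto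
    qed
    then have "U (axis i 1) = \<epsilon> i *\<^sub>R axis i 1" by (simp add: vec_eq_iff \<epsilon>_def axis_def)
    moreover have "U (axis i 1) \<bullet> U (axis i 1) = 1" by (simp add: ip inner_axis_axis)
    ultimately show ?case by (simp add: inner_axis_axis power2_eq_square)
  qed
  have Ux: "U x $ k = \<epsilon> k * x $ k" for x k
  proof -
    have "x = (\<Sum>i\<in>UNIV. x $ i *\<^sub>R axis i 1)"
      by (simp add: vec_eq_iff axis_def if_distrib cong: if_cong)
    then have "U x = U (\<Sum>i\<in>UNIV. x $ i *\<^sub>R axis i 1)" by simp
    also have "\<dots> = (\<Sum>i\<in>UNIV. x $ i *\<^sub>R (\<epsilon> i *\<^sub>R axis i 1))"
      using diag by (simp add: linear_sum[OF lin] linear_scale[OF lin])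
    finally show ?thesis by (simp add: axis_def if_distrib cong: if_cong)
  qed
  have "\<exists>i. \<epsilon> i \<noteq> 1"
  proof (rule ccontr)
    assume "\<not> (\<exists>i. \<epsilon> i \<noteq> 1)"
    then have "\<sigma> = \<tau>" by (simp add: vec_eq_iff \<sigma>U Ux)
    with ne show False by simp
  qed
  then obtain i where "\<epsilon> i \<noteq> 1" by blast
  moreover have "\<epsilon> i = 1 \<or> \<epsilon> i = -1" using diag[of i] by (simp add: power2_eq_1_iff)
  ultimately have "\<epsilon> i = -1" by simp
  with U \<sigma>U Ux that show ?thesis by blast
qed

text \<open>
  A framework with a vanishing coordinate could be moved along two independent directions.
\<close>

lemma coord_nonzero:
  assumes 0: "F (x, t) = 0"
  shows "coord i x \<noteq> 0"
proof
  assume xi: "coord i x = 0"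
  have x: "x \<in> G" using 0 by (simp add: F_zero_iff)
  \<comment> \<open>The pivots at which the triangular shape imposes nothing on coordinate
    \<open>i\<close>. At most \<open>CARD('n) - 1\<close> are excluded, so two remain.\<close>
  define Q where "Q = P - s ` {k. ord k < ord i}"
  have "card (s ` {k. ord k < ord i}) \<le> card (UNIV - {i})"
    by (rule order.trans[OF card_image_le card_mono]) auto
  then have "card (s ` {k. ord k < ord i}) < CARD('n)"
    by (simp add: card_Diff_singleton)
      (metis One_nat_def Suc_le_eq diff_Suc_less le_less_trans zero_less_card_finite)
  then have "2 \<le> card Q"
    using card_P diff_card_le_card_Diff[of "s ` {k. ord k < ord i}" P] unfolding Q_def by simp
  then obtain a b where ab: "a \<in> Q" "b \<in> Q" "a \<noteq> b"
    by (metis card_le_Suc0_iff_eq finite numeral_2_eq_2 not_less_eq_eq)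
  define c :: "'v \<Rightarrow> ('n, 'v) framework" where "c j = (\<chi> v. axis i (\<kappa> j $ v))" for j
  have c_nth: "c j $ v $ k = (if k = i then \<kappa> j $ v else 0)" for j v k by (simp add: c_def axis_def)
  have F'c: "F' (x, t) (c j, 0) = 0" if "j \<in> Q" for j
  proof -
    have jP: "j \<in> P" using that by (simp add: Q_def)
    have "coord k (c j) = (if k = i then \<kappa> j else 0)" for k
      by (simp add: vec_eq_iff coord_nth c_nth)
    moreover have "\<kappa> j $ s k = 0" if "ord k < ord i" for k
      using kappa[OF s_P jP, of k] \<open>j \<in> Q\<close> that by (auto simp: Q_def)
    ultimately have cG: "c j \<in> G"
      using kappa_kernel[OF jP] kappa_z[OF jP] subspace_0[OF subspace_stress_kernel[of E \<rho>]]
      by (auto simp: G_def c_nth vec_eq_iff[of "c j $ z"])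
    have "(x $ u - x $ v) \<bullet> (c j $ u - c j $ v) = 0" for u v
    proof -
      have "c j $ u - c j $ v = axis i (\<kappa> j $ u - \<kappa> j $ v)" by (simp add: c_def axis_def vec_eq_iff)
      moreover have "x $ u $ i = 0" for u using arg_cong[OF xi, of "\<lambda>y. y $ u"] by (simp add: coord_nth)
      ultimately show ?thesis by (simp add: inner_axis)
    qed
    then have "rig E x (c j) = 0" by (simp add: vec_eq_iff rig_nth)
    then show ?thesis by (simp add: F'_def pr(3)[OF x] pr(3)[OF cG] linear_0[OF J(2)])
  qed
  \<comment> \<open>Surjectivity makes the kernel a line, but the displacements \<open>c a\<close>
    and \<open>c b\<close> are independent.\<close>
  obtain v where v: "{y. F' (x, t) y = 0} = span {v}"
    using surj_kernel_line[OF has_derivative_linear[OF F_derivative] F'_surj[OF 0]] by metis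
  have "(c a, 0) \<in> span {v}" "(c b, 0) \<in> span {v}" using F'c ab unfolding v[symmetric] by auto
  then obtain \<alpha> \<beta> where \<alpha>: "(c a, 0) = \<alpha> *\<^sub>R v" and \<beta>: "(c b, 0) = \<beta> *\<^sub>R v" by (auto simp: span_singleton)
  have abP: "a \<in> P" "b \<in> P" using ab by (auto simp: Q_def)
  have "c a $ a $ i = \<alpha> * fst v $ a $ i" "c b $ a $ i = \<beta> * fst v $ a $ i" "c b $ b $ i = \<beta> * fst v $ b $ i"
    using arg_cong[OF \<alpha>, of fst] arg_cong[OF \<beta>, of fst] by auto
  then have "1 = \<alpha> * fst v $ a $ i" "0 = \<beta> * fst v $ a $ i" "1 = \<beta> * fst v $ b $ i"
    using ab abP by (simp_all add: c_nth kappa)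
  then show False by auto
qed

lemma arc_end_incongruent:
  assumes \<gamma>: "arc \<gamma>" "path_image \<gamma> \<subseteq> C" "openin (top_of_set C) (path_image \<gamma>)"
    and ends: "pathstart \<gamma> = (\<tau>, 0)" "pathfinish \<gamma> = (\<sigma>, 0)"
  shows "rig UNIV \<tau> \<tau> \<noteq> rig UNIV \<sigma> \<sigma>"
proof
  assume cong: "rig UNIV \<tau> \<tau> = rig UNIV \<sigma> \<sigma>"
  have fin: "(\<sigma>, 0) \<in> path_image \<gamma>" using ends(2) by (metis pathfinish_in_path_image)
  then have \<sigma>: "\<sigma> \<in> G" using \<gamma>(2) by (auto simp: C_iff)
  moreover have "\<sigma> \<noteq> \<tau>" using arc_distinct_ends[OF \<gamma>(1)] ends by auto
  ultimately obtain U \<epsilon> i where U: "orthogonal_transformation U" "\<And>v. \<sigma> $ v = U (\<tau> $ v)"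
    and Ux: "\<And>x k. U x $ k = \<epsilon> k * x $ k" and i: "\<epsilon> (i :: 'n) = (-1 :: real)"
    using congruent_in_G[OF _ cong] by metis
  have lin: "linear U" and ip: "U x \<bullet> U y = x \<bullet> y" for x y
    using U(1) by (simp_all add: orthogonal_transformation_def)
  \<comment> \<open>Sign changes respect \<open>K\<close> and the triangular zeros, so
    \<open>\<Theta>\<close> acts on \<open>C\<close>; it takes the start of the arc to its
    end.\<close>
  define \<Theta> where "\<Theta> y = (\<chi> v. U (fst y $ v), snd y)" for y :: "('n, 'v) framework \<times> real"
  have "linear \<Theta>"
    by (rule linearI) (auto simp: \<Theta>_def vec_eq_iff linear_add[OF lin] linear_scale[OF lin])
  then have cont: "continuous_on C \<Theta>" by (simp add: linear_continuous_on linear_linear)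
  have maps: "\<Theta> ` C \<subseteq> C"
  proof (rule image_subsetI)
    fix y assume "y \<in> C"
    obtain x t where y: "y = (x, t)" by (cases y)
    then have xt: "(x, t) \<in> C" using \<open>y \<in> C\<close> by simp
    have "coord k (\<chi> v. U (x $ v)) = \<epsilon> k *\<^sub>R coord k x" for k
      by (simp add: vec_eq_iff coord_nth Ux)
    then have "(\<chi> v. U (x $ v)) \<in> G"
      using xt subspace_scale[OF subspace_stress_kernel[of E \<rho>]] by (auto simp: C_iff G_def linear_0[OF lin] Ux)
    moreover have "rig E (\<chi> v. U (x $ v)) (\<chi> v. U (x $ v)) = rig E x x"
    proof -
      have "(U (x $ u) - U (x $ v)) \<bullet> (U (x $ u) - U (x $ v)) = (x $ u - x $ v) \<bullet> (x $ u - x $ v)" for u v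
        unfolding linear_diff[OF lin, symmetric] ip ..
      then show ?thesis unfolding rig_def vec_lambda_beta by (simp only:)
    qed
    ultimately show "\<Theta> y \<in> C" using xt by (simp add: y \<Theta>_def C_iff)
  qed
  have "\<Theta> (pathstart \<gamma>) = (\<sigma>, 0)" by (simp add: \<Theta>_def ends(1) vec_eq_iff U(2))
  then obtain y where y: "y \<in> path_image \<gamma>" "\<Theta> y = y"
    using open_arc_fixed_point[OF \<gamma> cont maps] fin by auto
  obtain x t where xt: "y = (x, t)" by (cases y)
  have "F (x, t) = 0" using y(1) \<gamma>(2) by (auto simp: C_def xt)
  moreover have "coord i x = 0"
  proof -
    have "x $ v $ i = \<epsilon> i * x $ v $ i" for v
    proof -
      have "(\<chi> v. U (x $ v)) = x" using y(2) by (simp add: \<Theta>_def xt)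
      then have "U (x $ v) = x $ v" by (metis vec_lambda_beta)
      then show ?thesis using Ux by metis
    qed
    then have "x $ v $ i = 0" for v using i by (metis equal_neg_zero mult_minus1)
    then show ?thesis by (simp add: vec_eq_iff coord_nth)
  qed
  ultimately show False using coord_nonzero by blast
qed

lemma incongruent_endpoint:
  "\<exists>\<sigma> :: ('n, 'v) framework. \<not> congruent_frameworks \<rho> \<sigma> \<and>
     connected_with_constant_lengths E (embed_framework \<rho>) (embed_framework \<sigma>)"
proof -
  have "F (\<tau>, 0) = 0" by (simp add: F_zero_iff tau_in_G)
  then obtain \<gamma> where \<gamma>: "arc \<gamma>" "path_image \<gamma> \<subseteq> C" "pathstart \<gamma> = (\<tau>, 0)" "snd (pathfinish \<gamma>) = 0"
      "openin (top_of_set C) (path_image \<gamma>)"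
    using regular_curve_arc[OF F_derivative F'_continuous F'_surj F'_flat, folded C_def, OF _ compact_C] by blast
  define \<sigma>' where "\<sigma>' = fst (pathfinish \<gamma>)"
  have fin: "pathfinish \<gamma> = (\<sigma>', 0)" using \<gamma>(4) by (simp add: \<sigma>'_def prod_eq_iff)
  have incong: "rig UNIV \<tau> \<tau> \<noteq> rig UNIV \<sigma>' \<sigma>'"
    using arc_end_incongruent[OF \<gamma>(1,2,5,3) fin] .
  \<comment> \<open>\<open>b\<close> undoes the rotation and the translation, so that the path
    starts at \<open>\<rho>\<close> itself.\<close>
  define b where "b x v = \<rho> $ z + adjoint T (x $ v)" for x :: "('n, 'v) framework" and v
  define \<Gamma> :: "('n, 'v) framework \<times> real \<Rightarrow> ('n option, 'v) framework"
    where "\<Gamma> y = (\<chi> v i. case i of None \<Rightarrow> snd y * w $ v | Some k \<Rightarrow> b (fst y) v $ k)" for y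
  define \<sigma> :: "('n, 'v) framework" where "\<sigma> = (\<chi> v. b \<sigma>' v)"
  have adj_norm: "adjoint T x \<bullet> adjoint T x = x \<bullet> x" for x
  proof -
    have "surj T" using T by (rule orthogonal_transformation_surj)
    then obtain y where "x = T y" by (metis surjD)
    then show ?thesis by (simp add: adjoint_T T_inner)
  qed
  have b_diff: "(b x u - b x v) \<bullet> (b x u - b x v) = (x $ u - x $ v) \<bullet> (x $ u - x $ v)" for x u v
  proof -
    have "b x u - b x v = adjoint T (x $ u - x $ v)"
      by (simp add: b_def linear_diff[OF adjoint_linear[OF linear_T]])
    then show ?thesis by (simp only: adj_norm)
  qed
  have rig_\<Gamma>: "rig E (\<Gamma> (x, t)) (\<Gamma> (x, t)) = rig E x x + t\<^sup>2 *\<^sub>R lw" for x t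
  proof -
    have "(\<Gamma> (x, t) $ u - \<Gamma> (x, t) $ v) \<bullet> (\<Gamma> (x, t) $ u - \<Gamma> (x, t) $ v) =
        (b x u - b x v) \<bullet> (b x u - b x v) + t\<^sup>2 * ((w $ u - w $ v) * (w $ u - w $ v))" for u v
      by (simp add: inner_vec_def \<Gamma>_def UNIV_option_conv sum.reindex power2_eq_square algebra_simps)
    then show ?thesis
      unfolding vec_eq_iff rig_def lw_def edge_prod_def by (simp add: b_diff)
  qed
  have "continuous_on S \<Gamma>" for S
  proof -
    have "continuous_on S (\<lambda>y. b (fst y) v)" for v
      unfolding b_def
      by (intro continuous_intros bounded_linear.continuous_on[of "adjoint T"])
        (simp add: linear_linear adjoint_linear[OF linear_T])
    then have "continuous_on S (\<lambda>y. case i of None \<Rightarrow> snd y * w $ v | Some k \<Rightarrow> b (fst y) v $ k)" for i v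
      by (cases i) (auto intro!: continuous_intros)
    then show ?thesis unfolding \<Gamma>_def by (intro continuous_intros)
  qed
  then have "path (\<Gamma> \<circ> \<gamma>)"
    using \<gamma>(1) unfolding arc_def path_def by (intro continuous_on_compose) auto
  moreover have "\<Gamma> (\<tau>, 0) = embed_framework \<rho>"
    by (auto simp: \<Gamma>_def embed_framework_def vec_eq_iff b_def \<tau>_def adjoint_T split: option.split)
  moreover have "\<Gamma> (\<sigma>', 0) = embed_framework \<sigma>"
    by (auto simp: \<Gamma>_def embed_framework_def vec_eq_iff \<sigma>_def split: option.split)
  moreover have "same_edge_lengths E ((\<Gamma> \<circ> \<gamma>) t) (embed_framework \<rho>)" if "t \<in> {0..1}" for t
  proof -
    obtain x r where xr: "\<gamma> t = (x, r)" by (cases "\<gamma> t")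
    then have "(x, r) \<in> C" using \<gamma>(2) that by (force simp: path_image_def)
    then show ?thesis by (simp add: same_edge_lengths_rig xr rig_\<Gamma> rig_embed C_iff rig_tau)
  qed
  ultimately have "connected_with_constant_lengths E (embed_framework \<rho>) (embed_framework \<sigma>)"
    unfolding connected_with_constant_lengths_def using \<gamma>(3) fin
    by (intro exI[of _ "\<Gamma> \<circ> \<gamma>"]) (auto simp: pathstart_def pathfinish_def)
  moreover have "rig UNIV \<sigma> \<sigma> = rig UNIV \<sigma>' \<sigma>'" unfolding rig_def \<sigma>_def vec_lambda_beta b_diff ..
  then have "\<not> congruent_frameworks \<rho> \<sigma>" using incong by (simp add: congruent_frameworks_rig rig_tau)
  ultimately show ?thesis by blast
qed

end

lemma rigid_large_kernel:
  fixes \<rho> :: "('n::finite, 'v::finite) framework"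
  assumes \<rho>: "generic_framework \<rho>" and rigid: "rigid E \<rho>" and K: "stress_kernel E \<rho> \<noteq> affine_kernel \<rho>"
  shows "\<exists>\<sigma> :: ('n, 'v) framework. \<not> congruent_frameworks \<rho> \<sigma> \<and>
    connected_with_constant_lengths E (embed_framework \<rho>) (embed_framework \<sigma>)"
proof -
  fix z :: 'v
  let ?K = "stress_kernel E \<rho>"
  define S where "S = {h \<in> ?K. h $ z = 0}"
  have "subspace S"
    using subspace_stress_kernel[of E \<rho>] by (auto simp: S_def subspace_def)
  then obtain P and \<kappa> :: "'v \<Rightarrow> real ^ 'v" where P: "\<And>h. h \<in> S \<Longrightarrow> (\<And>i. i \<in> P \<Longrightarrow> h $ i = 0) \<Longrightarrow> h = 0"
    and \<kappa>S: "\<And>j. j \<in> P \<Longrightarrow> \<kappa> j \<in> S"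
    and \<kappa>: "\<And>i j. i \<in> P \<Longrightarrow> j \<in> P \<Longrightarrow> \<kappa> j $ i = (if i = j then 1 else 0)"
    using subspace_pivots by blast
  have zP: "z \<notin> P" using \<kappa>[of z z] \<kappa>S[of z] by (auto simp: S_def)
  \<comment> \<open>Otherwise affine functions could match every function of the stress kernel at
    \<open>z\<close> and at all pivots, and the kernel would be affine.\<close>
  have card_P: "CARD('n) < card P"
  proof (rule ccontr)
    assume "\<not> CARD('n) < card P"
    then have ind: "\<forall>j\<in>P. a j = 0" if "(\<Sum>j\<in>P. a j *\<^sub>R (\<rho> $ j - \<rho> $ z)) = 0" for a
      using generic_points_independent[OF \<rho> _ zP that] by simp
    have "?K \<subseteq> affine_kernel \<rho>"
    proof
      fix h assume h: "h \<in> ?K"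
      obtain x where x: "\<And>j. j \<in> P \<Longrightarrow> x \<bullet> (\<rho> $ j - \<rho> $ z) = h $ j - h $ z"
        using family_solve[where J = P and r = "\<lambda>j. \<rho> $ j - \<rho> $ z" and b = "\<lambda>j. h $ j - h $ z"] ind by blast
      define g where "g = (\<chi> v. (h $ z - x \<bullet> \<rho> $ z) + x \<bullet> \<rho> $ v)"
      have g: "g \<in> affine_kernel \<rho>" unfolding affine_kernel_def g_def by force
      have "h - g = 0"
      proof (rule P)
        show "h - g \<in> S"
          using subspace_diff[OF subspace_stress_kernel h] g affine_kernel_subset[of \<rho> E]
          by (auto simp: S_def g_def)
        show "(h - g) $ i = 0" if "i \<in> P" for i
          using x[OF that] by (simp add: g_def inner_diff_right)
      qed
      with g show "h \<in> affine_kernel \<rho>" by simp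
    qed
    with K affine_kernel_subset[of \<rho> E] show False by blast
  qed
  obtain s :: "'n \<Rightarrow> 'v" where s: "range s \<subseteq> P" "inj s"
    using card_le_inj[of "UNIV :: 'n set" P] card_P by (metis finite less_imp_le)
  obtain ord :: "'n \<Rightarrow> nat" where ord: "inj ord"
    using finite_imp_inj_to_nat_seg[OF finite, where A = "UNIV :: 'n set"] by blast
  obtain T :: "real ^ 'n \<Rightarrow> real ^ 'n" where T: "orthogonal_transformation T"
      "\<And>i j. ord j < ord i \<Longrightarrow> T (\<rho> $ s j - \<rho> $ z) $ i = 0"
    using orthogonal_triangularization[OF ord, of "\<lambda>j. \<rho> $ s j - \<rho> $ z"] by blast
  interpret triangular_frame E \<rho> z P \<kappa> s ord T
    by unfold_locales (use \<rho> rigid P \<kappa>S \<kappa> card_P s ord T in \<open>auto simp: S_def\<close>)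
  show ?thesis by (rule incongruent_endpoint)
qed

theorem theorem1p18:
  fixes E :: "'v::finite set set"
    and \<rho> :: "('n::finite, 'v) framework"
  assumes "graph E"
    and "\<not> generically_globally_rigid TYPE('n) E"
    and "generic_framework \<rho>"
  shows "\<exists>\<sigma> :: ('n, 'v) framework.
           \<not> congruent_frameworks \<rho> \<sigma> \<and>
           connected_with_constant_lengths E (embed_framework \<rho>) (embed_framework \<sigma>)"
proof (cases "stress_kernel E \<rho> = affine_kernel \<rho>")
  case True
  \<comment> \<open>Global rigidity is only known to fail at some generic
    \<open>\<rho>\<^sub>0\<close>; the hypotheses of Connelly's theorem are transferred there from
    \<open>\<rho>\<close>.\<close>
  obtain \<rho>\<^sub>0 :: "('n, 'v) framework" where \<rho>\<^sub>0: "generic_framework \<rho>\<^sub>0" "\<not> globally_rigid E \<rho>\<^sub>0"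
    using assms(2) by (auto simp: generically_globally_rigid_def)
  have "\<not> rigid E \<rho>"
    using minimal_stress_kernel_globally_rigid[OF \<rho>\<^sub>0(1)] rigid_transfer[OF assms(3) \<rho>\<^sub>0(1)]
      affine_kernel_transfer[OF assms(3) \<rho>\<^sub>0(1) True] \<rho>\<^sub>0(2) by blast
  then show ?thesis using affine_flex[OF assms(3) _ True] by blast
next
  case False
  \<comment> \<open>More edges only restrict the admissible paths, so a path for \<open>F\<close>
    serves for \<open>E\<close>.\<close>
  obtain F where F: "E \<subseteq> F" "rigid F \<rho>" "stress_kernel F \<rho> = stress_kernel E \<rho>"
    by (rule rigid_extension)
  have "connected_with_constant_lengths F p q \<Longrightarrow> connected_with_constant_lengths E p q"
    for p q :: "('n option, 'v) framework"
    using F(1) unfolding connected_with_constant_lengths_def same_edge_lengths_def by blast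
  moreover obtain \<sigma> :: "('n, 'v) framework" where "\<not> congruent_frameworks \<rho> \<sigma>"
      "connected_with_constant_lengths F (embed_framework \<rho>) (embed_framework \<sigma>)"
    using rigid_large_kernel[OF assms(3) F(2)] F(3) False by auto
  ultimately show ?thesis by blast
qed

end
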